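(* Let $\rho(r)$ be a proximate order with $\rho(r)\to\rho$, let $u\in SH(\rho(r))$ and let $\sigma_M[u]:=\limsup_{r\to\infty}M(r,u)r^{-\rho(r)}$. Then: (fr1) $\mathbf{Fr}[u]$ is a connected compact set (in the topology of $\mathcal D'(\mathbb R^m)$); (fr2) $\mathbf{Fr}[u]\subset U[\rho,\sigma]$ for every $\sigma\ge\sigma_M[u]$; (fr3) $(\mathbf{Fr}[u])_{[t]}=\mathbf{Fr}[u]$ for every $t\in(0,\infty)$, where $(\mathbf{Fr}[u])_{[t]}=\{v_{[t]}:v\in\mathbf{Fr}[u]\}$; (fr4) if $\rho_1(r)$ is a proximate order equivalent to $\rho(r)$, i.e. $\rho_1(r)-\rho(r)=o(1/\log r)$ as $r\to\infty$, then the limit set of $u$ formed with $\rho_1(r)$ in place of $\rho(r)$ coincides with the limit set formed with $\rho(r)$ (same group $V_\bullet$).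
   Context: Fix $m\ge 2$ and $0<\rho<\infty$. A proximate order (with respect to $\rho$) is a function $\rho(r)\ge 0$ on $(0,\infty)$ with continuous derivative such that $\rho(r)\to\rho$ and $r\log r\,\rho'(r)\to 0$ as $r\to\infty$. Let $\{V_t:t\in(0,\infty)\}$ be a one-parameter group of rotations of $\mathbb R^m$, continuous in $t$: $V_{t_1}V_{t_2}=V_{t_1t_2}$, $V_1=I$; set $P_t:=tV_t$. Subharmonic functions are by definition not identically $-\infty$ and are identified with the regular distributions they define. $M(r,u)=\max_{|x|=r}u(x)$; $SH(\rho(r))$ is the set of subharmonic functions $u$ in $\mathbb R^m$ with $\limsup_{r\to\infty}M(r,u)r^{-\rho(r)}<\infty$. For such $u$, $u_t(x):=t^{-\rho(t)}u(P_tx)$. The limit set $\mathbf{Fr}[u]=\mathbf{Fr}[u,\rho(r),V_\bullet,\mathbb R^m]$ is the set of all subharmonic $v$ in $\mathbb R^m$ for which there is a sequence $t_k\to\infty$ with $u_{t_k}\to v$ in $\mathcal D'(\mathbb R^m)$. $U[\rho,\sigma]$ is the set of subharmonic $v$ in $\mathbb R^m$ with $v(0)=0$ and $M(r,v)\le\sigma r^\rho$ for all $r\ge0$. For a subharmonic $v$ and $t>0$, $v_{[t]}(x):=t^{-\rho}v(P_tx)$. *)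

theory Defs
  imports "HOL-Analysis.Analysis" "HOL-Library.Landau_Symbols"
begin

subsection \<open>Distributions\<close>

text \<open>Iterated partial derivatives in coordinate directions; the list \<open>bs\<close> plays the role
  of a multi-index.\<close>

fun partial_deriv :: "'a::euclidean_space list \<Rightarrow> ('a \<Rightarrow> real) \<Rightarrow> 'a \<Rightarrow> real" where
  "partial_deriv [] f = f"
| "partial_deriv (b # bs) f = (\<lambda>x. frechet_derivative (partial_deriv bs f) (at x) b)"

text \<open>If every iterated partial derivative is (totally) differentiable, then all of them are
  continuous, so this is the usual class of infinitely differentiable functions.\<close>

definition smooth :: "('a::euclidean_space \<Rightarrow> real) \<Rightarrow> bool" where
  "smooth f \<longleftrightarrow> (\<forall>bs\<in>lists Basis. \<forall>x. partial_deriv bs f differentiable (at x))"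

definition test_functions :: "('a::euclidean_space \<Rightarrow> real) set" where
  "test_functions = {\<phi>. smooth \<phi> \<and> compact (closure {x. \<phi> x \<noteq> 0})}"

definition test_convergent ::
    "(nat \<Rightarrow> 'a::euclidean_space \<Rightarrow> real) \<Rightarrow> ('a \<Rightarrow> real) \<Rightarrow> bool" where
  "test_convergent \<phi> \<psi> \<longleftrightarrow>
     (\<exists>K. compact K \<and> (\<forall>n. {x. \<phi> n x \<noteq> 0} \<subseteq> K)) \<and>
     (\<forall>bs\<in>lists Basis.
        uniform_limit UNIV (\<lambda>n. partial_deriv bs (\<phi> n)) (partial_deriv bs \<psi>) sequentially)"

text \<open>Continuous linear functionals on the space of test functions. Sequential continuity and
  continuity agree for linear functionals on this space. Functionals are represented as functions
  that are \<open>undefined\<close> off the test functions, so that equality of distributions is HOL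
  equality.\<close>

definition distributions :: "(('a::euclidean_space \<Rightarrow> real) \<Rightarrow> real) set" where
  "distributions = {T \<in> extensional test_functions.
     (\<forall>\<phi>\<in>test_functions. \<forall>\<psi>\<in>test_functions. \<forall>a b.
        T (\<lambda>x. a * \<phi> x + b * \<psi> x) = a * T \<phi> + b * T \<psi>) \<and>
     (\<forall>\<phi> \<psi>. (\<forall>n. \<phi> n \<in> test_functions) \<and> \<psi> \<in> test_functions \<and> test_convergent \<phi> \<psi>
        \<longrightarrow> (\<lambda>n. T (\<phi> n)) \<longlonglongrightarrow> T \<psi>)}"

text \<open>The weak topology: convergence is convergence on each test function.\<close>

definition distribution_topology :: "(('a::euclidean_space \<Rightarrow> real) \<Rightarrow> real) topology" where
  "distribution_topology =
     subtopology (product_topology (\<lambda>_. euclideanreal) test_functions) distributions"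

text \<open>The regular distribution of a function that is finite almost everywhere and locally
  integrable. The conversion sends the value \<open>-\<infinity>\<close> to \<open>0\<close>, which
  only affects a null set.\<close>

definition regular_distribution ::
    "('a::euclidean_space \<Rightarrow> ereal) \<Rightarrow> ('a \<Rightarrow> real) \<Rightarrow> real" where
  "regular_distribution u =
     (\<lambda>\<phi>\<in>test_functions. \<integral>x. real_of_ereal (u x) * \<phi> x \<partial>lborel)"


subsection \<open>Subharmonic functions\<close>

text \<open>The normalised surface measure on the unit sphere, as the image of the uniform
  distribution on the unit ball under radial projection (\<open>sgn x = x / norm x\<close>).\<close>

definition sphere_measure :: "'a::euclidean_space measure" where
  "sphere_measure = distr (uniform_measure lborel (ball 0 1)) borel sgn"

text \<open>The mean over the sphere with centre \<open>x\<close> and radius \<open>r\<close>. It may be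
  \<open>-\<infinity>\<close>; it is meaningful whenever \<open>u\<close> is bounded above on that
  sphere, as the first integral is then finite. Note that \<open>e2ennreal\<close> maps negative
  arguments to \<open>0\<close>.\<close>

definition sphere_mean :: "('a::euclidean_space \<Rightarrow> ereal) \<Rightarrow> 'a \<Rightarrow> real \<Rightarrow> ereal" where
  "sphere_mean u x r =
     enn2ereal (\<integral>\<^sup>+ s. e2ennreal (u (x + r *\<^sub>R s)) \<partial>sphere_measure) -
     enn2ereal (\<integral>\<^sup>+ s. e2ennreal (- u (x + r *\<^sub>R s)) \<partial>sphere_measure)"

text \<open>Subharmonicity in the whole space: values in \<open>[-\<infinity>, \<infinity>)\<close>, not
  identically \<open>-\<infinity>\<close>, upper semicontinuous, and satisfying the sub-mean-value
  inequality on spheres.\<close>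

definition subharmonic :: "('a::euclidean_space \<Rightarrow> ereal) \<Rightarrow> bool" where
  "subharmonic u \<longleftrightarrow>
     (\<forall>x. u x \<noteq> \<infinity>) \<and> (\<exists>x. u x \<noteq> -\<infinity>) \<and>
     (\<forall>a. open {x. u x < a}) \<and>
     (\<forall>x. \<forall>r>0. u x \<le> sphere_mean u x r)"

definition sphere_max :: "real \<Rightarrow> ('a::euclidean_space \<Rightarrow> ereal) \<Rightarrow> ereal" where
  "sphere_max r u = (SUP x\<in>sphere 0 r. u x)"


subsection \<open>Growth with respect to a proximate order\<close>

definition proximate_order :: "real \<Rightarrow> (real \<Rightarrow> real) \<Rightarrow> bool" where
  "proximate_order \<rho> p \<longleftrightarrow>
     (\<forall>r>0. p r \<ge> 0) \<and> (p \<longlongrightarrow> \<rho>) at_top \<and>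
     (\<exists>p'. (\<forall>r>0. (p has_real_derivative p' r) (at r)) \<and> continuous_on {0<..} p' \<and>
           ((\<lambda>r. r * ln r * p' r) \<longlongrightarrow> 0) at_top)"

definition proximate_order_equiv :: "(real \<Rightarrow> real) \<Rightarrow> (real \<Rightarrow> real) \<Rightarrow> bool" where
  "proximate_order_equiv p\<^sub>1 p \<longleftrightarrow> (\<lambda>r. p\<^sub>1 r - p r) \<in> o[at_top](\<lambda>r. 1 / ln r)"

definition growth_type :: "(real \<Rightarrow> real) \<Rightarrow> ('a::euclidean_space \<Rightarrow> ereal) \<Rightarrow> ereal" where
  "growth_type p u = Limsup at_top (\<lambda>r. sphere_max r u * ereal (r powr (- p r)))"

definition SH :: "(real \<Rightarrow> real) \<Rightarrow> ('a::euclidean_space \<Rightarrow> ereal) set" where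
  "SH p = {u. subharmonic u \<and> growth_type p u < \<infinity>}"

definition U :: "real \<Rightarrow> real \<Rightarrow> ('a::euclidean_space \<Rightarrow> ereal) set" where
  "U \<rho> \<sigma> = {v. subharmonic v \<and> v 0 = 0 \<and>
     (\<forall>r\<ge>0. sphere_max r v \<le> ereal (\<sigma> * r powr \<rho>))}"


subsection \<open>Limit sets\<close>

definition rotation_group :: "(real \<Rightarrow> real^'m^'m) \<Rightarrow> bool" where
  "rotation_group V \<longleftrightarrow>
     (\<forall>t>0. rotation_matrix (V t)) \<and> continuous_on {0<..} V \<and>
     (\<forall>s>0. \<forall>t>0. V s ** V t = V (s * t)) \<and> V 1 = mat 1"

definition rot_dilation :: "(real \<Rightarrow> real^'m^'m) \<Rightarrow> real \<Rightarrow> real^'m \<Rightarrow> real^'m" where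
  "rot_dilation V t x = t *\<^sub>R (V t *v x)"

text \<open>The functions \<open>u\<^sub>t(x) = t\<^bsup>-\<rho>(t)\<^esup> u(P\<^sub>t x)\<close> and
  \<open>v\<^bsub>[t]\<^esub>(x) = t\<^bsup>-\<rho>\<^esup> v(P\<^sub>t x)\<close>.\<close>

definition rescale ::
    "(real \<Rightarrow> real) \<Rightarrow> (real \<Rightarrow> real^'m^'m) \<Rightarrow> (real^'m \<Rightarrow> ereal) \<Rightarrow> real \<Rightarrow> real^'m \<Rightarrow> ereal" where
  "rescale p V u t x = ereal (t powr (- p t)) * u (rot_dilation V t x)"

definition rescale_const ::
    "real \<Rightarrow> (real \<Rightarrow> real^'m^'m) \<Rightarrow> (real^'m \<Rightarrow> ereal) \<Rightarrow> real \<Rightarrow> real^'m \<Rightarrow> ereal" where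
  "rescale_const \<rho> V v t x = ereal (t powr (- \<rho>)) * v (rot_dilation V t x)"

definition Fr ::
    "(real \<Rightarrow> real) \<Rightarrow> (real \<Rightarrow> real^'m^'m) \<Rightarrow> (real^'m \<Rightarrow> ereal) \<Rightarrow> (real^'m \<Rightarrow> ereal) set" where
  "Fr p V u = {v. subharmonic v \<and>
     (\<exists>t :: nat \<Rightarrow> real. (\<forall>k. t k > 0) \<and> filterlim t at_top sequentially \<and>
        limitin distribution_topology (\<lambda>k. regular_distribution (rescale p V u (t k)))
          (regular_distribution v) sequentially)}"

end

theory Submission
  imports Defs "HOL-Probability.Probability_Measure"
begin

text \<open>Let \<open>f\<^sub>R\<close> be the mean of a subharmonic function \<open>u\<close> against a radial bump of radius \<open>R\<close>.
  The sub-mean-value inequality gives \<open>u \<le> f\<^sub>R\<close>, and \<open>f\<^sub>R \<rightarrow> u\<close> as \<open>R \<rightarrow> 0\<close> by upper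
  semicontinuity. The bump is chosen so that its dilations have a radial derivative which is the
  Laplacian of a nonnegative function of compact support; since subharmonic functions pair
  nonnegatively with such Laplacians, \<open>f\<^sub>R\<close> increases with \<open>R\<close>. Hence the means of the rescaled
  functions \<open>u\<^sub>t\<close> over balls centred at the origin are bounded below by a quantity tending to \<open>0\<close>,
  which together with the growth bound makes the family \<open>u\<^sub>t\<close> bounded in \<open>L\<^sup>1\<close> on balls.
  Convergence against countably many bumps then forces convergence in the sense of distributions
  to the subharmonic function \<open>inf\<^sub>R lim f\<^sub>R\<close>. Consequently the limit set is the intersection of
  the weak closures of the curves \<open>{u\<^sub>t : t \<ge> n}\<close>, which are compact, connected and nested.\<close>


subsection \<open>Smooth bump functions\<close>

text \<open>The lower bound on the rescaled functions rests on a scaling identity: the radial mean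
  of u_t at the origin with radius R is the mean of u with radius tR divided by t^\<rho>(t).
  Monotonicity in the radius replaces tR by R for t \<ge> 1, so the numerator becomes a fixed
  number, finite even if u(0) = -\<infinity>, and the quotient tends to 0 because \<rho> > 0. The
  same bound gives v(0) \<ge> 0 for every limit v. Monotonicity comes from an explicit bump:
  exp(-1/s) has derivative exp(-1/s)/s^2, so with the latter profile at s = 1 - |y|^2 the field y
  bump(y) is minus the gradient of a function in closed form with compact support. In this way u
  itself is never differentiated. A second obstacle is the weak topology, a product over uncountably
  many test functions: a point of a closure is not at once the limit of a sequence. A subharmonic
  function is however determined by countably many numbers, its means of radii 1/(j+1) at the points
  of a countable dense set, and these identify the limit.\<close>

definition flat :: "nat \<Rightarrow> real \<Rightarrow> real" where
  "flat n s = (if 0 < s then exp (- (1 / s)) / s ^ n else 0)"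

lemma flat_nonneg: "0 \<le> flat n s"
  by (simp add: flat_def)

lemma flat_eq_0: "s \<le> 0 \<Longrightarrow> flat n s = 0"
  by (simp add: flat_def)

lemma flat_tendsto_0: "(flat n \<longlongrightarrow> 0) (at 0)"
proof -
  have "((\<lambda>s. (inverse s)^n / exp (inverse s)) \<longlongrightarrow> 0) (at_right (0::real))"
    by (rule filterlim_compose[OF tendsto_power_div_exp_0 filterlim_inverse_at_top_right])
  then have "(flat n \<longlongrightarrow> 0) (at_right 0)"
  proof (rule Lim_transform_eventually)
    show "\<forall>\<^sub>F s in at_right 0. inverse s ^ n / exp (inverse s) = flat n s"
      unfolding eventually_at_right_field
      by (intro exI[of _ 1])
         (auto simp: flat_def exp_minus power_inverse inverse_eq_divide field_simps)
  qed
  moreover have "(flat n \<longlongrightarrow> 0) (at_left 0)"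
    by (rule Lim_transform_eventually[OF tendsto_const])
       (auto simp: flat_def eventually_at_left_field intro!: exI[of _ "-1"])
  ultimately show ?thesis
    by (simp add: filterlim_split_at)
qed

definition flat' :: "nat \<Rightarrow> real \<Rightarrow> real" where
  "flat' n s = flat (n + 2) s - real n * flat (n + 1) s"

text \<open>The functions \<open>flat n\<close>, taken over all n, are closed under differentiation
  up to linear combinations, which is why the exponent is a parameter. At 0 the difference quotient
  of \<open>flat n\<close> is \<open>flat (Suc n)\<close>, which tends to 0.\<close>

lemma DERIV_flat: "(flat n has_real_derivative flat' n s) (at s)"
proof -
  consider "s > 0" | "s < 0" | "s = 0" by linarith
  then show ?thesis
  proof cases
    case 1
    have "((\<lambda>s. exp (- (1 / s)) / s ^ n) has_real_derivative flat' n s) (at s)"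
    proof (cases n)
      case 0
      then show ?thesis using 1
        by (auto intro!: derivative_eq_intros simp: flat_def flat'_def power2_eq_square)
    next
      case (Suc k)
      then show ?thesis using 1
        by (auto intro!: derivative_eq_intros simp: flat_def flat'_def field_simps power2_eq_square)
           (cases k; simp add: field_simps)
    qed
    then show ?thesis
      by (rule has_field_derivative_transform_within_open[where S="{0<..}"])
         (use 1 in \<open>auto simp: flat_def\<close>)
  next
    case 2
    have "((\<lambda>s. 0) has_real_derivative flat' n s) (at s)"
      using 2 by (auto simp: flat_def flat'_def)
    then show ?thesis
      by (rule has_field_derivative_transform_within_open[where S="{..<0}"])
         (use 2 in \<open>auto simp: flat_def\<close>)
  next
    case 3
    have "((\<lambda>h. flat n h / h) \<longlongrightarrow> 0) (at 0)"
      by (rule Lim_transform_eventually[OF flat_tendsto_0[of "Suc n"]])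
         (auto simp: flat_def eventually_at_filter)
    then show ?thesis
      using 3 by (simp add: DERIV_def flat_eq_0 flat'_def)
  qed
qed

lemma isCont_flat: "isCont (flat n) s"
  using DERIV_flat DERIV_isCont by blast

lemma continuous_on_flat [continuous_intros]:
  "continuous_on S f \<Longrightarrow> continuous_on S (\<lambda>x. flat n (f x))"
  using continuous_on_compose2[of UNIV "flat n" S f] isCont_flat
  by (auto simp: continuous_at_imp_continuous_on)

lemma continuous_on_flat' [continuous_intros]:
  "continuous_on S f \<Longrightarrow> continuous_on S (\<lambda>x. flat' n (f x))"
  unfolding flat'_def by (intro continuous_intros)

text \<open>\<open>smooth\<close> quantifies over all iterated partials, so an invariant is enough:
  a set of differentiable functions that every partial derivative maps into itself.\<close>

lemma smooth_if_closed_under_partials: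
  assumes diff: "\<And>f x. f \<in> S \<Longrightarrow> f differentiable (at x)"
    and closed: "\<And>f b. f \<in> S \<Longrightarrow> b \<in> Basis \<Longrightarrow> (\<lambda>x. frechet_derivative f (at x) b) \<in> S"
    and "f \<in> S"
  shows "smooth f"
proof -
  have "partial_deriv bs f \<in> S" if "bs \<in> lists Basis" for bs
    using that by (induction bs) (auto simp: closed \<open>f \<in> S\<close>)
  then show ?thesis
    unfolding smooth_def using diff by blast
qed

text \<open>The algebra generated by the constants, the affine functions vanishing at
  \<open>x0\<close> and the functions \<open>flat n\<close> of 1 - |x - x0|^2 / R^2. All exponents n
  are included to make it stable under partial derivatives.\<close>

inductive_set flat_algebra :: "('a::euclidean_space) \<Rightarrow> real \<Rightarrow> ('a \<Rightarrow> real) set" for x0 R where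
  const: "(\<lambda>x. c) \<in> flat_algebra x0 R"
| inner: "(\<lambda>x. (x - x0) \<bullet> b) \<in> flat_algebra x0 R"
| flat: "(\<lambda>x. flat n (1 - (norm (x - x0) / R)\<^sup>2)) \<in> flat_algebra x0 R"
| add: "f \<in> flat_algebra x0 R \<Longrightarrow> g \<in> flat_algebra x0 R \<Longrightarrow> (\<lambda>x. f x + g x) \<in> flat_algebra x0 R"
| mult: "f \<in> flat_algebra x0 R \<Longrightarrow> g \<in> flat_algebra x0 R \<Longrightarrow> (\<lambda>x. f x * g x) \<in> flat_algebra x0 R"

lemma has_derivative_flat_norm:
  "((\<lambda>x. flat n (1 - (norm (x - x0) / R)\<^sup>2)) has_derivative
     (\<lambda>h. (- 2 / R\<^sup>2) * (((x - x0) \<bullet> h) * flat' n (1 - (norm (x - x0) / R)\<^sup>2)))) (at x)"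
proof -
  have "((\<lambda>x. 1 - c * ((x - x0) \<bullet> (x - x0))) has_derivative (\<lambda>h. - 2 * c * ((x - x0) \<bullet> h))) (at x)"
    for c
    by (auto intro!: derivative_eq_intros ext simp: inner_commute algebra_simps)
  from has_derivative_compose[OF this[of "1 / R\<^sup>2"] DERIV_flat[unfolded has_field_derivative_def]]
  show ?thesis by (simp add: mult_ac power_divide power2_norm_eq_inner)
qed

lemma flat_algebra_has_derivative:
  assumes "f \<in> flat_algebra x0 R"
  shows "\<exists>f'. (\<forall>x. (f has_derivative f' x) (at x)) \<and> (\<forall>b. (\<lambda>x. f' x b) \<in> flat_algebra x0 R)"
  using assms
proof induction
  case (const c)
  show ?case
    by (rule exI[of _ "\<lambda>x h. 0"]) (auto intro!: flat_algebra.const derivative_eq_intros)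
next
  case (inner b)
  show ?case
    by (rule exI[of _ "\<lambda>x h. h \<bullet> b"]) (auto intro!: flat_algebra.const derivative_eq_intros)
next
  case (flat n)
  have "(\<lambda>x. flat' n (1 - (norm (x - x0) / R)\<^sup>2)) \<in> flat_algebra x0 R"
    using flat_algebra.add[OF flat_algebra.flat[of "n+2" x0 R]
        flat_algebra.mult[OF flat_algebra.const[of "- real n"] flat_algebra.flat[of "n+1" x0 R]]]
    by (simp add: flat'_def)
  then show ?case
    by (intro exI[of _ "\<lambda>x h. (- 2 / R\<^sup>2) * (((x - x0) \<bullet> h) * flat' n (1 - (norm (x - x0) / R)\<^sup>2))"])
       (intro conjI allI has_derivative_flat_norm flat_algebra.intros)
next
  case (add f g)
  then obtain f' g' where
    "\<forall>x. (f has_derivative f' x) (at x)" "\<forall>b. (\<lambda>x. f' x b) \<in> flat_algebra x0 R"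
    "\<forall>x. (g has_derivative g' x) (at x)" "\<forall>b. (\<lambda>x. g' x b) \<in> flat_algebra x0 R"
    by blast
  then show ?case
    by (intro exI[of _ "\<lambda>x h. f' x h + g' x h"])
       (auto intro!: has_derivative_add flat_algebra.intros)
next
  case (mult f g)
  then obtain f' g' where
    "\<forall>x. (f has_derivative f' x) (at x)" "\<forall>b. (\<lambda>x. f' x b) \<in> flat_algebra x0 R"
    "\<forall>x. (g has_derivative g' x) (at x)" "\<forall>b. (\<lambda>x. g' x b) \<in> flat_algebra x0 R"
    by blast
  with mult show ?case
    by (intro exI[of _ "\<lambda>x h. f x * g' x h + f' x h * g x"])
       (auto intro!: has_derivative_mult flat_algebra.intros)
qed

lemma smooth_flat_algebra:
  assumes "f \<in> flat_algebra x0 R"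
  shows "smooth f"
proof (rule smooth_if_closed_under_partials[OF _ _ assms])
  fix f :: "'a \<Rightarrow> real" assume "f \<in> flat_algebra x0 R"
  then obtain f' where f': "\<And>x. (f has_derivative f' x) (at x)"
      "\<And>b. (\<lambda>x. f' x b) \<in> flat_algebra x0 R"
    using flat_algebra_has_derivative by blast
  show "f differentiable (at x)" for x
    using f' by (auto simp: differentiable_def)
  show "(\<lambda>x. frechet_derivative f (at x) b) \<in> flat_algebra x0 R" for b
    using f'(2)[of b] by (simp add: frechet_derivative_at[OF f'(1), symmetric])
qed

subsection \<open>Isometries and polar coordinates\<close>

lemma nn_integral_lborel_affine:
  fixes f :: "'a::euclidean_space \<Rightarrow> ennreal"
  assumes [measurable]: "f \<in> borel_measurable borel" and "c \<noteq> 0"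
  shows "(\<integral>\<^sup>+x. f x \<partial>lborel) = ennreal (\<bar>c\<bar> ^ DIM('a)) * (\<integral>\<^sup>+x. f (t + c *\<^sub>R x) \<partial>lborel)"
  by (subst lborel_affine[OF \<open>c \<noteq> 0\<close>, of t])
     (simp add: nn_integral_density nn_integral_distr nn_integral_cmult)

lemma integral_lborel_affine:
  fixes f :: "'a::euclidean_space \<Rightarrow> real"
  assumes [measurable]: "f \<in> borel_measurable borel" and "c \<noteq> 0"
  shows "integrable lborel (\<lambda>x. f (t + c *\<^sub>R x)) \<longleftrightarrow> integrable lborel f"
    and "(\<integral>x. f x \<partial>lborel) = \<bar>c\<bar> ^ DIM('a) * (\<integral>x. f (t + c *\<^sub>R x) \<partial>lborel)"
proof -
  show "integrable lborel (\<lambda>x. f (t + c *\<^sub>R x)) \<longleftrightarrow> integrable lborel f"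
    using \<open>c \<noteq> 0\<close>
    by (subst (2) lborel_affine[OF \<open>c \<noteq> 0\<close>, of t])
       (simp add: integrable_density integrable_distr_eq)
  show "(\<integral>x. f x \<partial>lborel) = \<bar>c\<bar> ^ DIM('a) * (\<integral>x. f (t + c *\<^sub>R x) \<partial>lborel)"
    by (subst lborel_affine[OF \<open>c \<noteq> 0\<close>, of t])
       (simp add: integral_density integral_distr)
qed

lemma orthogonal_transformation_measurable:
  fixes g :: "'a::euclidean_space \<Rightarrow> 'a"
  assumes "orthogonal_transformation g"
  shows "g \<in> borel_measurable borel"
  using linear_continuous_on[OF linear_conv_bounded_linear[THEN iffD1,
        OF orthogonal_transformation_linear[OF assms]]]
  by (rule borel_measurable_continuous_onI)

lemma emeasure_ball_0_1:
  "emeasure lborel (ball (0::'a::euclidean_space) 1) \<noteq> 0"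
  "emeasure lborel (ball (0::'a::euclidean_space) 1) \<noteq> \<infinity>"
proof -
  have "\<not> negligible (ball (0::'a) 1)" by (intro open_not_negligible) auto
  then show "emeasure lborel (ball (0::'a::euclidean_space) 1) \<noteq> 0"
    by (auto simp: negligible_iff_emeasure0 emeasure_completion)
  show "emeasure lborel (ball (0::'a::euclidean_space) 1) \<noteq> \<infinity>"
    using emeasure_bounded_finite[of "ball (0::'a) 1"] by auto
qed

text \<open>Weighing both sides with the unit ball, on which the isometry acts trivially, reduces the
  claim to translation invariance.\<close>

lemma nn_integral_lborel_orthogonal:
  fixes g :: "'a::euclidean_space \<Rightarrow> 'a"
  assumes g: "orthogonal_transformation g" and [measurable]: "f \<in> borel_measurable borel"
  shows "(\<integral>\<^sup>+x. f (g x) \<partial>lborel) = (\<integral>\<^sup>+x. f x \<partial>lborel)"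
proof -
  note [measurable] = orthogonal_transformation_measurable[OF g]
  have transl: "(\<integral>\<^sup>+x. h (t + x) \<partial>lborel) = (\<integral>\<^sup>+x. h x \<partial>lborel)"
    if "h \<in> borel_measurable borel" for h :: "'a \<Rightarrow> ennreal" and t
    using nn_integral_lborel_affine[OF that, of 1 t] by simp
  obtain k where k: "orthogonal_transformation k" and kg: "\<And>x. k (g x) = x" "\<And>x. g (k x) = x"
    using g orthogonal_transformation_bij[OF g] orthogonal_transformation_inv[OF g]
    by (metis bij_inv_eq_iff)
  define B where "B = emeasure lborel (ball (0::'a) 1)"
  let ?i = "indicator (ball (0::'a) 1) :: 'a \<Rightarrow> ennreal"
  have [measurable]: "?i \<in> borel_measurable borel"
    by (rule borel_measurable_indicator) simp
  \<comment> \<open>The indicator is that of the unit ball about \<open>k y\<close>, with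
    \<open>k\<close> the inverse of \<open>g\<close>, so the volume depends neither on y nor on
    g.\<close>
  have inner: "(\<integral>\<^sup>+x. ?i (y - g x) \<partial>lborel) = B" for y
  proof -
    have "?i (y - g x) = indicator (ball (k y) 1) x" for x
    proof -
      have "norm (y - g x) = norm (k y - x)"
        using kg orthogonal_transformation_norm[OF k, of "y - g x"]
          orthogonal_transformation_linear[OF k]
        by (simp add: linear_diff)
      then show ?thesis by (auto simp: indicator_def dist_norm norm_minus_commute)
    qed
    then have "(\<integral>\<^sup>+x. ?i (y - g x) \<partial>lborel) = emeasure lborel (ball (k y) 1)" by simp
    also have "\<dots> = (\<integral>\<^sup>+x. indicator (ball (k y) 1) (k y + x) \<partial>lborel)"
      by (subst transl[OF borel_measurable_indicator]) simp_all
    also have "\<dots> = (\<integral>\<^sup>+x. ?i x \<partial>lborel)"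
      by (auto intro!: nn_integral_cong simp: indicator_def dist_norm)
    finally show ?thesis by (simp add: B_def)
  qed
  have "B * (\<integral>\<^sup>+x. f (g x) \<partial>lborel) = (\<integral>\<^sup>+y. ?i y * (\<integral>\<^sup>+x. f (g x) \<partial>lborel) \<partial>lborel)"
    by (subst nn_integral_multc) (simp_all add: B_def)
  \<comment> \<open>For fixed y the inner integral is translated by \<open>k y\<close>, which
    \<open>g\<close> sends to y. After the exchange of integrals the shift is undone in the variable
    y, and g survives only inside the unit ball.\<close>
  also have "\<dots> = (\<integral>\<^sup>+y. ?i y * (\<integral>\<^sup>+x. f (g x + y) \<partial>lborel) \<partial>lborel)"
  proof -
    have "(\<integral>\<^sup>+x. f (g (k y + x)) \<partial>lborel) = (\<integral>\<^sup>+x. f (g x) \<partial>lborel)" for y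
      by (rule transl) simp
    then show ?thesis
      using orthogonal_transformation_linear[OF g] by (simp add: linear_add kg add.commute)
  qed
  also have "\<dots> = (\<integral>\<^sup>+y. (\<integral>\<^sup>+x. ?i y * f (g x + y) \<partial>lborel) \<partial>lborel)"
    by (simp add: nn_integral_cmult)
  also have "\<dots> = (\<integral>\<^sup>+x. (\<integral>\<^sup>+y. ?i y * f (g x + y) \<partial>lborel) \<partial>lborel)"
    by (rule lborel_pair.Fubini') measurable
  also have "\<dots> = (\<integral>\<^sup>+x. (\<integral>\<^sup>+y. ?i (y - g x) * f y \<partial>lborel) \<partial>lborel)"
  proof (rule nn_integral_cong)
    fix x
    show "(\<integral>\<^sup>+y. ?i y * f (g x + y) \<partial>lborel) = (\<integral>\<^sup>+y. ?i (y - g x) * f y \<partial>lborel)"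
      using transl[of "\<lambda>y. ?i (y - g x) * f y" "g x"] by simp
  qed
  also have "\<dots> = (\<integral>\<^sup>+y. (\<integral>\<^sup>+x. ?i (y - g x) * f y \<partial>lborel) \<partial>lborel)"
    by (rule lborel_pair.Fubini') measurable
  also have "\<dots> = (\<integral>\<^sup>+y. B * f y \<partial>lborel)"
    by (simp add: nn_integral_multc inner)
  also have "\<dots> = B * (\<integral>\<^sup>+x. f x \<partial>lborel)"
    by (simp add: nn_integral_cmult)
  finally show ?thesis
    using emeasure_ball_0_1[where 'a='a] by (simp add: B_def ennreal_mult_cancel_left)
qed

lemma distr_lborel_orthogonal:
  fixes g :: "'a::euclidean_space \<Rightarrow> 'a"
  assumes g: "orthogonal_transformation g"
  shows "distr lborel borel g = lborel"
proof (rule measure_eqI)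
  note [measurable] = orthogonal_transformation_measurable[OF g]
  fix A assume "A \<in> sets (distr lborel borel g)"
  then have [measurable]: "A \<in> sets borel" by simp
  have "emeasure (distr lborel borel g) A = (\<integral>\<^sup>+x. indicator A x \<partial>distr lborel borel g)" by simp
  also have "\<dots> = (\<integral>\<^sup>+x. indicator A (g x) \<partial>lborel)" by (subst nn_integral_distr) auto
  also have "\<dots> = emeasure lborel A" by (subst nn_integral_lborel_orthogonal[OF g]) auto
  finally show "emeasure (distr lborel borel g) A = emeasure lborel A" .
qed simp

lemma integral_lborel_orthogonal:
  fixes g :: "'a::euclidean_space \<Rightarrow> 'a" and f :: "'a \<Rightarrow> real"
  assumes g: "orthogonal_transformation g" and [measurable]: "f \<in> borel_measurable borel"
  shows "integrable lborel (\<lambda>x. f (g x)) \<longleftrightarrow> integrable lborel f"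
    and "(\<integral>x. f (g x) \<partial>lborel) = (\<integral>x. f x \<partial>lborel)"
proof -
  note [measurable] = orthogonal_transformation_measurable[OF g]
  show "integrable lborel (\<lambda>x. f (g x)) \<longleftrightarrow> integrable lborel f"
    by (subst (2) distr_lborel_orthogonal[OF g, symmetric]) (simp add: integrable_distr_eq)
  show "(\<integral>x. f (g x) \<partial>lborel) = (\<integral>x. f x \<partial>lborel)"
    by (subst (2) distr_lborel_orthogonal[OF g, symmetric]) (simp add: integral_distr)
qed

section \<open>Surface measure of the sphere and integration in polar coordinates\<close>

lemma sets_sphere_measure [measurable_cong]:
  "sets (sphere_measure :: 'a::euclidean_space measure) = sets borel"
  by (simp add: sphere_measure_def)

lemma space_sphere_measure [simp]: "space (sphere_measure :: 'a::euclidean_space measure) = UNIV"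
  by (simp add: sphere_measure_def)

lemma sgn_measurable [measurable]:
  "(sgn :: 'a::euclidean_space \<Rightarrow> 'a) \<in> borel_measurable borel"
  unfolding sgn_div_norm by measurable

lemma prob_space_sphere_measure: "prob_space (sphere_measure :: 'a::euclidean_space measure)"
  unfolding sphere_measure_def
  using emeasure_ball_0_1
  by (intro prob_space.prob_space_distr prob_space_uniform_measure) auto

interpretation sphere_measure: prob_space "sphere_measure :: 'a::euclidean_space measure"
  by (rule prob_space_sphere_measure)

text \<open>Since \<open>sgn 0 = 0\<close>, the radial projection reaches the centre as well. The
  inequality holds on its whole image, and it keeps \<open>x + r *\<^sub>R s\<close> in the closed
  ball of radius r, which is its purpose.\<close>

lemma AE_sphere_measure_norm_le: "AE s in (sphere_measure :: 'a::euclidean_space measure). norm s \<le> 1"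
proof -
  have *: "{x \<in> space borel. norm (x::'a) \<le> 1} \<in> sets borel" by measurable
  show ?thesis
  unfolding sphere_measure_def
  by (subst AE_distr_iff[OF _ *]) (auto simp: norm_sgn)
qed

text \<open>An isometry commutes with \<open>sgn\<close> and maps the unit ball to itself preserving
  volume.\<close>

lemma distr_sphere_measure_orthogonal:
  fixes g :: "'a::euclidean_space \<Rightarrow> 'a"
  assumes g: "orthogonal_transformation g"
  shows "distr sphere_measure borel g = sphere_measure"
proof -
  note [measurable] = orthogonal_transformation_measurable[OF g]
  have [simp]: "g (sgn x) = sgn (g x)" for x
    using orthogonal_transformation_linear[OF g] orthogonal_transformation_norm[OF g]
    by (simp add: sgn_div_norm linear_scale)
  have um: "distr (uniform_measure lborel (ball 0 1)) borel g = uniform_measure lborel (ball 0 1)"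
  proof (rule measure_eqI)
    fix A assume "A \<in> sets (distr (uniform_measure lborel (ball 0 1)) borel g)"
    then have [measurable]: "A \<in> sets borel" by simp
    have m: "g -` A \<in> sets borel"
      using measurable_sets[OF orthogonal_transformation_measurable[OF g], of A] by simp
    have eq: "ball 0 1 \<inter> g -` A = g -` (ball 0 1 \<inter> A)"
      using orthogonal_transformation_norm[OF g] by auto
    have "emeasure lborel (g -` (ball 0 1 \<inter> A)) = emeasure (distr lborel borel g) (ball 0 1 \<inter> A)"
      by (subst emeasure_distr) auto
    then have *: "emeasure lborel (ball 0 1 \<inter> g -` A) = emeasure lborel (ball 0 1 \<inter> A)"
      by (simp add: eq distr_lborel_orthogonal[OF g])
    show "emeasure (distr (uniform_measure lborel (ball 0 1)) borel g) A
        = emeasure (uniform_measure lborel (ball 0 1)) A"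
      using m by (subst emeasure_distr) (auto simp: emeasure_uniform_measure *)
  qed simp
  have "distr sphere_measure borel g = distr (uniform_measure lborel (ball 0 1)) borel (\<lambda>x. g (sgn x))"
    unfolding sphere_measure_def by (subst distr_distr) (auto simp: o_def)
  also have "\<dots> = distr (distr (uniform_measure lborel (ball 0 1)) borel g) borel sgn"
    by (subst distr_distr) (auto simp: o_def)
  also have "\<dots> = sphere_measure"
    by (simp add: um sphere_measure_def)
  finally show ?thesis .
qed

text \<open>The cone over B is invariant under dilations, so both sides scale like r^n with n the
  dimension; at r = 1 the identity is the definition of \<open>sphere_measure\<close>.\<close>

lemma emeasure_ball_cone:
  assumes [measurable]: "B \<in> sets borel" and "0 < r"
  shows "emeasure lborel {y::'a::euclidean_space. norm y < r \<and> sgn y \<in> B} =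
    emeasure lborel (ball (0::'a) r) * emeasure sphere_measure B"
proof -
  let ?C = "{y::'a. norm y < 1 \<and> sgn y \<in> B}"
  have scale: "emeasure lborel {y::'a. norm y < r \<and> sgn y \<in> D} =
      ennreal (r ^ DIM('a)) * emeasure lborel {y::'a. norm y < 1 \<and> sgn y \<in> D}"
    if [measurable]: "D \<in> sets borel" for D
  proof -
    have "{y::'a. norm y < r \<and> sgn y \<in> D} \<in> sets borel" for r by measurable
    then have "emeasure lborel {y::'a. norm y < r \<and> sgn y \<in> D} =
        (\<integral>\<^sup>+y. indicator {y. norm y < r \<and> sgn y \<in> D} y \<partial>lborel)"
      by simp
    also have "\<dots> = ennreal (\<bar>r\<bar> ^ DIM('a)) *
        (\<integral>\<^sup>+y. indicator {y::'a. norm y < r \<and> sgn y \<in> D} (0 + r *\<^sub>R y) \<partial>lborel)"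
      using \<open>0 < r\<close> by (intro nn_integral_lborel_affine) auto
    also have "(\<lambda>y. indicator {y::'a. norm y < r \<and> sgn y \<in> D} (0 + r *\<^sub>R y) :: ennreal) =
        indicator {y. norm y < 1 \<and> sgn y \<in> D}"
      using \<open>0 < r\<close> by (auto simp: indicator_def sgn_scaleR fun_eq_iff)
    finally show ?thesis
      using \<open>0 < r\<close> \<open>\<And>r. {y::'a. norm y < r \<and> sgn y \<in> D} \<in> sets borel\<close>[of 1] by simp
  qed
  have "?C \<in> sets borel" by measurable
  have "emeasure sphere_measure B = emeasure lborel (ball 0 1 \<inter> sgn -` B) / emeasure lborel (ball (0::'a) 1)"
    unfolding sphere_measure_def
    using measurable_sets[OF sgn_measurable, of B]
    by (subst emeasure_distr) (auto simp: emeasure_uniform_measure)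
  also have "ball 0 1 \<inter> sgn -` B = ?C" by (auto simp: dist_norm)
  finally have "emeasure sphere_measure B * emeasure lborel (ball (0::'a) 1) = emeasure lborel ?C"
    using emeasure_ball_0_1[where 'a='a]
    by (simp add: ennreal_divide_times ennreal_divide_self less_top)
  moreover have "emeasure lborel (ball (0::'a) r) = ennreal (r ^ DIM('a)) * emeasure lborel (ball (0::'a) 1)"
    using scale[of UNIV] by (simp add: ball_def dist_norm)
  ultimately show ?thesis
    by (metis (no_types, lifting) scale[OF assms(1)] mult.assoc mult.commute)
qed

lemma measure_eqI_real_lessThan:
  fixes M N :: "real measure"
  assumes "sets M = sets borel" "sets N = sets borel"
    and "\<And>r. emeasure M {..<r} < \<infinity>" "\<And>r. emeasure M {..<r} = emeasure N {..<r}"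
  shows "M = N"
proof (rule measure_eqI_generator_eq[where E="range lessThan" and \<Omega>=UNIV and A="\<lambda>n. {..<real n}"])
  show "Int_stable (range (lessThan :: real \<Rightarrow> real set))"
    by (auto simp: Int_stable_def image_iff intro: exI[of _ "min _ _"])
  show "sets M = sigma_sets UNIV (range lessThan)" "sets N = sigma_sets UNIV (range lessThan)"
    using assms(1,2) by (simp_all add: borel_Iio)
  show "(\<Union>n. {..<real n}) = UNIV"
    using reals_Archimedean2 by auto
qed (use assms in \<open>auto simp: less_top\<close>)

text \<open>Independence of modulus and direction under Lebesgue measure. The law of the modulus is
  kept as an image measure, without its density r^(n-1), because integrals over it are read back as
  integrals over the whole space.\<close>

lemma polar_measure:
  "distr lborel (borel \<Otimes>\<^sub>M borel) (\<lambda>y::'a::euclidean_space. (norm y, sgn y)) =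
    distr lborel borel (norm :: 'a \<Rightarrow> real) \<Otimes>\<^sub>M sphere_measure"
proof (rule pair_measure_eqI[symmetric])
  have fin: "emeasure lborel (ball (0::'a) r) < \<infinity>" for r
    using emeasure_bounded_finite[of "ball (0::'a) r"] by auto
  have vim: "norm -` {..<r} = ball (0::'a) r" for r by (auto simp: dist_norm)
  have em: "emeasure (distr lborel borel (norm::'a \<Rightarrow> real)) {..<r} = emeasure lborel (ball (0::'a) r)" for r
    by (subst emeasure_distr) (auto simp: vim)
  show "sigma_finite_measure (distr lborel borel (norm::'a \<Rightarrow> real))"
  proof
    show "\<exists>A. countable A \<and> A \<subseteq> sets (distr lborel borel (norm::'a \<Rightarrow> real)) \<and>
      \<Union> A = space (distr lborel borel (norm::'a \<Rightarrow> real)) \<and>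
      (\<forall>a\<in>A. emeasure (distr lborel borel (norm::'a \<Rightarrow> real)) a \<noteq> \<infinity>)"
      using fin reals_Archimedean2 by (intro exI[of _ "range (\<lambda>n::nat. {..<real n})"])
        (auto simp: em less_le simp del: infinity_ennreal_def)
  qed
  show "sigma_finite_measure (sphere_measure :: 'a measure)" ..
  fix A :: "real set" and B :: "'a set"
  assume "A \<in> sets (distr lborel borel (norm::'a \<Rightarrow> real))" and "B \<in> sets (sphere_measure :: 'a measure)"
  then have A[measurable]: "A \<in> sets borel" and B[measurable]: "B \<in> sets borel"
    by (auto simp: sets_sphere_measure)
  \<comment> \<open>For fixed B both sides are measures in A. They agree on the half lines by the
    cone formula, and half lines generate the Borel sets.\<close>
  let ?M = "distr (density lborel (indicator (sgn -` B))) borel (norm::'a \<Rightarrow> real)"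
  let ?N = "scale_measure (emeasure sphere_measure B) (distr lborel borel (norm::'a \<Rightarrow> real))"
  have sB: "sgn -` B \<in> sets borel" using measurable_sets[OF sgn_measurable, of B] by simp
  have eM: "emeasure ?M X = emeasure lborel {y. norm y \<in> X \<and> sgn y \<in> B}" if "X \<in> sets borel" for X
  proof -
    have "norm -` X \<in> sets (borel :: 'a measure)"
      using measurable_sets[OF borel_measurable_norm that] by simp
    moreover have "sgn -` B \<inter> norm -` X = {y. norm y \<in> X \<and> sgn y \<in> B}" by auto
    ultimately show ?thesis
      using that sB by (subst emeasure_distr) (auto simp: emeasure_restricted)
  qed
  have "?M = ?N"
  proof (rule measure_eqI_real_lessThan)
    show "emeasure ?M {..<r} = emeasure ?N {..<r}" for r
    proof (cases "0 < r")
      case True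
      then show ?thesis
        using emeasure_ball_cone[OF B True] by (simp add: eM em mult.commute)
    next
      case False
      then have e: "{y::'a. norm y \<in> {..<r} \<and> sgn y \<in> B} = {}"
        using norm_ge_zero by (smt (verit) Collect_empty_eq lessThan_iff)
      have "emeasure ?M {..<r} = 0"
        unfolding eM[OF lessThan_borel] e by simp
      with False show ?thesis by (simp add: em ball_empty)
    qed
    show "emeasure ?M {..<r} < \<infinity>" for r
    proof -
      have "emeasure ?M {..<r} \<le> emeasure lborel (ball (0::'a) r)"
        unfolding eM[OF lessThan_borel] by (rule emeasure_mono) auto
      then show ?thesis using fin[of r] by (rule le_less_trans)
    qed
  qed auto
  then have "emeasure ?M A = emeasure ?N A" by simp
  moreover have "(\<lambda>y::'a. (norm y, sgn y)) -` (A \<times> B) = {y. norm y \<in> A \<and> sgn y \<in> B}" by auto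
  ultimately show "emeasure (distr lborel borel (norm :: 'a \<Rightarrow> real)) A * emeasure sphere_measure B =
      emeasure (distr lborel (borel \<Otimes>\<^sub>M borel) (\<lambda>y::'a. (norm y, sgn y))) (A \<times> B)"
    by (subst (2) emeasure_distr) (auto simp: eM mult.commute)
qed (simp add: sets_sphere_measure cong: sets_pair_measure_cong)

text \<open>The outer integral remains one over the whole space, so a radial weight can be
  integrated again without computing the area of the sphere.\<close>

lemma nn_integral_polar:
  fixes g :: "'a::euclidean_space \<Rightarrow> ennreal" and \<alpha> :: "real \<Rightarrow> ennreal"
  assumes [measurable]: "g \<in> borel_measurable borel" "\<alpha> \<in> borel_measurable borel"
  shows "(\<integral>\<^sup>+y. \<alpha> (norm y) * g y \<partial>lborel) =
    (\<integral>\<^sup>+y. \<alpha> (norm (y::'a)) * (\<integral>\<^sup>+s. g (norm y *\<^sub>R s) \<partial>sphere_measure) \<partial>lborel)"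
proof -
  have "(\<integral>\<^sup>+y. \<alpha> (norm y) * g y \<partial>lborel) = (\<integral>\<^sup>+y. \<alpha> (norm y) * g (norm y *\<^sub>R sgn y) \<partial>lborel)"
  proof -
    have "norm y *\<^sub>R sgn y = y" for y :: 'a by (cases "y = 0") (auto simp: sgn_div_norm)
    then show ?thesis by simp
  qed
  also have "\<dots> = (\<integral>\<^sup>+(r,s). \<alpha> r * g (r *\<^sub>R s) \<partial>distr lborel (borel \<Otimes>\<^sub>M borel) (\<lambda>y::'a. (norm y, sgn y)))"
    by (subst nn_integral_distr) auto
  also have "\<dots> = (\<integral>\<^sup>+r. (\<integral>\<^sup>+s. \<alpha> r * g (r *\<^sub>R s) \<partial>sphere_measure) \<partial>distr lborel borel (norm::'a \<Rightarrow> real))"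
  proof -
    have [measurable_cong]: "sets (distr lborel borel (norm::'a \<Rightarrow> real)) = sets borel" by simp
    have "(\<lambda>(r,s). \<alpha> r * g (r *\<^sub>R s)) \<in>
        borel_measurable (distr lborel borel (norm::'a \<Rightarrow> real) \<Otimes>\<^sub>M sphere_measure)"
      by measurable
    from sphere_measure.nn_integral_fst[OF this] show ?thesis
      unfolding polar_measure by (simp add: case_prod_beta')
  qed
  also have "\<dots> = (\<integral>\<^sup>+y. \<alpha> (norm (y::'a)) * (\<integral>\<^sup>+s. g (norm y *\<^sub>R s) \<partial>sphere_measure) \<partial>lborel)"
    by (subst nn_integral_distr) (auto simp: nn_integral_cmult)
  finally show ?thesis .
qed

subsection \<open>Mollification\<close>

definition locally_integrable :: "('a::euclidean_space \<Rightarrow> real) \<Rightarrow> bool" where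
  "locally_integrable f \<longleftrightarrow> f \<in> borel_measurable borel \<and> (\<forall>N. set_integrable lborel (ball 0 N) f)"

lemma locally_integrable_measurable [measurable_dest]:
  "locally_integrable f \<Longrightarrow> f \<in> borel_measurable borel"
  by (simp add: locally_integrable_def)

lemma locally_integrable_abs: "locally_integrable f \<Longrightarrow> locally_integrable (\<lambda>x. \<bar>f x\<bar>)"
  using set_integrable_abs unfolding locally_integrable_def by auto

definition ball_norm :: "real \<Rightarrow> ('a::euclidean_space \<Rightarrow> real) \<Rightarrow> real" where
  "ball_norm N f = (\<integral>x\<in>ball 0 N. \<bar>f x\<bar> \<partial>lborel)"

lemma integrable_locally_integrable_mult:
  fixes f :: "'a::euclidean_space \<Rightarrow> real"
  assumes f: "locally_integrable f" and [measurable]: "\<phi> \<in> borel_measurable borel"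
    and bound: "\<And>x. \<bar>\<phi> x\<bar> \<le> B" and supp: "\<And>x. x \<notin> ball 0 N \<Longrightarrow> \<phi> x = 0"
  shows "integrable lborel (\<lambda>x. f x * \<phi> x)"
    and "\<bar>\<integral>x. f x * \<phi> x \<partial>lborel\<bar> \<le> B * ball_norm N f"
proof -
  note [measurable] = locally_integrable_measurable[OF f]
  have int: "integrable lborel (\<lambda>x. indicator (ball 0 N) x * \<bar>f x\<bar>)"
    using f[unfolded locally_integrable_def set_integrable_def, THEN conjunct2, rule_format,
        of N, THEN integrable_abs]
    by (simp add: abs_mult)
  have le: "\<bar>f x * \<phi> x\<bar> \<le> B * (indicator (ball 0 N) x * \<bar>f x\<bar>)" for x
    using mult_left_mono[OF bound[of x], of "\<bar>f x\<bar>"] supp[of x]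
    by (cases "x \<in> ball 0 N") (auto simp: abs_mult mult_ac)
  show i: "integrable lborel (\<lambda>x. f x * \<phi> x)"
    by (rule Bochner_Integration.integrable_bound[OF integrable_mult_right[OF int, of B]])
       (use order_trans[OF le abs_ge_self] in auto)
  have "\<bar>\<integral>x. f x * \<phi> x \<partial>lborel\<bar> \<le> (\<integral>x. \<bar>f x * \<phi> x\<bar> \<partial>lborel)"
    by (rule integral_abs_bound)
  also have "\<dots> \<le> (\<integral>x. B * (indicator (ball 0 N) x * \<bar>f x\<bar>) \<partial>lborel)"
    using i int le by (intro integral_mono) auto
  also have "\<dots> = B * ball_norm N f"
    by (simp add: ball_norm_def set_lebesgue_integral_def)
  finally show "\<bar>\<integral>x. f x * \<phi> x \<partial>lborel\<bar> \<le> B * ball_norm N f" .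
qed

lemma ball_norm_nonneg: "0 \<le> ball_norm N f"
  unfolding ball_norm_def set_lebesgue_integral_def by (intro integral_nonneg_AE) auto

section \<open>The radial bump and its normalised dilations\<close>

definition bump :: "'a::euclidean_space \<Rightarrow> real" where
  "bump y = flat 2 (1 - (norm y)\<^sup>2) / 4"

definition bump_mass :: "'a::euclidean_space itself \<Rightarrow> real" where
  "bump_mass _ = (\<integral>y. bump (y::'a) \<partial>lborel)"

definition bump_kernel :: "real \<Rightarrow> 'a::euclidean_space \<Rightarrow> real" where
  "bump_kernel R y = bump (y /\<^sub>R R) / (bump_mass TYPE('a) * R ^ DIM('a))"

lemma bump_nonneg: "0 \<le> bump y"
  by (simp add: bump_def flat_nonneg)

text \<open>Squaring x \<le> exp x at x = 1/(2s) gives 1/(4 s^2) \<le> exp(1/s). This is the origin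
  of the 4 in \<open>bump\<close>, which is thereby at most 1.\<close>

lemma flat_2_le: "flat 2 s \<le> 4"
proof (cases "0 < s")
  case True
  have "(1 / s / 2)\<^sup>2 \<le> (exp (1 / s / 2))\<^sup>2"
    using exp_ge_add_one_self[of "1 / s / 2"] True
    by (intro power_mono) (linarith, simp)
  also have "\<dots> = exp (1 / s)" by (simp add: power2_eq_square flip: exp_add)
  finally have "exp (- (1 / s)) * (1 / s / 2)\<^sup>2 \<le> exp (- (1 / s)) * exp (1 / s)"
    by (intro mult_left_mono) auto
  then have "exp (- (1 / s)) \<le> s\<^sup>2 * 4"
    using True by (simp add: power_divide field_simps flip: exp_add)
  then show ?thesis using True by (simp add: flat_def pos_divide_le_eq mult.commute)
qed (simp add: flat_def)

lemma bump_le_1: "bump y \<le> 1"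
  using flat_2_le by (simp add: bump_def)

lemma bump_pos_iff: "0 < bump y \<longleftrightarrow> norm y < 1"
proof -
  have "norm y < 1 \<longleftrightarrow> 0 < 1 - (norm y)\<^sup>2"
    using abs_square_less_1[of "norm y"] by simp
  then show ?thesis by (simp add: bump_def flat_def)
qed

lemma bump_eq_0: "1 \<le> norm y \<Longrightarrow> bump y = 0"
  by (simp add: bump_def flat_def abs_square_less_1)

lemma continuous_on_bump [continuous_intros]:
  "continuous_on S f \<Longrightarrow> continuous_on S (\<lambda>x. bump (f x))"
  unfolding bump_def by (intro continuous_intros) simp_all

lemma bump_measurable [measurable]: "bump \<in> borel_measurable borel"
  by (intro borel_measurable_continuous_onI continuous_intros)

lemma locally_integrable_continuous:
  fixes f :: "'a::euclidean_space \<Rightarrow> real"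
  assumes "continuous_on UNIV f"
  shows "locally_integrable f"
  unfolding locally_integrable_def
proof safe
  show "f \<in> borel_measurable borel" using assms by (rule borel_measurable_continuous_onI)
  fix N
  have "set_integrable lborel (cball 0 N) f"
    unfolding set_integrable_def
    using borel_integrable_compact[of "cball 0 N" f] assms continuous_on_subset by fastforce
  then show "set_integrable lborel (ball 0 N) f"
    by (rule set_integrable_subset) auto
qed

lemma integrable_bump: "integrable lborel (bump :: 'a::euclidean_space \<Rightarrow> real)"
proof -
  have "integrable lborel (\<lambda>x::'a. 1 * bump x)"
    by (rule integrable_locally_integrable_mult(1)[where B=1 and N=1])
       (auto simp: bump_nonneg bump_le_1 bump_eq_0 intro: locally_integrable_continuous)
  then show ?thesis by simp
qed

lemma bump_mass_pos: "0 < bump_mass TYPE('a::euclidean_space)"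
proof -
  have "bump_mass TYPE('a) \<noteq> 0"
  proof
    assume "bump_mass TYPE('a) = 0"
    then have "AE y in lborel. bump (y::'a) = 0"
      using integral_nonneg_eq_0_iff_AE[OF integrable_bump[where 'a='a]]
      by (simp add: bump_mass_def bump_nonneg)
    then have "AE y in lborel. y \<notin> ball (0::'a) 1"
    proof eventually_elim
      case (elim y)
      then show ?case using bump_pos_iff[of y] by simp
    qed
    then have "emeasure lborel (ball (0::'a) 1) = 0"
      by (subst (asm) AE_iff_measurable[OF _ refl]) (auto simp: ball_def)
    then show False using emeasure_ball_0_1(1) by blast
  qed
  moreover have "0 \<le> bump_mass TYPE('a)"
    unfolding bump_mass_def by (intro integral_nonneg_AE) (auto simp: bump_nonneg)
  ultimately show ?thesis by simp
qed

lemma kernel_nonneg: "0 < R \<Longrightarrow> 0 \<le> bump_kernel R (y::'a::euclidean_space)"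
  using bump_mass_pos[where 'a='a] by (simp add: bump_kernel_def bump_nonneg)

lemma kernel_eq_0: "0 < R \<Longrightarrow> R \<le> norm y \<Longrightarrow> bump_kernel R y = 0"
  by (simp add: bump_kernel_def bump_eq_0 field_simps)

lemma kernel_minus: "bump_kernel R (- y) = bump_kernel R y"
  by (simp add: bump_kernel_def bump_def)

lemma kernel_minus_commute: "bump_kernel R (x - y) = bump_kernel R (y - x)"
  using kernel_minus[of R "y - x"] by simp

lemma continuous_on_kernel [continuous_intros]:
  "continuous_on S f \<Longrightarrow> continuous_on S (\<lambda>x. bump_kernel R (f x))"
  unfolding bump_kernel_def divide_inverse by (intro continuous_intros)

lemma kernel_measurable [measurable]: "bump_kernel R \<in> borel_measurable borel"
  by (intro borel_measurable_continuous_onI continuous_intros)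

definition kernel_bound :: "real \<Rightarrow> 'a::euclidean_space itself \<Rightarrow> real" where
  "kernel_bound R _ = 1 / (bump_mass TYPE('a) * R ^ DIM('a))"

lemma kernel_le: "0 < R \<Longrightarrow> bump_kernel R (y::'a::euclidean_space) \<le> kernel_bound R TYPE('a)"
  unfolding bump_kernel_def kernel_bound_def
  using bump_mass_pos[where 'a='a] by (intro divide_right_mono bump_le_1) simp

lemma abs_kernel_le: "0 < R \<Longrightarrow> \<bar>bump_kernel R (y::'a::euclidean_space)\<bar> \<le> kernel_bound R TYPE('a)"
  using kernel_le[of R y] kernel_nonneg[of R y] by simp

text \<open>On the half ball the kernel dominates a positive constant, so the mean of a nonnegative
  function controls its plain integral there. This is how a bound on one mean becomes an L^1
  bound.\<close>

lemma kernel_lower_bound: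
  assumes "0 < R"
  shows "\<exists>c>0. \<forall>y::'a::euclidean_space. norm y \<le> R / 2 \<longrightarrow> c \<le> bump_kernel R y"
proof (intro exI conjI allI impI)
  \<comment> \<open>For |y| \<le> R/2 the number q = 1 - |y/R|^2 lies in [3/4, 1], so exp(-1/q)
    \<ge> exp(-4/3) and 1/q^2 \<ge> 1.\<close>
  let ?c = "exp (- (4 / 3)) / 4 / (bump_mass TYPE('a) * R ^ DIM('a))"
  show "0 < ?c" using bump_mass_pos[where 'a='a] assms by simp
  fix y :: 'a assume y: "norm y \<le> R / 2"
  have "(norm (y /\<^sub>R R))\<^sup>2 \<le> (1 / 2)\<^sup>2"
    using y assms by (intro power_mono) (auto simp: field_simps)
  moreover define q where "q = 1 - (norm (y /\<^sub>R R))\<^sup>2"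
  ultimately have q: "3 / 4 \<le> q" by (simp add: power_divide)
  then have "1 / q \<le> 1 / (3 / 4)" by (intro divide_left_mono) simp_all
  then have "exp (- (4 / 3)) \<le> exp (- (1 / q))" by simp
  also have "\<dots> \<le> exp (- (1 / q)) / q\<^sup>2"
  proof -
    have "q \<le> 1" by (simp add: q_def)
    with q have "q\<^sup>2 \<le> 1" "0 < q\<^sup>2" by (simp_all add: power_le_one)
    then show ?thesis using divide_left_mono[of "q\<^sup>2" 1 "exp (- (1 / q))"] by simp
  qed
  finally have "exp (- (4 / 3)) / 4 \<le> bump (y /\<^sub>R R)"
    using q unfolding bump_def q_def[symmetric] by (simp add: flat_def)
  then show "?c \<le> bump_kernel R y"
    unfolding bump_kernel_def using bump_mass_pos[where 'a='a] assms by (intro divide_right_mono) simp_all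
qed

lemma integral_kernel:
  assumes "0 < R"
  shows "integrable lborel (bump_kernel R :: 'a::euclidean_space \<Rightarrow> real)"
    and "(\<integral>y. bump_kernel R (y::'a) \<partial>lborel) = 1"
proof -
  have i: "integrable lborel (\<lambda>y::'a. bump (y /\<^sub>R R))"
    using integral_lborel_affine(1)[of "bump :: 'a \<Rightarrow> real" "inverse R" 0] assms
      integrable_bump[where 'a='a] by simp
  then show "integrable lborel (bump_kernel R :: 'a \<Rightarrow> real)"
    unfolding bump_kernel_def by simp
  have "bump_mass TYPE('a) = inverse R ^ DIM('a) * (\<integral>y. bump ((y::'a) /\<^sub>R R) \<partial>lborel)"
    unfolding bump_mass_def
    using integral_lborel_affine(2)[of bump "inverse R" 0] assms by simp
  then have "(\<integral>y. bump ((y::'a) /\<^sub>R R) \<partial>lborel) = bump_mass TYPE('a) * R ^ DIM('a)"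
    using assms by (simp add: power_inverse field_simps)
  then show "(\<integral>y. bump_kernel R (y::'a) \<partial>lborel) = 1"
    unfolding bump_kernel_def using assms bump_mass_pos[where 'a='a]
    by simp
qed

lemma kernel_test_function:
  fixes x :: "'a::euclidean_space"
  assumes "0 < R"
  shows "(\<lambda>y. bump_kernel R (y - x)) \<in> test_functions"
proof -
  have "(\<lambda>y. bump_kernel R (y - x)) =
      (\<lambda>y. (1 / 4 / (bump_mass TYPE('a) * R ^ DIM('a))) * flat 2 (1 - (norm (y - x) / R)\<^sup>2))"
  proof
    fix y
    have "norm ((y - x) /\<^sub>R R) = norm (y - x) / R" using assms by (simp add: divide_inverse mult.commute)
    then show "bump_kernel R (y - x) =
        (1 / 4 / (bump_mass TYPE('a) * R ^ DIM('a))) * flat 2 (1 - (norm (y - x) / R)\<^sup>2)"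
      unfolding bump_kernel_def bump_def by simp
  qed
  moreover have "smooth \<dots>"
    by (rule smooth_flat_algebra[of _ x R]) (intro flat_algebra.intros)
  ultimately have "smooth (\<lambda>y. bump_kernel R (y - x))" by simp
  moreover have "{y. bump_kernel R (y - x) \<noteq> 0} \<subseteq> cball x R"
    using kernel_eq_0[OF assms] by (force simp: dist_norm norm_minus_commute not_le)
  then have "compact (closure {y. bump_kernel R (y - x) \<noteq> 0})"
    using bounded_subset[OF bounded_cball] by (auto simp: compact_closure)
  ultimately show ?thesis by (simp add: test_functions_def)
qed

section \<open>Mollification by the kernel\<close>

definition mollify :: "real \<Rightarrow> ('a::euclidean_space \<Rightarrow> real) \<Rightarrow> 'a \<Rightarrow> real" where
  "mollify R f x = (\<integral>y. f y * bump_kernel R (y - x) \<partial>lborel)"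

lemma mollify_shift:
  assumes "f \<in> borel_measurable borel"
  shows "mollify R f x = (\<integral>y. f (x + y) * bump_kernel R y \<partial>lborel)"
  unfolding mollify_def
  using assms integral_lborel_affine(2)[of "\<lambda>y. f y * bump_kernel R (y - x)" 1 x] by simp

lemma kernel_shift_support: "0 < R \<Longrightarrow> norm x + R \<le> N \<Longrightarrow> y \<notin> ball 0 N \<Longrightarrow> bump_kernel R (y - x) = 0"
  using norm_triangle_ineq2[of y x] by (intro kernel_eq_0) auto

lemma integrable_mollify:
  assumes "locally_integrable f" "0 < R"
  shows "integrable lborel (\<lambda>y. f y * bump_kernel R (y - x))"
    and "integrable lborel (\<lambda>y. f (x + y) * bump_kernel R y)"
proof -
  show *: "integrable lborel (\<lambda>y. f y * bump_kernel R (y - x))"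
    using assms abs_kernel_le[OF assms(2)] kernel_shift_support[OF assms(2) order_refl]
    by (intro integrable_locally_integrable_mult(1)[where N="norm x + R" and B="kernel_bound R TYPE('a)"]) auto
  show "integrable lborel (\<lambda>y. f (x + y) * bump_kernel R y)"
    using integral_lborel_affine(1)[of "\<lambda>y. f y * bump_kernel R (y - x)" 1 x, THEN iffD2, OF _ _ *]
      locally_integrable_measurable[OF assms(1)] by simp
qed

text \<open>The modulus of continuity is that of the kernel; f enters only through its L^1 norm on a
  fixed ball. As d is chosen before f, a family bounded in L^1 on balls has mollifications that are
  equicontinuous at x.\<close>

lemma mollify_equicontinuous:
  fixes x :: "'a::euclidean_space"
  assumes "0 < R" "0 < e"
  obtains d where "0 < d"
    "\<And>f x'. locally_integrable f \<Longrightarrow> norm (x' - x) < d \<Longrightarrow>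
      \<bar>mollify R f x' - mollify R f x\<bar> \<le> e * ball_norm (norm x + R + 1) f"
proof -
  \<comment> \<open>The summand 1 leaves room for \<open>x'\<close>, so that both kernels are
    supported in the ball of radius \<open>?N\<close>. For y in that ball, y - x and y - x' have
    norm at most twice \<open>?N\<close>.\<close>
  let ?N = "norm x + R + 1"
  have "uniformly_continuous_on (cball 0 (2 * ?N)) (bump_kernel R :: 'a \<Rightarrow> real)"
    by (intro compact_uniformly_continuous continuous_intros) auto
  then obtain d where d: "0 < d" "\<And>y z. norm y \<le> 2 * ?N \<Longrightarrow> norm z \<le> 2 * ?N \<Longrightarrow> dist y z < d \<Longrightarrow>
      dist (bump_kernel R y) (bump_kernel R (z::'a)) < e"
    using \<open>0 < e\<close> unfolding uniformly_continuous_on_def by (auto simp: dist_commute)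
  show thesis
  proof (rule that[of "min d 1"])
    fix f :: "'a \<Rightarrow> real" and x' :: 'a
    assume f: "locally_integrable f" and x': "norm (x' - x) < min d 1"
    have nx': "norm x' \<le> norm x + 1" using x' norm_triangle_ineq2[of x' x] by simp
    let ?\<phi> = "\<lambda>y. bump_kernel R (y - x') - bump_kernel R (y - x)"
    have supp: "?\<phi> y = 0" if "y \<notin> ball 0 ?N" for y
      using that kernel_shift_support[of R x' ?N y] kernel_shift_support[of R x ?N y] assms nx' by simp
    have "\<bar>?\<phi> y\<bar> \<le> e" for y
    proof (cases "y \<in> ball 0 ?N")
      case True
      then have "dist (bump_kernel R (y - x')) (bump_kernel R (y - x)) < e"
        using norm_triangle_ineq4[of y x] norm_triangle_ineq4[of y x'] x' nx' assms
        by (intro d) (auto simp: dist_norm norm_minus_commute)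
      then show ?thesis by (simp add: dist_real_def)
    next
      case False
      then show ?thesis using supp[OF False] assms by simp
    qed
    from integrable_locally_integrable_mult(2)[OF f _ this supp]
    have "\<bar>\<integral>y. f y * ?\<phi> y \<partial>lborel\<bar> \<le> e * ball_norm ?N f" by simp
    also have "(\<integral>y. f y * ?\<phi> y \<partial>lborel) = mollify R f x' - mollify R f x"
      unfolding mollify_def right_diff_distrib
      using integrable_mollify(1)[OF f assms(1)] by (intro Bochner_Integration.integral_diff) auto
    finally show "\<bar>mollify R f x' - mollify R f x\<bar> \<le> e * ball_norm ?N f" .
  qed (use d in auto)
qed

lemma continuous_on_mollify:
  fixes f :: "'a::euclidean_space \<Rightarrow> real"
  assumes f: "locally_integrable f" and R: "0 < R"
  shows "continuous_on UNIV (mollify R f)"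
  unfolding continuous_on_iff
proof (intro ballI allI impI)
  fix x :: 'a and e :: real assume "0 < e"
  let ?B = "ball_norm (norm x + R + 1) f"
  have B: "0 \<le> ?B" by (rule ball_norm_nonneg)
  with \<open>0 < e\<close> have "0 < e / (?B + 1)" by simp
  then obtain d where "0 < d"
    and "\<And>g x'. locally_integrable g \<Longrightarrow> norm (x' - x) < d \<Longrightarrow>
      \<bar>mollify R g x' - mollify R g x\<bar> \<le> e / (?B + 1) * ball_norm (norm x + R + 1) g"
    using mollify_equicontinuous[OF R, of "e / (?B + 1)" x] by metis
  then have d: "norm (x' - x) < d \<Longrightarrow> \<bar>mollify R f x' - mollify R f x\<bar> \<le> e / (?B + 1) * ?B" for x'
    using f by blast
  have "e / (?B + 1) * ?B < e" using B \<open>0 < e\<close> by (simp add: field_simps)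
  then show "\<exists>d>0. \<forall>x'\<in>UNIV. dist x' x < d \<longrightarrow> dist (mollify R f x') (mollify R f x) < e"
    using d \<open>0 < d\<close> by (intro exI[of _ d]) (auto simp: dist_norm dist_real_def intro: le_less_trans[OF d])
qed

subsection \<open>Subharmonic functions and their mollifications\<close>

lemma emeasure_sphere_measure_UNIV [simp]:
  "emeasure (sphere_measure :: 'a::euclidean_space measure) UNIV = 1"
  using sphere_measure.emeasure_space_1[where 'a='a] by simp

lemma subharmonic_less_top: "subharmonic u \<Longrightarrow> u x < \<infinity>"
  by (auto simp: subharmonic_def less_top)

lemma usc_measurable:
  fixes u :: "'a::euclidean_space \<Rightarrow> ereal"
  assumes "\<And>a. open {x. u x < a}"
  shows "u \<in> borel_measurable borel"
  using assms by (intro borel_measurableI_less) auto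

lemma subharmonic_measurable [measurable_dest]:
  "subharmonic u \<Longrightarrow> u \<in> borel_measurable borel"
  by (rule usc_measurable) (simp add: subharmonic_def)

lemma usc_bounded_above_compact:
  fixes u :: "'a::euclidean_space \<Rightarrow> ereal"
  assumes "\<And>a. open {x. u x < a}" "\<And>x. u x \<noteq> \<infinity>" "compact K"
  obtains C where "0 \<le> C" "\<And>x. x \<in> K \<Longrightarrow> u x \<le> ereal C"
proof -
  have "\<exists>n. u x < ereal (real n)" for x
  proof (cases "u x")
    case (real r)
    then show ?thesis using reals_Archimedean2 by auto
  qed (use assms(2)[of x] in auto)
  then have "K \<subseteq> (\<Union>n\<in>UNIV. {x. u x < ereal (real n)})" by auto
  then obtain D where "finite D" and D: "K \<subseteq> (\<Union>n\<in>D. {x. u x < ereal (real n)})"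
    using compactE_image[OF \<open>compact K\<close>, of UNIV "\<lambda>n. {x. u x < ereal (real n)}"] assms(1) by metis
  show thesis
  proof (rule that[of "real (Max (insert 0 D))"])
    fix x assume "x \<in> K"
    with D obtain n where "n \<in> D" "u x < ereal (real n)" by blast
    moreover have "n \<le> Max (insert 0 D)" using \<open>finite D\<close> \<open>n \<in> D\<close> by simp
    ultimately show "u x \<le> ereal (real (Max (insert 0 D)))"
      by (meson ereal_less_eq(3) le_less_trans less_imp_le of_nat_mono order_less_le_trans)
  qed simp
qed

lemma subharmonic_bounded_above_compact:
  assumes "subharmonic u" "compact K"
  obtains C where "0 \<le> C" "\<And>x. x \<in> K \<Longrightarrow> u x \<le> ereal C"
  using usc_bounded_above_compact[of u K] assms unfolding subharmonic_def by metis

text \<open>Below an upper bound \<open>C\<close> the sub-mean-value inequality becomes a super-mean-value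
  inequality for the nonnegative function \<open>C - u\<close>, free of differences of infinite integrals.\<close>

lemma sphere_mean_ge_iff:
  fixes u :: "'a::euclidean_space \<Rightarrow> ereal"
  assumes [measurable]: "u \<in> borel_measurable borel" and "0 \<le> C" "0 \<le> r"
    and le: "\<And>y. y \<in> cball x r \<Longrightarrow> u y \<le> ereal C"
  shows "u x \<le> sphere_mean u x r \<longleftrightarrow>
    (\<integral>\<^sup>+s. e2ennreal (ereal C - u (x + r *\<^sub>R s)) \<partial>sphere_measure) \<le> e2ennreal (ereal C - u x)"
proof -
  let ?u = "\<lambda>s. u (x + r *\<^sub>R s)"
  define P where "P = (\<integral>\<^sup>+s. e2ennreal (?u s) \<partial>(sphere_measure :: 'a measure))"
  define N where "N = (\<integral>\<^sup>+s. e2ennreal (- ?u s) \<partial>(sphere_measure :: 'a measure))"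
  define I where "I = (\<integral>\<^sup>+s. e2ennreal (ereal C - ?u s) \<partial>(sphere_measure :: 'a measure))"
  have AE: "AE s in (sphere_measure :: 'a measure). ?u s \<le> ereal C"
    using AE_sphere_measure_norm_le
  proof eventually_elim
    case (elim s)
    then show ?case using \<open>0 \<le> r\<close> mult_left_mono[of "norm s" 1 r] by (intro le) (simp add: dist_norm)
  qed
  \<comment> \<open>The identity (C - u) + u^+ = C + u^- holds pointwise for u \<le> C, also at u =
    -\<infinity>, and involves only sums of nonnegative quantities. P is finite by the bound C and
    can be cancelled, whereas N may be infinite.\<close>
  have "I + P = (\<integral>\<^sup>+s. e2ennreal (ereal C - ?u s) + e2ennreal (?u s) \<partial>(sphere_measure :: 'a measure))"
    unfolding I_def P_def by (intro nn_integral_add[symmetric]) measurable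
  also have "\<dots> = (\<integral>\<^sup>+s. ennreal C + e2ennreal (- ?u s) \<partial>(sphere_measure :: 'a measure))"
  proof (rule nn_integral_cong_AE, use AE in eventually_elim)
    case (elim s)
    then show ?case using \<open>0 \<le> C\<close>
      by (cases "?u s"; cases "0 \<le> real_of_ereal (?u s)")
         (auto simp: ennreal_plus[symmetric] ennreal_neg simp del: ennreal_plus)
  qed
  also have "\<dots> = ennreal C + N"
    unfolding N_def by (subst nn_integral_add) auto
  finally have eq: "I + P = ennreal C + N" .
  have "P \<le> (\<integral>\<^sup>+s. ennreal C \<partial>(sphere_measure :: 'a measure))"
    unfolding P_def
    by (rule nn_integral_mono_AE, use AE in eventually_elim) (metis e2ennreal_ereal e2ennreal_mono)
  also have "\<dots> = ennreal C" by simp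
  finally have "P < \<infinity>" by (simp add: le_less_trans)
  then obtain p where p: "P = ennreal p" "0 \<le> p" by (cases P) auto
  have ux: "u x \<le> ereal C" using \<open>0 \<le> r\<close> by (intro le) simp
  have "u x \<le> enn2ereal P - enn2ereal N \<longleftrightarrow> I \<le> e2ennreal (ereal C - u x)"
  proof (cases N)
    case (real n)
    then have "I < \<infinity>" using eq p \<open>0 \<le> C\<close> by (cases I) (auto simp: ennreal_plus[symmetric] simp del: ennreal_plus)
    then obtain i where i: "I = ennreal i" "0 \<le> i" by (cases I) auto
    have "i + p = C + n" using eq p i real \<open>0 \<le> C\<close> by (simp add: ennreal_plus[symmetric] del: ennreal_plus)
    then show ?thesis using ux p i real
      by (cases "u x") (auto simp: enn2ereal_ennreal ennreal_le_iff)
  next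
    case top
    then have "I = top" using eq p by (cases I) (auto simp: ennreal_plus[symmetric] simp del: ennreal_plus)
    with top show ?thesis using ux p
      by (cases "u x") (auto simp: enn2ereal_ennreal enn2ereal_top top_unique)
  qed
  then show ?thesis by (simp add: sphere_mean_def P_def N_def I_def)
qed

lemma subharmonic_supermean:
  fixes u :: "'a::euclidean_space \<Rightarrow> ereal"
  assumes u: "subharmonic u" and "0 \<le> C" "0 \<le> r" and le: "\<And>y. y \<in> cball x r \<Longrightarrow> u y \<le> ereal C"
  shows "(\<integral>\<^sup>+s. e2ennreal (ereal C - u (x + r *\<^sub>R s)) \<partial>sphere_measure) \<le> e2ennreal (ereal C - u x)"
proof (cases "r = 0")
  case True
  then show ?thesis by simp
next
  case False
  then have "u x \<le> sphere_mean u x r"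
    using u \<open>0 \<le> r\<close> unfolding subharmonic_def by auto
  then show ?thesis
    using sphere_mean_ge_iff[OF subharmonic_measurable[OF u] assms(2-4)] by blast
qed

lemma subharmonicI:
  fixes u :: "'a::euclidean_space \<Rightarrow> ereal"
  assumes "\<And>x. u x \<noteq> \<infinity>" "\<exists>x. u x \<noteq> - \<infinity>" and usc: "\<And>a. open {x. u x < a}"
    and sm: "\<And>x r. 0 < r \<Longrightarrow> \<exists>C\<ge>0. (\<forall>y\<in>cball x r. u y \<le> ereal C) \<and>
      (\<integral>\<^sup>+s. e2ennreal (ereal C - u (x + r *\<^sub>R s)) \<partial>sphere_measure) \<le> e2ennreal (ereal C - u x)"
  shows "subharmonic u"
  unfolding subharmonic_def
proof (intro conjI allI impI)
  fix x :: 'a and r :: real assume "0 < r"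
  with sm[of r x] obtain C where "0 \<le> C" "\<And>y. y \<in> cball x r \<Longrightarrow> u y \<le> ereal C"
    "(\<integral>\<^sup>+s. e2ennreal (ereal C - u (x + r *\<^sub>R s)) \<partial>sphere_measure) \<le> e2ennreal (ereal C - u x)"
    by blast
  then show "u x \<le> sphere_mean u x r"
    using sphere_mean_ge_iff[OF usc_measurable[OF usc] _ less_imp_le[OF \<open>0 < r\<close>]] by blast
qed (use assms in auto)

text \<open>The kernel is radial, has mass 1 and vanishes beyond radius R, so its mean is an average
  of spherical means of radii at most R, to each of which the supermean inequality applies.\<close>

lemma subharmonic_kernel_supermean:
  fixes u :: "'a::euclidean_space \<Rightarrow> ereal"
  assumes u: "subharmonic u" and "0 \<le> C" and R: "0 < R" and le: "\<And>y. y \<in> cball x R \<Longrightarrow> u y \<le> ereal C"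
  shows "(\<integral>\<^sup>+y. ennreal (bump_kernel R y) * e2ennreal (ereal C - u (x + y)) \<partial>lborel)
    \<le> e2ennreal (ereal C - u x)"
proof -
  note [measurable] = subharmonic_measurable[OF u]
  define \<alpha> where "\<alpha> r = ennreal (flat 2 (1 - (r / R)\<^sup>2) / 4 / (bump_mass TYPE('a) * R ^ DIM('a)))" for r
  have k: "ennreal (bump_kernel R y) = \<alpha> (norm y)" for y :: 'a
  proof -
    have "norm (y /\<^sub>R R) = norm y / R" using R by (simp add: divide_inverse mult.commute)
    then show ?thesis by (simp add: \<alpha>_def bump_kernel_def bump_def)
  qed
  have [measurable]: "\<alpha> \<in> borel_measurable borel"
    unfolding \<alpha>_def divide_inverse
    by (intro measurable_compose[OF _ measurable_ennreal] borel_measurable_continuous_onI continuous_intros)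
  have "(\<integral>\<^sup>+y. ennreal (bump_kernel R y) * e2ennreal (ereal C - u (x + y)) \<partial>lborel) =
      (\<integral>\<^sup>+y. \<alpha> (norm (y::'a)) *
        (\<integral>\<^sup>+s. e2ennreal (ereal C - u (x + norm y *\<^sub>R s)) \<partial>sphere_measure) \<partial>lborel)"
    unfolding k by (rule nn_integral_polar) measurable
  also have "\<dots> \<le> (\<integral>\<^sup>+y. \<alpha> (norm (y::'a)) * e2ennreal (ereal C - u x) \<partial>lborel)"
  proof (rule nn_integral_mono)
    fix y :: 'a
    show "\<alpha> (norm y) * (\<integral>\<^sup>+s. e2ennreal (ereal C - u (x + norm y *\<^sub>R s)) \<partial>sphere_measure)
        \<le> \<alpha> (norm y) * e2ennreal (ereal C - u x)"
    proof (cases "norm y \<le> R")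
      case True
      then show ?thesis
        by (intro mult_left_mono subharmonic_supermean[OF u \<open>0 \<le> C\<close>] le) auto
    next
      case False
      then show ?thesis using kernel_eq_0[OF R, of y] by (simp add: k[symmetric])
    qed
  qed
  also have "\<dots> = (\<integral>\<^sup>+y. ennreal (bump_kernel R (y::'a)) \<partial>lborel) * e2ennreal (ereal C - u x)"
    unfolding k by (rule nn_integral_multc) measurable
  also have "(\<integral>\<^sup>+y. ennreal (bump_kernel R (y::'a)) \<partial>lborel) = 1"
    using integral_kernel[OF R, where 'a='a] by (subst nn_integral_eq_integral) (auto simp: kernel_nonneg[OF R])
  finally show ?thesis by simp
qed

lemma ennreal_abs_real_of_ereal_le:
  assumes "u \<le> ereal C" "0 \<le> C"
  shows "ennreal \<bar>real_of_ereal u\<bar> \<le> ennreal C + e2ennreal (ereal C - u)"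
  using assms
  by (cases u) (auto simp: ennreal_plus[symmetric] simp del: ennreal_plus intro!: ennreal_leI)

text \<open>A single point x0 with u(x0) > -\<infinity> controls u on every ball: the kernel mean of
  C - u about x0 is finite, and the kernel is bounded below on its half ball.\<close>

lemma subharmonic_integrable_near:
  fixes u :: "'a::euclidean_space \<Rightarrow> ereal"
  assumes u: "subharmonic u"
  shows "set_integrable lborel (ball 0 N) (\<lambda>x. real_of_ereal (u x))"
    and "AE x in lborel. x \<in> ball 0 N \<longrightarrow> u x \<noteq> - \<infinity>"
proof -
  note [measurable] = subharmonic_measurable[OF u]
  obtain x0 where x0: "u x0 \<noteq> - \<infinity>" using u by (auto simp: subharmonic_def)
  \<comment> \<open>Half of R exceeds |N| + |x0|, hence the ball of radius N about 0 lies in the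
    half ball about x0. The absolute value allows for negative N.\<close>
  define R where "R = 2 * (\<bar>N\<bar> + norm x0 + 1)"
  have R: "0 < R" unfolding R_def by (simp add: add_nonneg_pos)
  obtain C where C: "0 \<le> C" and le: "\<And>y. y \<in> cball x0 R \<Longrightarrow> u y \<le> ereal C"
    using subharmonic_bounded_above_compact[OF u compact_cball] by blast
  obtain c where "0 < c" and c: "\<And>y::'a. norm y \<le> R / 2 \<Longrightarrow> c \<le> bump_kernel R y"
    using kernel_lower_bound[OF R] by blast
  have near: "norm (x - x0) \<le> R / 2" "x \<in> cball x0 R" if "x \<in> ball 0 N" for x
    using that norm_triangle_ineq4[of x x0] R by (auto simp: R_def dist_norm norm_minus_commute)
  have [measurable]: "ball (0::'a) N \<in> sets borel" by simp
  let ?g = "\<lambda>x. indicator (ball 0 N) x * e2ennreal (ereal C - u x)"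
  have "ennreal c * (\<integral>\<^sup>+x. ?g x \<partial>lborel) = (\<integral>\<^sup>+x. ennreal c * ?g x \<partial>lborel)"
    by (rule nn_integral_cmult[symmetric]) simp
  also have "\<dots> \<le> (\<integral>\<^sup>+x. ennreal (bump_kernel R (x - x0)) * e2ennreal (ereal C - u x) \<partial>lborel)"
  proof (rule nn_integral_mono)
    fix x
    show "ennreal c * ?g x \<le> ennreal (bump_kernel R (x - x0)) * e2ennreal (ereal C - u x)"
      using c[OF near(1), of x] by (cases "x \<in> ball 0 N") (auto intro!: mult_right_mono ennreal_leI)
  qed
  also have "\<dots> = (\<integral>\<^sup>+y. ennreal (bump_kernel R y) * e2ennreal (ereal C - u (x0 + y)) \<partial>lborel)"
    by (subst nn_integral_lborel_affine[of _ 1 x0]) auto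
  also have "\<dots> \<le> e2ennreal (ereal C - u x0)"
    by (rule subharmonic_kernel_supermean[OF u C R le])
  also have "\<dots> < top"
    using x0 subharmonic_less_top[OF u, of x0] by (cases "u x0") (auto simp: less_top[symmetric])
  finally have fin: "(\<integral>\<^sup>+x. ?g x \<partial>lborel) < top"
    using \<open>0 < c\<close> by (auto simp: ennreal_mult_less_top)
  show "set_integrable lborel (ball 0 N) (\<lambda>x. real_of_ereal (u x))"
    unfolding set_integrable_def
  proof (rule integrableI_bounded)
    have "(\<integral>\<^sup>+x. ennreal (norm (indicator (ball 0 N) x *\<^sub>R real_of_ereal (u x))) \<partial>lborel) \<le>
        (\<integral>\<^sup>+x. ennreal C * indicator (ball 0 N) x + ?g x \<partial>lborel)"
      using ennreal_abs_real_of_ereal_le[OF le C] near(2)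
      by (intro nn_integral_mono) (auto simp: indicator_def)
    also have "\<dots> = ennreal C * emeasure lborel (ball (0::'a) N) + (\<integral>\<^sup>+x. ?g x \<partial>lborel)"
      by (subst nn_integral_add) (auto simp: nn_integral_cmult_indicator)
    also have "\<dots> < top"
      using fin emeasure_bounded_finite[of "ball (0::'a) N"] by (auto simp: ennreal_mult_less_top)
    finally show "(\<integral>\<^sup>+x. ennreal (norm (indicator (ball 0 N) x *\<^sub>R real_of_ereal (u x))) \<partial>lborel) < \<infinity>"
      by simp
  qed measurable
  have "AE x in lborel. ?g x \<noteq> \<infinity>"
    using fin by (intro nn_integral_noteq_infinite) auto
  then show "AE x in lborel. x \<in> ball 0 N \<longrightarrow> u x \<noteq> - \<infinity>"
    by eventually_elim auto
qed

abbreviation real_fun :: "('a \<Rightarrow> ereal) \<Rightarrow> 'a \<Rightarrow> real" where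
  "real_fun u \<equiv> \<lambda>x. real_of_ereal (u x)"

lemma subharmonic_locally_integrable: "subharmonic u \<Longrightarrow> locally_integrable (real_fun u)"
  unfolding locally_integrable_def
  using subharmonic_integrable_near subharmonic_measurable by (auto intro: borel_measurable_real_of_ereal)

lemma subharmonic_AE_finite:
  fixes u :: "'a::euclidean_space \<Rightarrow> ereal"
  assumes "subharmonic u"
  shows "AE x in lborel. u x \<noteq> - \<infinity>"
proof -
  have "AE x in lborel. \<forall>n::nat. x \<in> ball 0 (real n) \<longrightarrow> u x \<noteq> - \<infinity>"
    unfolding AE_all_countable using subharmonic_integrable_near(2)[OF assms] by blast
  then show ?thesis
  proof eventually_elim
    case (elim x)
    obtain n where "norm x < real n" using reals_Archimedean2 by blast
    with elim show ?case by auto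
  qed
qed

lemma nn_integral_kernel_diff:
  fixes f :: "'a::euclidean_space \<Rightarrow> real"
  assumes f: "locally_integrable f" and R: "0 < R"
    and le: "AE y in lborel. norm y \<le> R \<longrightarrow> f (x + y) \<le> C"
  shows "(\<integral>\<^sup>+y. ennreal (bump_kernel R y) * ennreal (C - f (x + y)) \<partial>lborel) = ennreal (C - mollify R f x)"
    and "mollify R f x \<le> C"
proof -
  note [measurable] = locally_integrable_measurable[OF f]
  have int: "integrable lborel (\<lambda>y. bump_kernel R y * (C - f (x + y)))"
    using integrable_mollify(2)[OF f R, of x] integral_kernel(1)[OF R, where 'a='a]
    by (auto simp: algebra_simps)
  have nonneg: "AE y in lborel. 0 \<le> bump_kernel R y * (C - f (x + y))"
    using le
  proof eventually_elim
    case (elim y)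
    then show ?case using kernel_eq_0[OF R, of y] kernel_nonneg[OF R, of y] by (cases "norm y \<le> R") auto
  qed
  have eq: "(\<integral>y. bump_kernel R y * (C - f (x + y)) \<partial>lborel) = C - mollify R f x"
    using integrable_mollify(2)[OF f R, of x] integral_kernel[OF R, where 'a='a]
    by (simp add: mollify_shift algebra_simps)
  have "(\<integral>\<^sup>+y. ennreal (bump_kernel R y) * ennreal (C - f (x + y)) \<partial>lborel) =
      (\<integral>\<^sup>+y. ennreal (bump_kernel R y * (C - f (x + y))) \<partial>lborel)"
    by (simp add: ennreal_mult' kernel_nonneg[OF R])
  also have "\<dots> = ennreal (\<integral>y. bump_kernel R y * (C - f (x + y)) \<partial>lborel)"
    by (rule nn_integral_eq_integral[OF int nonneg])
  finally show "(\<integral>\<^sup>+y. ennreal (bump_kernel R y) * ennreal (C - f (x + y)) \<partial>lborel) = ennreal (C - mollify R f x)"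
    by (simp add: eq)
  show "mollify R f x \<le> C"
    using integral_nonneg_AE[OF nonneg] eq by simp
qed

lemma AE_shift:
  assumes "AE x in lborel. P (x::'a::euclidean_space)"
  shows "AE y in lborel. P (x + y)"
proof (rule AE_distrD[of "(+) x" lborel borel])
  show "AE y in distr lborel borel ((+) x). P y"
    unfolding lborel_distr_plus by (rule assms)
qed simp

text \<open>One exceptional point z is allowed, being a null set. It serves at the origin for limit
  functions, where the growth bound is first known only for y \<noteq> 0.\<close>

lemma subharmonic_mollify_le:
  fixes u :: "'a::euclidean_space \<Rightarrow> ereal"
  assumes u: "subharmonic u" and R: "0 < R"
    and le: "\<And>y. y \<in> cball x R \<Longrightarrow> y \<noteq> z \<Longrightarrow> u y \<le> ereal C"
  shows "mollify R (real_fun u) x \<le> C"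
proof (rule nn_integral_kernel_diff(2)[OF subharmonic_locally_integrable[OF u] R])
  have "AE y in lborel. u y \<noteq> - \<infinity> \<and> y \<noteq> z"
    using subharmonic_AE_finite[OF u] AE_lborel_singleton[of z] by eventually_elim auto
  from AE_shift[OF this, of x]
  show "AE y in lborel. norm y \<le> R \<longrightarrow> real_of_ereal (u (x + y)) \<le> C"
  proof eventually_elim
    case (elim y)
    then show ?case
      using le[of "x + y"] by (cases "u (x + y)") (auto simp: dist_norm)
  qed
qed

lemma subharmonic_nn_integral_kernel:
  fixes u :: "'a::euclidean_space \<Rightarrow> ereal"
  assumes u: "subharmonic u" and R: "0 < R"
    and le: "\<And>y. y \<in> cball x R \<Longrightarrow> u y \<le> ereal C"
  shows "(\<integral>\<^sup>+y. ennreal (bump_kernel R y) * e2ennreal (ereal C - u (x + y)) \<partial>lborel) =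
    ennreal (C - mollify R (real_fun u) x)"
proof -
  have *: "AE y in lborel. u (x + y) \<noteq> - \<infinity>"
    by (rule AE_shift[OF subharmonic_AE_finite[OF u]])
  have "(\<integral>\<^sup>+y. ennreal (bump_kernel R y) * e2ennreal (ereal C - u (x + y)) \<partial>lborel) =
      (\<integral>\<^sup>+y. ennreal (bump_kernel R y) * ennreal (C - real_of_ereal (u (x + y))) \<partial>lborel)"
  proof (rule nn_integral_cong_AE, use * in eventually_elim)
    case (elim y)
    then show ?case
      using subharmonic_less_top[OF u, of "x + y"] by (cases "u (x + y)") auto
  qed
  also have "\<dots> = ennreal (C - mollify R (real_fun u) x)"
  proof (rule nn_integral_kernel_diff(1)[OF subharmonic_locally_integrable[OF u] R], use * in eventually_elim)
    case (elim y)
    then show ?case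
      using le[of "x + y"] by (cases "u (x + y)") (auto simp: dist_norm)
  qed
  finally show ?thesis .
qed

lemma subharmonic_le_mollify:
  fixes u :: "'a::euclidean_space \<Rightarrow> ereal"
  assumes u: "subharmonic u" and R: "0 < R"
  shows "u x \<le> ereal (mollify R (real_fun u) x)"
proof -
  obtain C where C: "0 \<le> C" and le: "\<And>y. y \<in> cball x R \<Longrightarrow> u y \<le> ereal C"
    using subharmonic_bounded_above_compact[OF u compact_cball] by blast
  have "ennreal (C - mollify R (real_fun u) x) \<le> e2ennreal (ereal C - u x)"
    using subharmonic_kernel_supermean[OF u C R le] subharmonic_nn_integral_kernel[OF u R le] by simp
  moreover have "mollify R (real_fun u) x \<le> C"
    using subharmonic_mollify_le[OF u R le] by blast
  moreover have "u x \<le> ereal C" using R by (intro le) auto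
  ultimately show ?thesis
    by (cases "u x") auto
qed

lemma subharmonic_mollify_tendsto:
  fixes u :: "'a::euclidean_space \<Rightarrow> ereal"
  assumes u: "subharmonic u"
  shows "((\<lambda>R. ereal (mollify R (real_fun u) x)) \<longlongrightarrow> u x) (at_right 0)"
proof (rule order_tendstoI)
  fix a assume "a < u x"
  then show "\<forall>\<^sub>F R in at_right 0. a < ereal (mollify R (real_fun u) x)"
    using subharmonic_le_mollify[OF u]
    by (auto simp: eventually_at_right_field intro!: exI[of _ 1] intro: less_le_trans)
next
  fix a assume "u x < a"
  then obtain c where c: "u x < ereal c" "ereal c < a"
    using ereal_dense2 subharmonic_less_top[OF u] by (metis ereal_dense2)
  have "open {y. u y < ereal c}" using u by (simp add: subharmonic_def)
  then obtain d where d: "0 < d" "\<And>y. y \<in> cball x d \<Longrightarrow> u y < ereal c"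
    using c(1) open_contains_cball[of "{y. u y < ereal c}"] by (metis mem_Collect_eq subsetD)
  show "\<forall>\<^sub>F R in at_right 0. ereal (mollify R (real_fun u) x) < a"
    unfolding eventually_at_right_field
  proof (intro exI[of _ d] conjI allI impI)
    fix R assume R: "0 < R" "R < d"
    have "mollify R (real_fun u) x \<le> c"
      by (rule subharmonic_mollify_le[OF u R(1)]) (use d(2) R in \<open>auto intro!: less_imp_le\<close>)
    then show "ereal (mollify R (real_fun u) x) < a" using c(2) by (meson ereal_less_eq(3) le_less_trans)
  qed fact
qed

text \<open>Equality holds at every point, not merely almost everywhere, since the mollifications at
  a point recover the value there. A fixed sequence of radii is enough, which keeps the set of tests
  countable.\<close>

lemma subharmonic_eqI:
  fixes u v :: "'a::euclidean_space \<Rightarrow> ereal"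
  assumes "subharmonic u" "subharmonic v"
    and "\<And>j x. mollify (1 / real (Suc j)) (real_fun u) x = mollify (1 / real (Suc j)) (real_fun v) x"
  shows "u = v"
proof
  fix x
  have "filterlim (\<lambda>j. 1 / real (Suc j)) (at_right 0) sequentially"
    unfolding filterlim_at using LIMSEQ_Suc[OF lim_1_over_n] by (auto simp: eventually_sequentially)
  from filterlim_compose[OF subharmonic_mollify_tendsto[OF assms(1)] this]
    filterlim_compose[OF subharmonic_mollify_tendsto[OF assms(2)] this]
  show "u x = v x" unfolding assms(3) by (rule LIMSEQ_unique)
qed

subsection \<open>Monotonicity of mollifications in the radius\<close>

lemma exists_orthogonal_swap:
  fixes a b :: "'a::euclidean_space"
  assumes "norm a = 1" "norm b = 1"
  obtains g where "orthogonal_transformation g" "\<And>z. b \<bullet> z = a \<bullet> g z"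
proof (cases "a = b")
  case True
  then show ?thesis using that[of "\<lambda>x. x"] by simp
next
  case False
  define h where "h = a - b"
  \<comment> \<open>The reflection in the hyperplane orthogonal to a - b. It exchanges the unit
    vectors a and b and is symmetric, hence b . z = (g a) . z = a . g z.\<close>
  define g where "g z = z - (2 * (z \<bullet> h) / (h \<bullet> h)) *\<^sub>R h" for z
  have hh: "h \<bullet> h \<noteq> 0" using False by (simp add: h_def)
  have ab: "a \<bullet> a = 1" "b \<bullet> b = 1" using assms by (simp_all add: norm_eq_1)
  have ah: "2 * (a \<bullet> h) = h \<bullet> h"
    by (simp add: h_def inner_diff_left inner_diff_right ab inner_commute)
  have "linear g"
    unfolding g_def
    by (intro linearI) (simp_all add: inner_add_left algebra_simps add_divide_distrib)
  moreover have "g v \<bullet> g w = v \<bullet> w" for v w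
  proof -
    have "g v \<bullet> g w = v \<bullet> w - 2 * (w \<bullet> h) / (h \<bullet> h) * (v \<bullet> h) - 2 * (v \<bullet> h) / (h \<bullet> h) * (h \<bullet> w)
        + (2 * (v \<bullet> h) / (h \<bullet> h)) * (2 * (w \<bullet> h) / (h \<bullet> h)) * (h \<bullet> h)"
      unfolding g_def by (simp add: inner_diff_left inner_diff_right)
    also have "\<dots> = v \<bullet> w" using hh by (simp add: inner_commute field_simps)
    finally show ?thesis .
  qed
  ultimately have "orthogonal_transformation g" by (simp add: orthogonal_transformation_def)
  moreover have "b \<bullet> z = a \<bullet> g z" for z
  proof -
    have "a \<bullet> g z = a \<bullet> z - (z \<bullet> h) * (2 * (a \<bullet> h) / (h \<bullet> h))"
      unfolding g_def by (simp add: inner_diff_right)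
    also have "\<dots> = a \<bullet> z - z \<bullet> h" using hh by (simp add: ah)
    also have "\<dots> = b \<bullet> z" by (simp add: h_def inner_diff_right inner_commute)
    finally show ?thesis ..
  qed
  ultimately show ?thesis by (rule that)
qed

definition kernel_moment :: "'a::euclidean_space itself \<Rightarrow> real" where
  "kernel_moment _ = (\<integral>z. (norm (z::'a))\<^sup>2 * bump_kernel 1 z \<partial>lborel)"

lemma integrable_continuous_kernel:
  fixes f :: "'a::euclidean_space \<Rightarrow> real"
  assumes "continuous_on UNIV f" "0 < R"
  shows "integrable lborel (\<lambda>z. f z * bump_kernel R z)"
  using integrable_mollify(2)[OF locally_integrable_continuous[OF assms(1)] assms(2), of 0] by simp

lemma kernel_orthogonal:
  fixes g :: "'a::euclidean_space \<Rightarrow> 'a"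
  shows "orthogonal_transformation g \<Longrightarrow> bump_kernel R (g z) = bump_kernel R z"
  by (simp add: bump_kernel_def bump_def orthogonal_transformation_norm)

lemma kernel_first_moment:
  fixes y :: "'a::euclidean_space"
  shows "(\<integral>z. (y \<bullet> z) * bump_kernel R z \<partial>lborel) = 0"
proof -
  have "(\<integral>z. (y \<bullet> z) * bump_kernel R z \<partial>lborel) = (\<integral>z. (y \<bullet> (- z)) * bump_kernel R (- z) \<partial>lborel)"
    using integral_lborel_orthogonal(2)[of "\<lambda>z::'a. - z" "\<lambda>z. (y \<bullet> z) * bump_kernel R z"]
    by (simp add: orthogonal_transformation_neg)
  also have "\<dots> = - (\<integral>z. (y \<bullet> z) * bump_kernel R z \<partial>lborel)"
    by (simp add: kernel_minus)
  finally show ?thesis by simp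
qed

text \<open>Rotation invariance makes the integral of (e . z)^2 the same for all unit vectors e.
  Summed over an orthonormal basis it is the full second moment, hence the division by the
  dimension.\<close>

lemma kernel_second_moment:
  fixes y :: "'a::euclidean_space"
  shows "(\<integral>z. (y \<bullet> z)\<^sup>2 * bump_kernel 1 z \<partial>lborel) =
    (norm y)\<^sup>2 * kernel_moment TYPE('a) / DIM('a)"
proof -
  let ?q = "\<lambda>e::'a. \<integral>z. (e \<bullet> z)\<^sup>2 * bump_kernel 1 z \<partial>lborel"
  have int: "integrable lborel (\<lambda>z. (e \<bullet> z)\<^sup>2 * bump_kernel 1 z)" for e :: 'a
    by (intro integrable_continuous_kernel continuous_intros) simp
  have eq: "?q b = ?q a" if "norm a = 1" "norm b = 1" for a b
  proof -
    obtain g where g: "orthogonal_transformation g" "\<And>z. b \<bullet> z = a \<bullet> g z"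
      using exists_orthogonal_swap[OF \<open>norm a = 1\<close> \<open>norm b = 1\<close>] by blast
    have "?q b = (\<integral>z. (a \<bullet> g z)\<^sup>2 * bump_kernel 1 (g z) \<partial>lborel)"
      by (simp add: g kernel_orthogonal)
    also have "\<dots> = ?q a"
      by (rule integral_lborel_orthogonal(2)[OF g(1), of "\<lambda>z. (a \<bullet> z)\<^sup>2 * bump_kernel 1 z"]) measurable
    finally show ?thesis .
  qed
  have unit: "?q e = kernel_moment TYPE('a) / DIM('a)" if "norm e = 1" for e
  proof -
    have "kernel_moment TYPE('a) = (\<integral>z. (\<Sum>b\<in>Basis. ((b::'a) \<bullet> z)\<^sup>2 * bump_kernel 1 z) \<partial>lborel)"
      unfolding kernel_moment_def sum_distrib_right[symmetric] power2_norm_eq_inner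
      by (subst euclidean_inner) (simp add: power2_eq_square inner_commute)
    also have "\<dots> = (\<Sum>b\<in>Basis. ?q b)" using int by (simp add: Bochner_Integration.integral_sum)
    also have "\<dots> = DIM('a) * ?q e" using eq[OF that] by simp
    finally show ?thesis by simp
  qed
  show ?thesis
  proof (cases "y = 0")
    case False
    have "(y \<bullet> z)\<^sup>2 = (norm y)\<^sup>2 * (sgn y \<bullet> z)\<^sup>2" for z
      using False by (simp add: sgn_div_norm power_mult_distrib field_simps)
    then have "?q y = (norm y)\<^sup>2 * ?q (sgn y)" by (simp add: mult.assoc)
    then show ?thesis using unit[of "sgn y"] False by (simp add: norm_sgn)
  qed simp
qed

lemma kernel_moment_pos: "0 < kernel_moment TYPE('a::euclidean_space)"
proof -
  have int: "integrable lborel (\<lambda>z::'a. (norm z)\<^sup>2 * bump_kernel 1 z)"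
    by (intro integrable_continuous_kernel continuous_intros) simp
  have "kernel_moment TYPE('a) \<noteq> 0"
  proof
    assume "kernel_moment TYPE('a) = 0"
    then have "AE z in lborel. (norm (z::'a))\<^sup>2 * bump_kernel 1 z = 0"
      using integral_nonneg_eq_0_iff_AE[OF int] by (simp add: kernel_moment_def kernel_nonneg)
    then have "AE z in lborel. bump_kernel 1 (z::'a) = 0"
      using AE_lborel_singleton[of 0] by eventually_elim auto
    then have "(\<integral>z. bump_kernel 1 (z::'a) \<partial>lborel) = 0"
      by (rule integral_eq_zero_AE)
    then show False using integral_kernel(2)[of 1, where 'a='a] by simp
  qed
  moreover have "0 \<le> kernel_moment TYPE('a)"
    unfolding kernel_moment_def by (intro integral_nonneg_AE) (auto simp: kernel_nonneg)
  ultimately show ?thesis by simp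
qed

text \<open>The potential satisfies \<open>\<nabla> potential y = - bump y y\<close>; its Laplacian is therefore
  \<open>- div (bump y y)\<close>, which is also the derivative of the dilations of \<open>bump\<close> in the radius.\<close>

definition potential :: "'a::euclidean_space \<Rightarrow> real" where
  "potential y = flat 0 (1 - (norm y)\<^sup>2) / 8"

text \<open>The Hessian of \<open>potential\<close> at y as a quadratic form in z, that is, the
  second derivative along the line through y in direction z. Its trace is
  \<open>potential_laplacian\<close>.\<close>

definition potential_hessian :: "'a::euclidean_space \<Rightarrow> 'a \<Rightarrow> real" where
  "potential_hessian y z = (y \<bullet> z)\<^sup>2 * (flat' 2 (1 - (norm y)\<^sup>2) / 2) - (norm z)\<^sup>2 * bump y"

definition potential_laplacian :: "'a::euclidean_space \<Rightarrow> real" where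
  "potential_laplacian y = (norm y)\<^sup>2 * (flat' 2 (1 - (norm y)\<^sup>2) / 2) - DIM('a) * bump y"

lemma flat'_eq_0: "s \<le> 0 \<Longrightarrow> flat' n s = 0"
  by (simp add: flat'_def flat_eq_0)

lemma one_le_norm_sq: "1 \<le> norm y \<Longrightarrow> 1 - (norm y)\<^sup>2 \<le> 0"
  using power_mono[of 1 "norm y" 2] by simp

lemma potential_eq_0: "1 \<le> norm y \<Longrightarrow> potential y = 0"
  by (simp add: potential_def flat_eq_0 one_le_norm_sq)

lemma potential_hessian_eq_0: "1 \<le> norm y \<Longrightarrow> potential_hessian y z = 0"
  by (simp add: potential_hessian_def flat'_eq_0 one_le_norm_sq bump_eq_0)

lemma potential_laplacian_eq_0: "1 \<le> norm y \<Longrightarrow> potential_laplacian y = 0"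
  by (simp add: potential_laplacian_def flat'_eq_0 one_le_norm_sq bump_eq_0)

lemma potential_nonneg: "0 \<le> potential y"
  by (simp add: potential_def flat_nonneg)

lemma continuous_on_potential [continuous_intros]:
  "continuous_on S f \<Longrightarrow> continuous_on S (\<lambda>x. potential (f x))"
  unfolding potential_def by (intro continuous_intros) simp_all

lemma continuous_on_potential_laplacian [continuous_intros]:
  "continuous_on S f \<Longrightarrow> continuous_on S (\<lambda>x. potential_laplacian (f x))"
  unfolding potential_laplacian_def by (intro continuous_intros) simp_all

lemma continuous_on_potential_hessian [continuous_intros]:
  "continuous_on S f \<Longrightarrow> continuous_on S g \<Longrightarrow> continuous_on S (\<lambda>x. potential_hessian (f x) (g x))"
  unfolding potential_hessian_def by (intro continuous_intros) simp_all

lemma potential_measurable [measurable]: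
  "potential \<in> borel_measurable borel" "potential_laplacian \<in> borel_measurable borel"
  by (intro borel_measurable_continuous_onI continuous_intros)+

lemma DERIV_norm_line:
  "((\<lambda>t. 1 - (norm (y + t *\<^sub>R z))\<^sup>2) has_real_derivative - 2 * ((y + t *\<^sub>R z) \<bullet> z)) (at t)"
  unfolding power2_norm_eq_inner
  by (auto intro!: derivative_eq_intros simp: inner_commute algebra_simps has_field_derivative_def)

lemma DERIV_potential_line:
  "((\<lambda>t. potential (y + t *\<^sub>R z)) has_real_derivative - ((y + t *\<^sub>R z) \<bullet> z) * bump (y + t *\<^sub>R z)) (at t)"
proof -
  have *: "flat' 0 s = flat 2 s" for s by (simp add: flat'_def numeral_2_eq_2)
  show ?thesis
    unfolding potential_def bump_def
    by (rule DERIV_cong[OF DERIV_cdivide[OF DERIV_chain2[OF DERIV_flat DERIV_norm_line]]])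
       (simp add: *)
qed

lemma DERIV_bump_line:
  "((\<lambda>t. bump (y + t *\<^sub>R z)) has_real_derivative
    - ((y + t *\<^sub>R z) \<bullet> z) * (flat' 2 (1 - (norm (y + t *\<^sub>R z))\<^sup>2) / 2)) (at t)"
  unfolding bump_def
  by (rule DERIV_cong[OF DERIV_cdivide[OF DERIV_chain2[OF DERIV_flat DERIV_norm_line]]]) simp

lemma DERIV_potential_line_2:
  "((\<lambda>t. - ((y + t *\<^sub>R z) \<bullet> z) * bump (y + t *\<^sub>R z)) has_real_derivative
    potential_hessian (y + t *\<^sub>R z) z) (at t)"
proof -
  have 1: "((\<lambda>t. - ((y + t *\<^sub>R z) \<bullet> z)) has_real_derivative - (norm z)\<^sup>2) (at t)"
    by (auto intro!: derivative_eq_intros simp: power2_norm_eq_inner has_field_derivative_def algebra_simps)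
  show ?thesis
    by (rule DERIV_cong[OF DERIV_mult[OF 1 DERIV_bump_line]])
       (simp add: potential_hessian_def power2_eq_square)
qed

text \<open>Averaging a quadratic form against a rotation-invariant kernel leaves its trace, times
  the second moment divided by the dimension.\<close>

lemma integral_hessian_kernel:
  fixes y :: "'a::euclidean_space"
  shows "(\<integral>z. potential_hessian y z * bump_kernel 1 z \<partial>lborel) =
    kernel_moment TYPE('a) / DIM('a) * potential_laplacian y"
proof -
  define F where "F = flat' 2 (1 - (norm y)\<^sup>2) / 2"
  have "integrable lborel (\<lambda>z. (y \<bullet> z)\<^sup>2 * bump_kernel 1 z)" "integrable lborel (\<lambda>z::'a. (norm z)\<^sup>2 * bump_kernel 1 z)"
    by (intro integrable_continuous_kernel continuous_intros; simp)+
  then have "(\<integral>z. F * ((y \<bullet> z)\<^sup>2 * bump_kernel 1 z) - bump y * ((norm z)\<^sup>2 * bump_kernel 1 z) \<partial>lborel) =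
      F * ((norm y)\<^sup>2 * kernel_moment TYPE('a) / DIM('a)) - bump y * kernel_moment TYPE('a)"
    by (simp add: kernel_second_moment kernel_moment_def[where 'a='a])
  also have "(\<lambda>z. F * ((y \<bullet> z)\<^sup>2 * bump_kernel 1 z) - bump y * ((norm z)\<^sup>2 * bump_kernel 1 z)) =
      (\<lambda>z. potential_hessian y z * bump_kernel 1 z)"
    by (simp add: potential_hessian_def F_def fun_eq_iff algebra_simps)
  finally show ?thesis
    by (simp add: potential_laplacian_def F_def[symmetric] field_simps)
qed

lemma mollify_unit_scale:
  fixes f :: "'a::euclidean_space \<Rightarrow> real"
  assumes [measurable]: "f \<in> borel_measurable borel" and "0 < e"
  shows "mollify e f y = (\<integral>z. f (y + e *\<^sub>R z) * bump_kernel 1 z \<partial>lborel)"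
proof -
  have "bump_kernel e (e *\<^sub>R z) = bump_kernel 1 z / e ^ DIM('a)" for z :: 'a
    using \<open>0 < e\<close> by (simp add: bump_kernel_def)
  moreover have "mollify e f y = \<bar>e\<bar> ^ DIM('a) * (\<integral>z. f (y + e *\<^sub>R z) * bump_kernel e (e *\<^sub>R z) \<partial>lborel)"
    unfolding mollify_def
    using integral_lborel_affine(2)[of "\<lambda>z. f z * bump_kernel e (z - y)" e y] \<open>0 < e\<close> by simp
  ultimately show ?thesis using \<open>0 < e\<close> by simp
qed

text \<open>The Laplacian appears as the e^2 coefficient of the mollification: the linear Taylor
  term vanishes because the kernel is even, and the quadratic term leaves the trace. The error is
  uniform in y, so it survives integration against a function that is merely L^1 on balls.\<close>

lemma mollify_potential_approx:
  assumes "0 < \<eta>"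
  obtains e where "0 < e" "e \<le> 1"
    "\<And>y::'a::euclidean_space. \<bar>mollify e potential y - potential y -
       e\<^sup>2 / 2 * (kernel_moment TYPE('a) / DIM('a) * potential_laplacian y)\<bar> \<le> e\<^sup>2 / 2 * \<eta>"
proof -
  let ?H = "\<lambda>(y, z). potential_hessian y z"
  \<comment> \<open>For |y| \<le> 2 and increments of norm at most e \<le> 1 the points stay in the
    ball of radius 3. For |y| > 2 both points have norm at least 1, where the Hessian
    vanishes.\<close>
  have "uniformly_continuous_on (cball (0::'a) 3 \<times> cball (0::'a) 1) ?H"
    by (intro compact_uniformly_continuous compact_Times)
       (auto simp: case_prod_beta' intro!: continuous_intros)
  then obtain d where "0 < d" and d: "\<And>y y' z::'a. y \<in> cball 0 3 \<Longrightarrow> y' \<in> cball 0 3 \<Longrightarrow> z \<in> cball 0 1 \<Longrightarrow>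
      dist y y' < d \<Longrightarrow> dist (potential_hessian y z) (potential_hessian y' z) < \<eta>"
    using assms unfolding uniformly_continuous_on_def
    by (auto simp: dist_prod_def)
  define e where "e = min (d / 2) 1"
  have e: "0 < e" "e \<le> 1" "e < d" using \<open>0 < d\<close> by (auto simp: e_def)
  have hess: "\<bar>potential_hessian (y + t *\<^sub>R z) z - potential_hessian y z\<bar> \<le> \<eta>"
    if "norm z \<le> 1" "0 \<le> t" "t \<le> e" for y z :: 'a and t
  proof -
    have tz: "norm (t *\<^sub>R z) \<le> e" using that mult_mono[of t e "norm z" 1] e by simp
    show ?thesis
    proof (cases "norm y \<le> 2")
      case True
      have "norm (y + t *\<^sub>R z) \<le> 3" using norm_triangle_ineq[of y "t *\<^sub>R z"] tz e True by simp
      then have "y + t *\<^sub>R z \<in> cball 0 3" "y \<in> cball 0 3" "z \<in> cball 0 1"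
        using True that by (auto simp only: mem_cball_0)
      moreover have "dist (y + t *\<^sub>R z) y < d" using tz e by (simp add: dist_norm)
      ultimately have "dist (potential_hessian (y + t *\<^sub>R z) z) (potential_hessian y z) < \<eta>"
        by (rule d)
      then show ?thesis by (simp add: dist_real_def)
    next
      case False
      have "1 \<le> norm (y + t *\<^sub>R z)"
        using norm_diff_ineq[of y "t *\<^sub>R z"] tz e False by linarith
      then show ?thesis using False assms by (simp add: potential_hessian_eq_0)
    qed
  qed
  have taylor: "\<bar>potential (y + e *\<^sub>R z) - potential y - e * (- (y \<bullet> z) * bump y) - e\<^sup>2 / 2 * potential_hessian y z\<bar>
      \<le> e\<^sup>2 / 2 * \<eta>" if z: "norm z \<le> 1" for y z :: 'a
  proof -
    define diff where "diff m = (if m = 0 then (\<lambda>t. potential (y + t *\<^sub>R z))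
      else if m = 1 then (\<lambda>t. - ((y + t *\<^sub>R z) \<bullet> z) * bump (y + t *\<^sub>R z))
      else (\<lambda>t. potential_hessian (y + t *\<^sub>R z) z))" for m :: nat
    \<comment> \<open>Second order Taylor formula along the segment with the remainder at an
      intermediate t. Replacing the Hessian there by the one at y costs \<eta>.\<close>
    have "\<exists>t. 0 < t \<and> t < e \<and> potential (y + e *\<^sub>R z) =
        (\<Sum>m<2. diff m 0 / fact m * e ^ m) + diff 2 t / fact 2 * e ^ 2"
    proof (rule Maclaurin[OF e(1)])
      show "\<forall>m t. m < 2 \<and> 0 \<le> t \<and> t \<le> e \<longrightarrow> (diff m has_real_derivative diff (Suc m) t) (at t)"
      proof (intro allI impI)
        fix m :: nat and t assume "m < 2 \<and> 0 \<le> t \<and> t \<le> e"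
        then consider "m = 0" | "m = 1" by linarith
        then show "(diff m has_real_derivative diff (Suc m) t) (at t)"
          using DERIV_potential_line[of y z t] DERIV_potential_line_2[of y z t]
          by cases (simp_all only: diff_def if_True if_False One_nat_def nat.distinct nat.inject simp_thms)
      qed
    qed (simp_all add: diff_def)
    then obtain t where t: "0 < t" "t < e" "potential (y + e *\<^sub>R z) =
        potential y + e * (- (y \<bullet> z) * bump y) + e\<^sup>2 / 2 * potential_hessian (y + t *\<^sub>R z) z"
      by (auto simp: diff_def numeral_2_eq_2 algebra_simps)
    have "\<bar>e\<^sup>2 / 2 * (potential_hessian (y + t *\<^sub>R z) z - potential_hessian y z)\<bar> \<le> e\<^sup>2 / 2 * \<eta>"
      unfolding abs_mult using hess[OF z, of t y] t e by (intro mult_mono) auto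
    then show ?thesis unfolding t(3) by (simp add: algebra_simps)
  qed
  have bound: "\<bar>mollify e potential y - potential y -
       e\<^sup>2 / 2 * (kernel_moment TYPE('a) / DIM('a) * potential_laplacian y)\<bar> \<le> e\<^sup>2 / 2 * \<eta>" for y :: 'a
  proof -
    let ?k = "bump_kernel 1 :: 'a \<Rightarrow> real"
    have i: "integrable lborel (\<lambda>z. potential (y + e *\<^sub>R z) * ?k z)" "integrable lborel (\<lambda>z. potential y * ?k z)"
      "integrable lborel (\<lambda>z. (y \<bullet> z) * ?k z)" "integrable lborel (\<lambda>z. potential_hessian y z * ?k z)"
      by (intro integrable_continuous_kernel continuous_intros; simp)+
    let ?E = "\<lambda>z. potential (y + e *\<^sub>R z) * ?k z - potential y * ?k z - (- e * bump y) * ((y \<bullet> z) * ?k z)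
        - e\<^sup>2 / 2 * (potential_hessian y z * ?k z)"
    have "(\<integral>z. ?E z \<partial>lborel) = mollify e potential y - potential y -
       e\<^sup>2 / 2 * (kernel_moment TYPE('a) / DIM('a) * potential_laplacian y)"
      using i integral_kernel[of 1, where 'a='a] e
      by (simp add: mollify_unit_scale kernel_first_moment integral_hessian_kernel)
    moreover have "\<bar>\<integral>z. ?E z \<partial>lborel\<bar> \<le> (\<integral>z. e\<^sup>2 / 2 * \<eta> * ?k z \<partial>lborel)"
    proof (rule order_trans[OF integral_abs_bound integral_mono])
      show "integrable lborel (\<lambda>z. \<bar>?E z\<bar>)" using i by (intro integrable_abs) simp
      show "integrable lborel (\<lambda>z. e\<^sup>2 / 2 * \<eta> * ?k z)" using integral_kernel[of 1, where 'a='a] by simp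
      show "\<bar>?E z\<bar> \<le> e\<^sup>2 / 2 * \<eta> * ?k z" for z
      proof (cases "norm z \<le> 1")
        case True
        have "?E z = (potential (y + e *\<^sub>R z) - potential y - e * (- (y \<bullet> z) * bump y) - e\<^sup>2 / 2 * potential_hessian y z) * ?k z"
          by (simp add: algebra_simps)
        moreover note mult_right_mono[OF taylor[OF True, of y] kernel_nonneg[OF zero_less_one, of z]]
        ultimately show ?thesis
          using kernel_nonneg[of 1 z] by (simp only: abs_mult abs_of_nonneg)
      next
        case False
        then show ?thesis by (simp add: kernel_eq_0)
      qed
    qed
    ultimately show ?thesis using integral_kernel[of 1, where 'a='a] by simp
  qed
  show thesis by (rule that[OF e(1,2) bound])
qed

lemma bounded_compact_support:
  fixes \<phi> :: "'a::euclidean_space \<Rightarrow> real"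
  assumes "continuous_on UNIV \<phi>" "\<And>x. x \<notin> ball 0 N \<Longrightarrow> \<phi> x = 0"
  obtains B where "0 \<le> B" "\<And>x. \<bar>\<phi> x\<bar> \<le> B"
proof -
  have "bounded (\<phi> ` cball 0 N)"
    using assms(1) by (intro compact_imp_bounded compact_continuous_image) (auto intro: continuous_on_subset)
  then obtain B where B: "\<And>x. x \<in> cball 0 N \<Longrightarrow> \<bar>\<phi> x\<bar> \<le> B"
    unfolding bounded_iff ball_simps real_norm_def by blast
  show thesis
  proof (rule that[of "max B 0"])
    show "\<bar>\<phi> x\<bar> \<le> max B 0" for x
      using B[of x] assms(2)[of x] by (cases "x \<in> ball 0 N") (auto simp: le_max_iff_disj)
  qed simp
qed

lemma integrable_locally_integrable_times:
  fixes f \<phi> :: "'a::euclidean_space \<Rightarrow> real"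
  assumes "locally_integrable f" "continuous_on UNIV \<phi>" "\<And>x. x \<notin> ball 0 N \<Longrightarrow> \<phi> x = 0"
  shows "integrable lborel (\<lambda>x. f x * \<phi> x)"
proof -
  obtain B where "\<And>x. \<bar>\<phi> x\<bar> \<le> B" using bounded_compact_support[OF assms(2,3)] by blast
  then show ?thesis
    using assms by (intro integrable_locally_integrable_mult(1)[where N=N])
      (auto intro: borel_measurable_continuous_onI)
qed

lemma mollify_support:
  fixes \<phi> :: "'a::euclidean_space \<Rightarrow> real"
  assumes "\<And>x. x \<notin> ball 0 N \<Longrightarrow> \<phi> x = 0" "0 < R" "x \<notin> ball 0 (N + R)"
  shows "mollify R \<phi> x = 0"
proof -
  have "\<phi> y * bump_kernel R (y - x) = 0" for y
  proof (cases "y \<in> ball 0 N")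
    case True
    then have "R \<le> norm (y - x)" using assms(3) norm_triangle_ineq2[of x y] by (simp add: norm_minus_commute)
    then show ?thesis using kernel_eq_0[OF assms(2), of "y - x"] by simp
  qed (use assms in simp)
  then show ?thesis by (simp only: mollify_def) simp
qed

text \<open>Fubini and the evenness of the kernel. Absolute integrability on the product holds
  because the mollification of |f| is continuous and \<phi> has compact support.\<close>

lemma mollify_adjoint:
  fixes f \<phi> :: "'a::euclidean_space \<Rightarrow> real"
  assumes f: "locally_integrable f" and \<phi>: "continuous_on UNIV \<phi>" "\<And>x. x \<notin> ball 0 N \<Longrightarrow> \<phi> x = 0"
    and R: "0 < R"
  shows "(\<integral>x. mollify R f x * \<phi> x \<partial>lborel) = (\<integral>x. f x * mollify R \<phi> x \<partial>lborel)"
proof -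
  note [measurable] = locally_integrable_measurable[OF f] borel_measurable_continuous_onI[OF \<phi>(1)]
  let ?h = "\<lambda>x y. f y * bump_kernel R (y - x) * \<phi> x"
  have abs_f: "locally_integrable (\<lambda>x. \<bar>f x\<bar>)"
    by (rule locally_integrable_abs[OF f])
  have eq: "(\<integral>y. \<bar>?h x y\<bar> \<partial>lborel) = mollify R (\<lambda>x. \<bar>f x\<bar>) x * \<bar>\<phi> x\<bar>" for x
    unfolding mollify_def by (simp add: abs_mult kernel_nonneg[OF R])
  have "integrable (lborel \<Otimes>\<^sub>M lborel) (\<lambda>(x, y). ?h x y)"
  proof (rule lborel_pair.Fubini_integrable)
    show "integrable lborel (\<lambda>x. \<integral>y. norm (case (x, y) of (x, y) \<Rightarrow> ?h x y) \<partial>lborel)"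
      using \<phi>
      by (simp add: eq)
         (intro integrable_locally_integrable_times[where N=N] locally_integrable_continuous
          continuous_on_mollify[OF abs_f R] continuous_intros; simp)
    show "AE x in lborel. integrable lborel (\<lambda>y. case (x, y) of (x, y) \<Rightarrow> ?h x y)"
      using integrable_mollify(1)[OF f R] by simp
  qed measurable
  then have "(\<integral>y. (\<integral>x. ?h x y \<partial>lborel) \<partial>lborel) = (\<integral>x. (\<integral>y. ?h x y \<partial>lborel) \<partial>lborel)"
    by (rule lborel_pair.Fubini_integral)
  moreover have "(\<integral>y. ?h x y \<partial>lborel) = mollify R f x * \<phi> x" for x
    unfolding mollify_def by (rule integral_mult_left_zero)
  moreover have "(\<integral>x. ?h x y \<partial>lborel) = f y * mollify R \<phi> y" for y
  proof -
    have "(\<lambda>x. ?h x y) = (\<lambda>x. f y * (\<phi> x * bump_kernel R (x - y)))"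
      by (simp add: fun_eq_iff kernel_minus_commute[of R y])
    then show ?thesis by (simp add: mollify_def)
  qed
  ultimately show ?thesis by (simp only:)
qed

text \<open>Subharmonicity enters through the fact that u lies below its mollification. Integrated
  against the nonnegative \<open>potential\<close>, with the mollification moved over by
  adjointness, this says that u pairs nonnegatively with mollified minus original potential, whose
  e^2 coefficient is a positive multiple of the Laplacian.\<close>

lemma subharmonic_laplacian_nonneg:
  fixes u :: "'a::euclidean_space \<Rightarrow> ereal"
  assumes u: "subharmonic u"
  shows "0 \<le> (\<integral>y. real_of_ereal (u y) * potential_laplacian y \<partial>lborel)"
proof (rule field_le_epsilon)
  fix \<delta> :: real assume "0 < \<delta>"
  let ?f = "real_fun u"
  let ?L = "\<integral>y. ?f y * potential_laplacian y \<partial>lborel"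
  have f: "locally_integrable ?f" by (rule subharmonic_locally_integrable[OF u])
  define S where "S = kernel_moment TYPE('a) / DIM('a)"
  have S: "0 < S" using kernel_moment_pos[where 'a='a] by (simp add: S_def)
  let ?B = "ball_norm 2 ?f"
  have B: "0 \<le> ?B" by (rule ball_norm_nonneg)
  \<comment> \<open>Chosen so that the error \<eta> * \<open>?B\<close>, divided by the constant S
    of the expansion, is at most \<delta>; the 1 guards against a vanishing norm.\<close>
  define \<eta> where "\<eta> = \<delta> * S / (?B + 1)"
  have \<eta>: "0 < \<eta>" using \<open>0 < \<delta>\<close> S B by (simp add: \<eta>_def)
  obtain e where e: "0 < e" "e \<le> 1"
    and approx: "\<And>y::'a. \<bar>mollify e potential y - potential y - e\<^sup>2 / 2 * (S * potential_laplacian y)\<bar> \<le> e\<^sup>2 / 2 * \<eta>"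
    using mollify_potential_approx[OF \<eta>, where 'a='a] unfolding S_def by metis
  have supp: "potential y = 0" "potential_laplacian y = 0" if "y \<notin> ball 0 1" for y :: 'a
    using that by (simp_all add: potential_eq_0 potential_laplacian_eq_0)
  have supp2: "potential y = 0" "potential_laplacian y = 0" "mollify e potential y = 0" if "y \<notin> ball 0 2" for y :: 'a
    using that e by (auto intro!: mollify_support[OF supp(1)] simp: potential_eq_0 potential_laplacian_eq_0)
  have cont: "continuous_on UNIV (mollify e (potential :: 'a \<Rightarrow> real))"
    using e by (intro continuous_on_mollify locally_integrable_continuous continuous_intros)
  have [measurable]: "mollify e (potential :: 'a \<Rightarrow> real) \<in> borel_measurable borel"
    by (rule borel_measurable_continuous_onI[OF cont])
  have i: "integrable lborel (\<lambda>y. ?f y * mollify e potential y)" "integrable lborel (\<lambda>y. ?f y * potential y)"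
      "integrable lborel (\<lambda>y. ?f y * potential_laplacian y)"
    by (intro integrable_locally_integrable_times[OF f, where N=2] cont supp2 continuous_intros; simp)+
  have "0 \<le> (\<integral>y. (mollify e ?f y - ?f y) * potential y \<partial>lborel)"
  proof (rule integral_nonneg_AE, use subharmonic_AE_finite[OF u] in eventually_elim)
    case (elim y)
    then show ?case
      using subharmonic_le_mollify[OF u e(1), of y] subharmonic_less_top[OF u, of y] potential_nonneg[of y]
      by (cases "u y") auto
  qed
  also have "\<dots> = (\<integral>y. mollify e ?f y * potential y \<partial>lborel) - (\<integral>y. ?f y * potential y \<partial>lborel)"
    unfolding left_diff_distrib
    by (intro Bochner_Integration.integral_diff i(2)
        integrable_locally_integrable_times[where N=1] locally_integrable_continuous
        continuous_on_mollify f e supp continuous_intros; simp)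
  also have "(\<integral>y. mollify e ?f y * potential y \<partial>lborel) = (\<integral>y. ?f y * mollify e potential y \<partial>lborel)"
    by (intro mollify_adjoint[where N=1] f e supp continuous_intros; simp)
  finally have 1: "(\<integral>y. ?f y * potential y \<partial>lborel) \<le> (\<integral>y. ?f y * mollify e potential y \<partial>lborel)" by simp
  let ?err = "\<lambda>y::'a. mollify e potential y - potential y - e\<^sup>2 / 2 * (S * potential_laplacian y)"
  have "\<bar>\<integral>y. ?f y * ?err y \<partial>lborel\<bar> \<le> e\<^sup>2 / 2 * \<eta> * ?B"
    by (rule integrable_locally_integrable_mult(2)[OF f _ approx]) (use supp2 in auto)
  moreover have "(\<integral>y. ?f y * ?err y \<partial>lborel) =
      (\<integral>y. ?f y * mollify e potential y \<partial>lborel) - (\<integral>y. ?f y * potential y \<partial>lborel) - e\<^sup>2 / 2 * S * ?L"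
  proof -
    have "(\<lambda>y. ?f y * ?err y) = (\<lambda>y. ?f y * mollify e potential y - ?f y * potential y
        - e\<^sup>2 / 2 * S * (?f y * potential_laplacian y))"
      by (simp add: fun_eq_iff algebra_simps)
    then show ?thesis using i by simp
  qed
  ultimately have "0 \<le> e\<^sup>2 / 2 * (S * ?L + \<eta> * ?B)"
    using 1 by (simp add: algebra_simps)
  then have "0 \<le> S * ?L + \<eta> * ?B" using e by (simp add: zero_le_mult_iff)
  moreover have "\<eta> * ?B \<le> \<delta> * S"
    using \<open>0 < \<delta>\<close> S B by (simp add: \<eta>_def field_simps)
  ultimately have "0 \<le> S * (?L + \<delta>)" by (simp add: algebra_simps)
  then show "0 \<le> ?L + \<delta>" using S by (simp add: zero_le_mult_iff)
qed

text \<open>Similarities carry spheres to spheres, and the means agree because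
  \<open>sphere_measure\<close> is invariant under g.\<close>

lemma subharmonic_similarity:
  fixes u :: "'a::euclidean_space \<Rightarrow> ereal" and g :: "'a \<Rightarrow> 'a"
  assumes u: "subharmonic u" and g: "orthogonal_transformation g" and "0 < c"
  shows "subharmonic (\<lambda>y. u (x + c *\<^sub>R g y))"
proof -
  note [measurable] = subharmonic_measurable[OF u] orthogonal_transformation_measurable[OF g]
  have lin: "linear g" by (rule orthogonal_transformation_linear[OF g])
  let ?A = "\<lambda>y. x + c *\<^sub>R g y"
  have A: "?A (y + r *\<^sub>R s) = ?A y + (c * r) *\<^sub>R g s" for y s r
    by (simp add: linear_add[OF lin] linear_scale[OF lin] algebra_simps)
  have inv: "(\<integral>\<^sup>+s. h (g s) \<partial>sphere_measure) = (\<integral>\<^sup>+s. h s \<partial>(sphere_measure :: 'a measure))"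
    if [measurable]: "h \<in> borel_measurable borel" for h
    by (subst (2) distr_sphere_measure_orthogonal[OF g, symmetric]) (simp add: nn_integral_distr)
  have mean: "sphere_mean (\<lambda>y. u (?A y)) y r = sphere_mean u (?A y) (c * r)" for y r
    unfolding sphere_mean_def A
    using inv[of "\<lambda>s. e2ennreal (u (?A y + (c * r) *\<^sub>R s))"] inv[of "\<lambda>s. e2ennreal (- u (?A y + (c * r) *\<^sub>R s))"]
    by simp
  have cont: "continuous_on UNIV ?A"
    by (intro continuous_intros linear_continuous_on linear_conv_bounded_linear[THEN iffD1, OF lin])
  have "open {y. u (?A y) < a}" for a
    using open_vimage[OF _ cont, of "{y. u y < a}"] u by (simp add: subharmonic_def vimage_def)
  moreover have "\<exists>y. u (?A y) \<noteq> - \<infinity>"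
  proof -
    obtain z where "u z \<noteq> - \<infinity>" using u by (auto simp: subharmonic_def)
    moreover obtain y where "g y = (z - x) /\<^sub>R c"
      using orthogonal_transformation_surj[OF g] by (metis surjD)
    ultimately show ?thesis using \<open>0 < c\<close> by (intro exI[of _ y]) simp
  qed
  ultimately show ?thesis
    using u \<open>0 < c\<close> unfolding subharmonic_def mean by auto
qed

lemma subharmonic_scale:
  fixes u :: "'a::euclidean_space \<Rightarrow> ereal"
  assumes u: "subharmonic u" and c: "0 < c"
  shows "subharmonic (\<lambda>x. ereal c * u x)"
proof (rule subharmonicI)
  note [measurable] = subharmonic_measurable[OF u]
  have nt: "u x \<noteq> \<infinity>" for x using u by (simp add: subharmonic_def)
  show "ereal c * u x \<noteq> \<infinity>" for x using nt[of x] c by (cases "u x") auto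
  obtain x0 where "u x0 \<noteq> - \<infinity>" using u by (auto simp: subharmonic_def)
  then show "\<exists>x. ereal c * u x \<noteq> - \<infinity>" using c by (intro exI[of _ x0]) (cases "u x0"; auto)
  show "open {x. ereal c * u x < a}" for a
  proof -
    have "ereal c * u x < a \<longleftrightarrow> u x < a / ereal c" for x
      using c by (simp add: ereal_less_divide_pos)
    then show ?thesis using u by (simp add: subharmonic_def)
  qed
  fix x :: 'a and r :: real assume r: "0 < r"
  obtain B where B: "0 \<le> B" and le: "\<And>y. y \<in> cball x r \<Longrightarrow> u y \<le> ereal B"
    using subharmonic_bounded_above_compact[OF u compact_cball] by blast
  define C where "C = c * B"
  have "ereal c * u y \<le> ereal C" if "y \<in> cball x r" for y
    using le[OF that] c by (cases "u y") (auto simp: C_def)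
  moreover have eq: "e2ennreal (ereal C - ereal c * u y) = ennreal c * e2ennreal (ereal B - u y)" for y
    using c nt[of y]
    by (cases "u y") (auto simp: C_def ennreal_mult'[symmetric] right_diff_distrib ennreal_mult_top)
  moreover have "(\<integral>\<^sup>+s. e2ennreal (ereal C - ereal c * u (x + r *\<^sub>R s)) \<partial>sphere_measure)
      \<le> e2ennreal (ereal C - ereal c * u x)"
    unfolding eq using subharmonic_supermean[OF u B less_imp_le[OF r] le]
    by (simp add: nn_integral_cmult mult_left_mono)
  ultimately show "\<exists>C\<ge>0. (\<forall>y\<in>cball x r. ereal c * u y \<le> ereal C) \<and>
      (\<integral>\<^sup>+s. e2ennreal (ereal C - ereal c * u (x + r *\<^sub>R s)) \<partial>sphere_measure)
      \<le> e2ennreal (ereal C - ereal c * u x)"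
    using B c by (intro exI[of _ C]) (auto simp: C_def)
qed

text \<open>With n the dimension, the R-derivative of R^(-n) bump(y/R) is -R^(-n-1) times the
  divergence of w bump(w) at w = y/R. The choice of \<open>bump\<close> makes that divergence equal
  to minus \<open>potential_laplacian\<close>.\<close>

lemma DERIV_kernel_radius:
  fixes y :: "'a::euclidean_space"
  assumes "0 < R"
  shows "((\<lambda>R. bump_kernel R y) has_real_derivative
    potential_laplacian (y /\<^sub>R R) / (bump_mass TYPE('a) * R ^ (DIM('a) + 1))) (at R)"
proof -
  let ?n = "DIM('a)"
  have m: "bump_mass TYPE('a) \<noteq> 0" using bump_mass_pos[where 'a='a] by simp
  have 1: "((\<lambda>R. bump (y /\<^sub>R R)) has_real_derivative
      (- (((1 / R) *\<^sub>R y) \<bullet> y) * (flat' 2 (1 - (norm (y /\<^sub>R R))\<^sup>2) / 2)) * (- (1 / R\<^sup>2))) (at R)"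
    using DERIV_chain2[OF DERIV_bump_line[of 0 y "inverse R"] DERIV_inverse[of R]] assms
    by (simp add: power2_eq_square inverse_eq_divide)
  have 2: "((\<lambda>R. bump_mass TYPE('a) * R ^ ?n) has_real_derivative bump_mass TYPE('a) * (real ?n * R ^ (?n - 1))) (at R)"
    by (auto intro!: derivative_eq_intros)
  obtain k where k: "?n = Suc k" using DIM_positive[where 'a='a] by (metis gr0_implies_Suc)
  have "(norm (y /\<^sub>R R))\<^sup>2 = (y \<bullet> y) / R\<^sup>2" using assms
    by (simp add: power_mult_distrib power2_norm_eq_inner divide_inverse power_inverse mult.commute)
  then show ?thesis
    unfolding bump_kernel_def
    by (intro DERIV_cong[OF DERIV_divide[OF 1 2]])
       (use assms m in \<open>auto simp: potential_laplacian_def k divide_simps power2_eq_square\<close>,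
        simp add: algebra_simps)
qed

text \<open>Differentiation under the integral sign. After the substitution y = R w the R-derivative
  is a positive multiple of the pairing of the subharmonic function u(x + R w) of w with
  \<open>potential_laplacian\<close>.\<close>

lemma subharmonic_mollify_mono:
  fixes u :: "'a::euclidean_space \<Rightarrow> ereal"
  assumes u: "subharmonic u" and R: "0 < R1" "R1 \<le> R2"
  shows "mollify R1 (real_fun u) x \<le> mollify R2 (real_fun u) x"
proof (rule DERIV_nonneg_imp_nondecreasing[OF \<open>R1 \<le> R2\<close>])
  fix R assume "R1 \<le> R" "R \<le> R2"
  then have R: "0 < R" using \<open>0 < R1\<close> by simp
  let ?f = "\<lambda>y. real_of_ereal (u (x + y))"
  let ?c = "\<lambda>R. bump_mass TYPE('a) * R ^ (DIM('a) + 1)"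
  let ?K = "\<lambda>R y::'a. potential_laplacian (y /\<^sub>R R) / ?c R"
  have c: "0 < ?c R" if "0 < R" for R using bump_mass_pos[where 'a='a] that by simp
  have "subharmonic (\<lambda>y. u (x + 1 *\<^sub>R y))"
    by (rule subharmonic_similarity[OF u]) auto
  then have sf: "subharmonic (\<lambda>y. u (x + y))" by simp
  have f: "locally_integrable ?f" by (rule subharmonic_locally_integrable[OF sf])
  let ?D = "\<integral>y. ?f y * ?K R y \<partial>lborel"
  have contK: "continuous_on S (\<lambda>(R, y). ?K R y)" if "S \<subseteq> {0<..} \<times> UNIV" for S
    unfolding case_prod_beta' using that bump_mass_pos[where 'a='a] by (intro continuous_intros) auto
  have suppK: "?K r y = 0" if "0 < r" "r \<le> 2 * R" "y \<notin> ball 0 (2 * R)" for r y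
    using that by (simp add: potential_laplacian_eq_0 field_simps)
  have suppk: "bump_kernel r y = 0" if "0 < r" "r \<le> 2 * R" "y \<notin> ball 0 (2 * R)" for r and y :: 'a
    using that by (intro kernel_eq_0) auto
  have intK: "integrable lborel (\<lambda>y. ?f y * ?K R y)"
  proof (rule integrable_locally_integrable_times[OF f, where N="2 * R"])
    show "continuous_on UNIV (?K R)" using c[OF R] by (intro continuous_intros) auto
  qed (use suppK R in auto)
  have intk: "integrable lborel (\<lambda>y. ?f y * bump_kernel r y)" if "0 < r" for r
    using integrable_mollify(2)[OF subharmonic_locally_integrable[OF u] that] .
  let ?B = "ball_norm (2 * R) ?f"
  have B: "0 \<le> ?B" by (rule ball_norm_nonneg)
  \<comment> \<open>The difference quotients of the kernel converge to \<open>?K R\<close> uniformly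
    in y, with supports in one ball, so the L^1 norm of \<open>?f\<close> there controls the
    error.\<close>
  have est: "\<exists>d>0. \<forall>h. h \<noteq> 0 \<and> \<bar>h\<bar> < d \<longrightarrow>
      \<bar>(mollify (R + h) (real_fun u) x - mollify R (real_fun u) x) / h - ?D\<bar> \<le> \<eta> * ?B"
    if \<eta>: "0 < \<eta>" for \<eta>
  proof -
    \<comment> \<open>Radii are confined to [R/2, 2R], away from the singularity at radius
      0.\<close>
    have "uniformly_continuous_on ({R / 2..2 * R} \<times> cball 0 (2 * R)) (\<lambda>(R, y). ?K R y)"
      using R by (intro compact_uniformly_continuous compact_Times contK) auto
    then obtain d where d: "0 < d" and du': "\<And>p p'. p \<in> {R / 2..2 * R} \<times> cball 0 (2 * R) \<Longrightarrow>
        p' \<in> {R / 2..2 * R} \<times> cball 0 (2 * R) \<Longrightarrow> dist p' p < d \<Longrightarrow>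
        dist (case p' of (R, y) \<Rightarrow> ?K R y) (case p of (R, y) \<Rightarrow> ?K R y) < \<eta>"
      using \<eta> unfolding uniformly_continuous_on_def by meson
    have du: "dist (?K r y) (?K R y) < \<eta>"
      if "r \<in> {R / 2..2 * R}" "y \<in> cball 0 (2 * R)" "dist (r, y) (R, y) < d" for r y
      using du'[of "(R, y)" "(r, y)"] that R by simp
    have K: "\<bar>?K r y - ?K R y\<bar> \<le> \<eta>" if "\<bar>r - R\<bar> < min d (R / 2)" for r y
    proof (cases "y \<in> ball 0 (2 * R)")
      case True
      have "R / 2 \<le> r" "r \<le> 2 * R" using that R by (auto simp: abs_if split: if_splits)
      then have "dist (?K r y) (?K R y) < \<eta>"
        using that True by (intro du) (auto simp: dist_prod_def dist_real_def)
      then show ?thesis by (simp add: dist_real_def)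
    next
      case False
      have "0 < r" "r \<le> 2 * R" using that R by (auto simp: abs_if split: if_splits)
      then have z: "?K r y = 0" "?K R y = 0" using R by (intro suppK False; simp)+
      show ?thesis unfolding z using \<eta> by simp
    qed
    have diff: "\<bar>(bump_kernel (R + h) y - bump_kernel R y) / h - ?K R y\<bar> \<le> \<eta>"
      if h: "h \<noteq> 0" "\<bar>h\<bar> < min d (R / 2)" for h y
    proof -
      have der: "((\<lambda>r. bump_kernel r y) has_real_derivative ?K r y) (at r)" if "\<bar>r - R\<bar> \<le> \<bar>h\<bar>" for r
        using that h R by (intro DERIV_kernel_radius) (auto simp: abs_if split: if_splits)
      have "\<exists>r. \<bar>r - R\<bar> \<le> \<bar>h\<bar> \<and> bump_kernel (R + h) y - bump_kernel R y = h * ?K r y"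
      proof (cases "0 < h")
        case True
        then have "\<exists>z>R. z < R + h \<and> bump_kernel (R + h) y - bump_kernel R y = (R + h - R) * ?K z y"
          by (intro MVT2 der) auto
        then obtain z where "z > R" "z < R + h" "bump_kernel (R + h) y - bump_kernel R y = h * ?K z y" by auto
        then show ?thesis using True by (intro exI[of _ z]) auto
      next
        case False
        then have "\<exists>z>R+h. z < R \<and> bump_kernel R y - bump_kernel (R + h) y = (R - (R + h)) * ?K z y"
          using h by (intro MVT2 der) auto
        then obtain z where "z > R + h" "z < R" "bump_kernel R y - bump_kernel (R + h) y = - h * ?K z y" by auto
        then show ?thesis using False by (intro exI[of _ z]) (auto simp: abs_if)
      qed
      then obtain r where "\<bar>r - R\<bar> \<le> \<bar>h\<bar>" "bump_kernel (R + h) y - bump_kernel R y = h * ?K r y" by blast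
      then show ?thesis using K[of r y] h by simp
    qed
    show ?thesis
    proof (intro exI[of _ "min d (R / 2)"] conjI allI impI)
      show "0 < min d (R / 2)" using d R by simp
      fix h assume h: "h \<noteq> 0 \<and> \<bar>h\<bar> < min d (R / 2)"
      then have Rh: "0 < R + h" "R + h \<le> 2 * R" using R by (auto simp: abs_if split: if_splits)
      let ?e = "\<lambda>y. (bump_kernel (R + h) y - bump_kernel R y) / h - ?K R y"
      have [measurable]: "?K R \<in> borel_measurable borel"
        using c[OF R] by (intro borel_measurable_continuous_onI continuous_intros) auto
      have "\<bar>\<integral>y. ?f y * ?e y \<partial>lborel\<bar> \<le> \<eta> * ?B"
      proof (rule integrable_locally_integrable_mult(2)[OF f])
        show "\<bar>?e y\<bar> \<le> \<eta>" for y using diff h by blast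
        show "?e y = 0" if "y \<notin> ball 0 (2 * R)" for y
          using suppk[OF Rh that] suppk[OF R _ that] suppK[OF R _ that] R by simp
      qed measurable
      moreover have "(\<integral>y. ?f y * ?e y \<partial>lborel) =
          (mollify (R + h) (real_fun u) x - mollify R (real_fun u) x) / h - ?D"
      proof -
        have "(\<lambda>y. ?f y * ?e y) =
            (\<lambda>y. (?f y * bump_kernel (R + h) y - ?f y * bump_kernel R y) / h - ?f y * ?K R y)"
          by (simp add: fun_eq_iff algebra_simps diff_divide_distrib)
        then show ?thesis
          using intk[OF R] intk[OF Rh(1)] intK subharmonic_measurable[OF u]
          by (simp add: mollify_shift borel_measurable_real_of_ereal)
      qed
      ultimately show "\<bar>(mollify (R + h) (real_fun u) x - mollify R (real_fun u) x) / h - ?D\<bar> \<le> \<eta> * ?B"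
        by simp
    qed
  qed
  have "((\<lambda>r. mollify r (real_fun u) x) has_real_derivative ?D) (at R)"
    unfolding DERIV_def LIM_eq
  proof (intro allI impI)
    fix e :: real assume "0 < e"
    then have "0 < e / (?B + 1)" using B by simp
    from est[OF this] obtain d where "0 < d" and d: "\<And>h. h \<noteq> 0 \<Longrightarrow> \<bar>h\<bar> < d \<Longrightarrow>
        \<bar>(mollify (R + h) (real_fun u) x - mollify R (real_fun u) x) / h - ?D\<bar> \<le> e / (?B + 1) * ?B"
      by blast
    have "e / (?B + 1) * ?B < e" using B \<open>0 < e\<close> by (simp add: field_simps)
    then show "\<exists>s>0. \<forall>h. h \<noteq> 0 \<and> norm (h - 0) < s \<longrightarrow>
        norm ((mollify (R + h) (real_fun u) x - mollify R (real_fun u) x) / h - ?D) < e"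
      using \<open>0 < d\<close> d by (intro exI[of _ d]) (auto intro: le_less_trans)
  qed
  moreover have "0 \<le> ?D"
  proof -
    let ?v = "\<lambda>y. u (x + R *\<^sub>R y)"
    have "subharmonic ?v" by (rule subharmonic_similarity[OF u]) (use R in auto)
    then have *: "0 \<le> (\<integral>y. real_of_ereal (u (x + R *\<^sub>R y)) * potential_laplacian y \<partial>lborel)"
      by (rule subharmonic_laplacian_nonneg)
    note [measurable] = locally_integrable_measurable[OF f]
    have [measurable]: "?K R \<in> borel_measurable borel"
      using c[OF R] by (intro borel_measurable_continuous_onI continuous_intros) auto
    have "?D = R ^ DIM('a) * (\<integral>y. ?f (0 + R *\<^sub>R y) * ?K R (0 + R *\<^sub>R y) \<partial>lborel)"
      using integral_lborel_affine(2)[of "\<lambda>y. ?f y * ?K R y" R 0] R by simp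
    also have "\<dots> = R ^ DIM('a) * ((\<integral>y. real_of_ereal (u (x + R *\<^sub>R y)) * potential_laplacian y \<partial>lborel) / ?c R)"
      using R by simp
    finally have D: "?D = \<dots>" .
    show ?thesis
      unfolding D using * R c[OF R] by (intro mult_nonneg_nonneg divide_nonneg_pos) auto
  qed
  ultimately show "\<exists>y. ((\<lambda>r. mollify r (real_fun u) x) has_real_derivative y) (at R) \<and> 0 \<le> y" by blast
qed

subsection \<open>Compactness of families of subharmonic functions\<close>

text \<open>A mollification is an average of translates of u, each of which satisfies the supermean
  inequality; Tonelli exchanges the two averages. The ball of radius r + R covers all the translates
  at once.\<close>

lemma mollify_supermean:
  fixes u :: "'a::euclidean_space \<Rightarrow> ereal"
  assumes u: "subharmonic u" and R: "0 < R" and r: "0 \<le> r" and M: "0 \<le> M"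
    and le: "\<And>y. y \<in> cball x (r + R) \<Longrightarrow> u y \<le> ereal M"
  shows "(\<integral>\<^sup>+s. ennreal (M - mollify R (real_fun u) (x + r *\<^sub>R s)) \<partial>sphere_measure)
    \<le> ennreal (M - mollify R (real_fun u) x)"
proof -
  note [measurable] = subharmonic_measurable[OF u]
  interpret pair_sigma_finite "lborel :: 'a measure" "sphere_measure :: 'a measure" ..
  have near: "u (z + y) \<le> ereal M" if "norm (z - x) \<le> r" "norm y \<le> R" for z y
  proof (rule le)
    have "norm (x - (z + y)) \<le> norm (z - x) + norm y"
      using norm_triangle_ineq4[of "x - z" y] by (simp add: norm_minus_commute algebra_simps)
    then show "z + y \<in> cball x (r + R)" using that by (simp add: dist_norm)
  qed
  have K: "ennreal (M - mollify R (real_fun u) z) =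
      (\<integral>\<^sup>+y. ennreal (bump_kernel R y) * e2ennreal (ereal M - u (z + y)) \<partial>lborel)"
    if "norm (z - x) \<le> r" for z
  proof (rule subharmonic_nn_integral_kernel[OF u R, symmetric])
    show "u y \<le> ereal M" if "y \<in> cball z R" for y
      using near[OF \<open>norm (z - x) \<le> r\<close>, of "y - z"] that by (simp add: dist_norm norm_minus_commute)
  qed
  have "(\<integral>\<^sup>+s. ennreal (M - mollify R (real_fun u) (x + r *\<^sub>R s)) \<partial>sphere_measure) =
     (\<integral>\<^sup>+s. (\<integral>\<^sup>+y. ennreal (bump_kernel R y) * e2ennreal (ereal M - u (x + r *\<^sub>R s + y)) \<partial>lborel) \<partial>sphere_measure)"
  proof (rule nn_integral_cong_AE, use AE_sphere_measure_norm_le in eventually_elim)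
    case (elim s)
    then show ?case using r mult_left_mono[of "norm s" 1 r] by (intro K) simp
  qed
  also have "\<dots> = (\<integral>\<^sup>+y. (\<integral>\<^sup>+s. ennreal (bump_kernel R y) * e2ennreal (ereal M - u (x + r *\<^sub>R s + y)) \<partial>sphere_measure) \<partial>lborel)"
    by (rule Fubini') measurable
  also have "\<dots> \<le> (\<integral>\<^sup>+y. ennreal (bump_kernel R y) * e2ennreal (ereal M - u (x + y)) \<partial>lborel)"
  proof (rule nn_integral_mono)
    fix y :: 'a
    show "(\<integral>\<^sup>+s. ennreal (bump_kernel R y) * e2ennreal (ereal M - u (x + r *\<^sub>R s + y)) \<partial>sphere_measure)
        \<le> ennreal (bump_kernel R y) * e2ennreal (ereal M - u (x + y))"
    proof (cases "norm y \<le> R")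
      case True
      have "(\<integral>\<^sup>+s. e2ennreal (ereal M - u ((x + y) + r *\<^sub>R s)) \<partial>sphere_measure) \<le> e2ennreal (ereal M - u (x + y))"
      proof (rule subharmonic_supermean[OF u M r])
        show "u z \<le> ereal M" if "z \<in> cball (x + y) r" for z
          using near[of "z - y" y] that True by (simp add: dist_norm norm_minus_commute algebra_simps)
      qed
      moreover have "x + r *\<^sub>R s + y = (x + y) + r *\<^sub>R s" for s by simp
      ultimately show ?thesis by (simp only:) (simp add: nn_integral_cmult mult_left_mono)
    next
      case False
      then show ?thesis using kernel_eq_0[OF R, of y] by simp
    qed
  qed
  also have "\<dots> = ennreal (M - mollify R (real_fun u) x)"
    using r by (intro K[symmetric]) simp
  finally show ?thesis .
qed

lemma mollify_abs_le:
  fixes f :: "'a::euclidean_space \<Rightarrow> real"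
  assumes "locally_integrable f" "0 < R" "norm x + R \<le> N"
  shows "\<bar>mollify R f x\<bar> \<le> kernel_bound R TYPE('a) * ball_norm N f"
  unfolding mollify_def
  using assms abs_kernel_le[OF assms(2)] kernel_shift_support[OF assms(2,3)]
  by (intro integrable_locally_integrable_mult(2)) auto

lemma mollify_uniform_approx:
  fixes \<phi> :: "'a::euclidean_space \<Rightarrow> real"
  assumes \<phi>: "continuous_on UNIV \<phi>" "\<And>x. x \<notin> ball 0 N \<Longrightarrow> \<phi> x = 0" and \<eta>: "0 < \<eta>"
  obtains d where "0 < d" "\<And>R x. 0 < R \<Longrightarrow> R < d \<Longrightarrow> \<bar>mollify R \<phi> x - \<phi> x\<bar> \<le> \<eta>"
proof -
  have "uniformly_continuous_on (cball 0 (\<bar>N\<bar> + 2)) \<phi>"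
    using \<phi>(1) by (intro compact_uniformly_continuous) (auto intro: continuous_on_subset)
  then obtain d where "0 < d" and d: "\<And>x y. x \<in> cball 0 (\<bar>N\<bar> + 2) \<Longrightarrow> y \<in> cball 0 (\<bar>N\<bar> + 2) \<Longrightarrow>
      dist y x < d \<Longrightarrow> dist (\<phi> y) (\<phi> x) < \<eta>"
    using \<eta> unfolding uniformly_continuous_on_def by meson
  have near: "\<bar>\<phi> (x + y) - \<phi> x\<bar> \<le> \<eta>" if "norm y < min d 1" for x y
  proof (cases "x \<in> cball 0 (\<bar>N\<bar> + 1)")
    case True
    then have "x + y \<in> cball 0 (\<bar>N\<bar> + 2)" "x \<in> cball 0 (\<bar>N\<bar> + 2)"
      using that norm_triangle_ineq[of x y] by auto
    then have "dist (\<phi> (x + y)) (\<phi> x) < \<eta>" using that by (intro d) (auto simp: dist_norm)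
    then show ?thesis by (simp add: dist_real_def)
  next
    case False
    then have "x + y \<notin> ball 0 N" "x \<notin> ball 0 N"
      using that norm_diff_ineq[of x y] by auto
    then show ?thesis using \<phi>(2) \<eta> by simp
  qed
  show thesis
  proof (rule that[of "min d 1"])
    fix R x assume R: "0 < R" "R < min d 1"
    let ?k = "bump_kernel R :: 'a \<Rightarrow> real"
    have li: "locally_integrable \<phi>" using \<phi>(1) by (rule locally_integrable_continuous)
    have i: "integrable lborel (\<lambda>y. \<phi> (x + y) * ?k y)" by (rule integrable_mollify(2)[OF li R(1)])
    have ik: "integrable lborel ?k" "(\<integral>y. ?k y \<partial>lborel) = 1" using integral_kernel[OF R(1)] by auto
    have "\<bar>\<integral>y. \<phi> (x + y) * ?k y - \<phi> x * ?k y \<partial>lborel\<bar> \<le> (\<integral>y. \<eta> * ?k y \<partial>lborel)"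
    proof (rule order_trans[OF integral_abs_bound integral_mono])
      show "\<bar>\<phi> (x + y) * ?k y - \<phi> x * ?k y\<bar> \<le> \<eta> * ?k y" for y
      proof (cases "norm y < min d 1")
        case True
        then show ?thesis
          using mult_right_mono[OF near[OF True, of x] kernel_nonneg[OF R(1), of y]] kernel_nonneg[OF R(1), of y]
          by (simp add: abs_mult flip: left_diff_distrib)
      next
        case False
        then show ?thesis using R kernel_eq_0[OF R(1), of y] by auto
      qed
    qed (use i ik in auto)
    moreover have "(\<integral>y. \<phi> (x + y) * ?k y - \<phi> x * ?k y \<partial>lborel) = mollify R \<phi> x - \<phi> x"
      using i ik \<phi>(1) by (simp add: mollify_shift borel_measurable_continuous_onI)
    ultimately show "\<bar>mollify R \<phi> x - \<phi> x\<bar> \<le> \<eta>" using ik by simp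
  qed (use \<open>0 < d\<close> in simp)
qed

lemma ennreal_liminf_eq:
  fixes X :: "nat \<Rightarrow> ennreal"
  shows "X \<longlonglongrightarrow> L \<Longrightarrow> liminf X = L"
  by (rule lim_imp_Liminf) auto

text \<open>By equicontinuity the values at x stay close to those at a nearby point of D uniformly
  in k, so the Cauchy property passes from D to x.\<close>

lemma mollify_convergent_dense:
  fixes f :: "nat \<Rightarrow> 'a::euclidean_space \<Rightarrow> real"
  assumes f: "\<And>k. locally_integrable (f k)" and C: "\<And>k. ball_norm (norm x + R + 1) (f k) \<le> C"
    and R: "0 < R" and dense: "closure D = UNIV" and conv: "\<And>y. y \<in> D \<Longrightarrow> convergent (\<lambda>k. mollify R (f k) y)"
  shows "convergent (\<lambda>k. mollify R (f k) x)"
proof (rule Cauchy_convergent, rule metric_CauchyI)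
  fix e :: real assume "0 < e"
  have C0: "0 \<le> C" using C[of 0] ball_norm_nonneg[of "norm x + R + 1" "f 0"] by simp
  \<comment> \<open>Each transfer between x and y costs at most e/4; with e/4 for the Cauchy
    estimate at y the sum stays below e.\<close>
  define e' where "e' = e / (4 * (C + 1))"
  have e': "0 < e'" "e' * C \<le> e / 4" using \<open>0 < e\<close> C0 by (auto simp: e'_def field_simps)
  obtain d where "0 < d" and d: "\<And>g x'. locally_integrable g \<Longrightarrow> norm (x' - x) < d \<Longrightarrow>
      \<bar>mollify R g x' - mollify R g x\<bar> \<le> e' * ball_norm (norm x + R + 1) g"
    using mollify_equicontinuous[OF R e'(1), of x] by metis
  obtain y where y: "y \<in> D" "dist y x < d"
    using dense \<open>0 < d\<close> by (metis UNIV_I closure_approachable)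
  have near: "\<bar>mollify R (f k) y - mollify R (f k) x\<bar> \<le> e / 4" for k
    using d[OF f, of y k] y order_trans[OF mult_left_mono[OF C[of k] less_imp_le[OF e'(1)]] e'(2)]
      by (simp add: dist_norm)
  have "Cauchy (\<lambda>k. mollify R (f k) y)" using conv[OF y(1)] by (rule convergent_Cauchy)
  then obtain M where M: "\<And>m n. m \<ge> M \<Longrightarrow> n \<ge> M \<Longrightarrow> dist (mollify R (f m) y) (mollify R (f n) y) < e / 4"
    using \<open>0 < e\<close> unfolding Cauchy_def by (metis zero_less_divide_iff zero_less_numeral)
  have "dist (mollify R (f m) x) (mollify R (f n) x) < e" if "m \<ge> M" "n \<ge> M" for m n
    using M[OF that] near[of m] near[of n] \<open>0 < e\<close> unfolding dist_real_def by linarith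
  then show "\<exists>M. \<forall>m\<ge>M. \<forall>n\<ge>M. dist (mollify R (f m) x) (mollify R (f n) x) < e" by blast
qed

lemma mollify_limit_continuous:
  fixes f :: "nat \<Rightarrow> 'a::euclidean_space \<Rightarrow> real"
  assumes f: "\<And>k. locally_integrable (f k)" and C: "\<And>N. \<exists>C. \<forall>k. ball_norm N (f k) \<le> C"
    and R: "0 < R" and lim: "\<And>x. (\<lambda>k. mollify R (f k) x) \<longlonglongrightarrow> F x"
  shows "continuous_on UNIV F"
  unfolding continuous_on_iff
proof (intro ballI allI impI)
  fix x :: 'a and e :: real assume "0 < e"
  obtain C where C: "\<And>k. ball_norm (norm x + R + 1) (f k) \<le> C" using C by blast
  have C0: "0 \<le> C" using C[of 0] ball_norm_nonneg[of "norm x + R + 1" "f 0"] by simp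
  define e' where "e' = e / (4 * (C + 1))"
  have e': "0 < e'" "e' * C \<le> e / 4" using \<open>0 < e\<close> C0 by (auto simp: e'_def field_simps)
  obtain d where "0 < d" and d: "\<And>g x'. locally_integrable g \<Longrightarrow> norm (x' - x) < d \<Longrightarrow>
      \<bar>mollify R g x' - mollify R g x\<bar> \<le> e' * ball_norm (norm x + R + 1) g"
    using mollify_equicontinuous[OF R e'(1), of x] by metis
  have "\<bar>F y - F x\<bar> \<le> e / 4" if "dist y x < d" for y
  proof (rule LIMSEQ_le_const2)
    show "(\<lambda>k. \<bar>mollify R (f k) y - mollify R (f k) x\<bar>) \<longlonglongrightarrow> \<bar>F y - F x\<bar>"
      by (intro tendsto_intros lim)
    have "\<bar>mollify R (f k) y - mollify R (f k) x\<bar> \<le> e / 4" for k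
      using d[OF f, of y k] that order_trans[OF mult_left_mono[OF C[of k] less_imp_le[OF e'(1)]] e'(2)]
      by (simp add: dist_norm)
    then show "\<exists>N. \<forall>k\<ge>N. \<bar>mollify R (f k) y - mollify R (f k) x\<bar> \<le> e / 4" by blast
  qed
  then have "dist (F y) (F x) < e" if "dist y x < d" for y
    using that \<open>0 < e\<close> by (fastforce simp: dist_real_def)
  then show "\<exists>d>0. \<forall>y\<in>UNIV. dist y x < d \<longrightarrow> dist (F y) (F x) < e" using \<open>0 < d\<close> by blast
qed

text \<open>No subsequence is extracted: convergence of the means on D is assumed, and then the
  whole sequence converges weakly. Inequalities pass to the limit by Fatou's lemma for M - f, with
  an upper bound M common to all k on a ball. Weak convergence gets a separate argument, since the
  limits F_j are not yet known to be mollifications of w.\<close>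

theorem subharmonic_compactness:
  fixes v :: "nat \<Rightarrow> 'a::euclidean_space \<Rightarrow> ereal"
  assumes v: "\<And>k. subharmonic (v k)"
    and above: "\<And>N. \<exists>C. \<forall>k. \<forall>x\<in>cball 0 N. v k x \<le> ereal C"
    and norm: "\<And>N. \<exists>C. \<forall>k. ball_norm N (real_fun (v k)) \<le> C"
    and dense: "closure D = UNIV"
    and conv: "\<And>j x. x \<in> D \<Longrightarrow> convergent (\<lambda>k. mollify (1 / real (Suc j)) (real_fun (v k)) x)"
  obtains w where "subharmonic w"
    "\<And>\<phi> N. continuous_on UNIV \<phi> \<Longrightarrow> (\<And>x. x \<notin> ball 0 N \<Longrightarrow> \<phi> x = 0) \<Longrightarrow>
      (\<lambda>k. \<integral>x. real_fun (v k) x * \<phi> x \<partial>lborel) \<longlonglongrightarrow> (\<integral>x. real_fun w x * \<phi> x \<partial>lborel)"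
proof -
  define r where "r j = 1 / real (Suc j)" for j
  have r: "0 < r j" "r j \<le> 1" "r (Suc j) \<le> r j" for j by (auto simp: r_def field_simps)
  have li: "locally_integrable (real_fun (v k))" for k by (rule subharmonic_locally_integrable[OF v])
  define f where "f k j = mollify (r j) (real_fun (v k))" for k j
  have conv_all: "convergent (\<lambda>k. f k j x)" for j x
  proof -
    obtain C where "\<And>k. ball_norm (norm x + r j + 1) (real_fun (v k)) \<le> C" using norm by blast
    from mollify_convergent_dense[OF li this r(1) dense] conv show ?thesis by (simp add: f_def r_def)
  qed
  define F where "F j x = lim (\<lambda>k. f k j x)" for j x
  have lim: "(\<lambda>k. f k j x) \<longlonglongrightarrow> F j x" for j x
    using conv_all[of j x] by (simp add: F_def convergent_LIMSEQ_iff)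
  have contf: "continuous_on UNIV (f k j)" for k j
    unfolding f_def by (rule continuous_on_mollify[OF li r(1)])
  have contF: "continuous_on UNIV (F j)" for j
    by (rule mollify_limit_continuous[OF li norm r(1)]) (use lim in \<open>simp add: f_def\<close>)
  note [measurable] = borel_measurable_continuous_onI[OF contf] borel_measurable_continuous_onI[OF contF]
  have F_Suc: "F (Suc j) x \<le> F j x" for j x
    by (rule LIMSEQ_le[OF lim lim])
       (auto simp: f_def intro!: exI[of _ 0] subharmonic_mollify_mono[OF v] r)
  have F_decr: "decseq (\<lambda>j. ereal (F j x))" for x
    by (rule decseq_SucI) (simp add: F_Suc)
  define w where "w x = (INF j. ereal (F j x))" for x
  have Fw: "(\<lambda>j. ereal (F j x)) \<longlonglongrightarrow> w x" for x
    unfolding w_def by (rule LIMSEQ_INF[OF F_decr])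
  have w_le: "w x \<le> ereal (F j x)" for x j unfolding w_def by (rule INF_lower) simp
  have usc: "open {x. w x < a}" for a
  proof -
    have "{x. w x < a} = (\<Union>j. {x. ereal (F j x) < a})" by (auto simp: w_def INF_less_iff)
    moreover have "open {x. ereal (F j x) < a}" for j
    proof (cases a)
      case (real b)
      then show ?thesis using contF[of j] by (simp add: open_Collect_less continuous_on_const)
    qed auto
    ultimately show ?thesis by auto
  qed
  have wm[measurable]: "w \<in> borel_measurable borel" by (rule usc_measurable[OF usc])
  \<comment> \<open>Distances below an upper bound are measured in \<open>ennreal\<close>, so the
    limit makes sense also where w = -\<infinity>.\<close>
  have e2lim: "(\<lambda>j. ennreal (M - F j x)) \<longlonglongrightarrow> e2ennreal (ereal M - w x)" for M x
  proof -
    have "(\<lambda>j. ereal M - ereal (F j x)) \<longlonglongrightarrow> ereal M - w x"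
      by (rule tendsto_diff_ereal_general[OF tendsto_const Fw]) simp
    then have "(\<lambda>j. e2ennreal (ereal M - ereal (F j x))) \<longlonglongrightarrow> e2ennreal (ereal M - w x)"
      by (rule tendsto_e2ennrealI)
    then show ?thesis by simp
  qed
  have bound: "\<exists>M\<ge>0. (\<forall>k. \<forall>y\<in>cball 0 (N + 1). v k y \<le> ereal M) \<and>
      (\<forall>j k. \<forall>x\<in>cball 0 N. f k j x \<le> M) \<and> (\<forall>j. \<forall>x\<in>cball 0 N. F j x \<le> M \<and> w x \<le> ereal M)" for N
  proof -
    obtain C where C: "\<And>k y. y \<in> cball 0 (N + 1) \<Longrightarrow> v k y \<le> ereal C" using above by blast
    have C': "v k y \<le> ereal (max C 0)" if "y \<in> cball 0 (N + 1)" for k y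
      using C[OF that, of k] by (rule order_trans) simp
    have f_le: "f k j x \<le> max C 0" if "x \<in> cball 0 N" for j k x
      unfolding f_def
    proof (rule subharmonic_mollify_le[OF v r(1)])
      show "v k y \<le> ereal (max C 0)" if "y \<in> cball x (r j)" for y
        using that \<open>x \<in> cball 0 N\<close> r(2)[of j] norm_triangle_ineq2[of y x]
        by (intro C') (simp add: dist_norm norm_minus_commute)
    qed
    have F_le: "F j x \<le> max C 0" if "x \<in> cball 0 N" for j x
      by (rule LIMSEQ_le_const2[OF lim]) (use f_le[OF that] in blast)
    have "w x \<le> ereal (max C 0)" if "x \<in> cball 0 N" for x
      using F_le[OF that, of 0] w_le[of x 0] by (meson ereal_less_eq(3) order_trans)
    with C' f_le F_le show ?thesis by (intro exI[of _ "max C 0"]) auto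
  qed
  have "subharmonic w"
  proof (rule subharmonicI)
    show "w x \<noteq> \<infinity>" for x using w_le[of x 0] by auto
    show "open {x. w x < a}" for a by (rule usc)
    show "\<exists>x. w x \<noteq> - \<infinity>"
    proof -
      obtain M where M: "0 \<le> M" "\<And>j k x. x \<in> cball 0 1 \<Longrightarrow> f k j x \<le> M" "\<And>j x. x \<in> cball 0 1 \<Longrightarrow> F j x \<le> M"
        using bound[of 1] by blast
      obtain C where C: "\<And>k. ball_norm 2 (real_fun (v k)) \<le> C" using norm by blast
      let ?m = "bump_mass TYPE('a)"
      \<comment> \<open>Fatou's lemma in k and then in j bounds the integral of bump * (M - w) by B.
        If w were -\<infinity> everywhere, that integral would be infinite.\<close>
      define B where "B = M * ?m + C"
      have bump_supp: "bump x = 0" if "x \<notin> ball 0 1" for x :: 'a using that by (simp add: bump_eq_0)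
      have b1: "continuous_on UNIV (bump :: 'a \<Rightarrow> real)" by (intro continuous_intros)
      have fk: "(\<integral>\<^sup>+x. ennreal (bump x) * ennreal (M - f k j x) \<partial>lborel) \<le> ennreal B" for k j
      proof -
        have i: "integrable lborel (\<lambda>x. f k j x * bump x)"
          by (rule integrable_locally_integrable_times[OF locally_integrable_continuous[OF contf] b1 bump_supp])
        \<comment> \<open>Adjointness moves the mollification onto \<open>bump\<close>. The
          mollified bump is at most 1 and supported in the ball of radius 2, so the L^1 bound on
          that ball serves for all k and j.\<close>
        have eq: "(\<integral>x. f k j x * bump x \<partial>lborel) = (\<integral>x. real_fun (v k) x * mollify (r j) bump x \<partial>lborel)"
          unfolding f_def by (rule mollify_adjoint[OF li b1 bump_supp r(1)])
        have "\<bar>mollify (r j) bump x\<bar> \<le> 1" for x :: 'a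
        proof -
          have lib: "locally_integrable (bump :: 'a \<Rightarrow> real)" using b1 by (rule locally_integrable_continuous)
          have "mollify (r j) bump x \<le> 1"
            by (rule nn_integral_kernel_diff(2)[OF lib r(1)]) (simp add: bump_le_1)
          moreover have "0 \<le> mollify (r j) bump x"
            unfolding mollify_def
            by (intro integral_nonneg_AE AE_I2 mult_nonneg_nonneg bump_nonneg kernel_nonneg r)
          ultimately show ?thesis by simp
        qed
        moreover have "mollify (r j) bump x = 0" if "x \<notin> ball 0 2" for x :: 'a
          by (rule mollify_support[OF bump_supp r(1)]) (use that r(2)[of j] in auto)
        moreover have "mollify (r j) (bump :: 'a \<Rightarrow> real) \<in> borel_measurable borel"
          by (intro borel_measurable_continuous_onI continuous_on_mollify locally_integrable_continuous b1 r)
        ultimately have "\<bar>\<integral>x. real_fun (v k) x * mollify (r j) bump x \<partial>lborel\<bar> \<le> 1 * ball_norm 2 (real_fun (v k))"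
          by (intro integrable_locally_integrable_mult(2)[OF li]) auto
        then have "- C \<le> (\<integral>x. f k j x * bump x \<partial>lborel)" using C[of k] eq by simp
        moreover have "(\<integral>\<^sup>+x. ennreal (bump x) * ennreal (M - f k j x) \<partial>lborel)
            = (\<integral>\<^sup>+x. ennreal (M * bump x - f k j x * bump x) \<partial>lborel)"
          by (intro nn_integral_cong) (simp add: ennreal_mult'[symmetric] bump_nonneg algebra_simps)
        moreover have "\<dots> = ennreal (\<integral>x. M * bump x - f k j x * bump x \<partial>lborel)"
        proof (rule nn_integral_eq_integral)
          show "AE x in lborel. 0 \<le> M * bump x - f k j x * bump x"
          proof (rule AE_I2)
            fix x
            show "0 \<le> M * bump x - f k j x * bump x"
              using M(2)[of x k j] bump_nonneg[of x] bump_supp[of x]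
              by (cases "x \<in> ball 0 1") (auto intro!: mult_right_mono)
          qed
        qed (use i integrable_bump[where 'a='a] in auto)
        ultimately show ?thesis
          using i integrable_bump[where 'a='a]
          by (simp add: B_def) (intro ennreal_leI, simp add: bump_mass_def)
      qed
      have Fj: "(\<integral>\<^sup>+x. ennreal (bump x) * ennreal (M - F j x) \<partial>lborel) \<le> ennreal B" for j
      proof -
        have "(\<integral>\<^sup>+x. ennreal (bump x) * ennreal (M - F j x) \<partial>lborel)
            = (\<integral>\<^sup>+x. liminf (\<lambda>k. ennreal (bump x) * ennreal (M - f k j x)) \<partial>lborel)"
          by (intro nn_integral_cong ennreal_liminf_eq[symmetric] ennreal_tendsto_cmult tendsto_ennrealI tendsto_intros lim) simp
        also have "\<dots> \<le> liminf (\<lambda>k. \<integral>\<^sup>+x. ennreal (bump x) * ennreal (M - f k j x) \<partial>lborel)"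
          by (intro nn_integral_liminf) measurable
        also have "\<dots> \<le> liminf (\<lambda>k. ennreal B)" by (intro Liminf_mono always_eventually allI fk)
        also have "\<dots> = ennreal B" by (intro ennreal_liminf_eq tendsto_const)
        finally show ?thesis .
      qed
      have "(\<integral>\<^sup>+x. ennreal (bump x) * e2ennreal (ereal M - w x) \<partial>lborel)
          = (\<integral>\<^sup>+x. liminf (\<lambda>j. ennreal (bump x) * ennreal (M - F j x)) \<partial>lborel)"
        by (intro nn_integral_cong ennreal_liminf_eq[symmetric] ennreal_tendsto_cmult e2lim) simp
      also have "\<dots> \<le> liminf (\<lambda>j. \<integral>\<^sup>+x. ennreal (bump x) * ennreal (M - F j x) \<partial>lborel)"
        by (intro nn_integral_liminf) measurable
      also have "\<dots> \<le> liminf (\<lambda>j. ennreal B)" by (intro Liminf_mono always_eventually allI Fj)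
      also have "\<dots> = ennreal B" by (intro ennreal_liminf_eq tendsto_const)
      finally have fin: "(\<integral>\<^sup>+x. ennreal (bump x) * e2ennreal (ereal M - w x) \<partial>lborel) < \<infinity>"
        by (rule le_less_trans) simp
      show ?thesis
      proof (rule ccontr)
        assume "\<nexists>x. w x \<noteq> - \<infinity>"
        then have "(\<integral>\<^sup>+x. ennreal (bump (x::'a)) * top \<partial>lborel) < \<infinity>" using fin by simp
        then have "(\<integral>\<^sup>+x. ennreal (bump (x::'a)) \<partial>lborel) = 0"
          by (subst (asm) nn_integral_multc) (auto simp: ennreal_mult_less_top)
        then show False
          using integrable_bump[where 'a='a] bump_mass_pos[where 'a='a]
          by (subst (asm) nn_integral_eq_integral) (auto simp: bump_nonneg bump_mass_def)
      qed
    qed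
    fix x :: 'a and s :: real assume s: "0 < s"
    obtain M where M: "0 \<le> M" "\<And>k y. y \<in> cball 0 (norm x + s + 1) \<Longrightarrow> v k y \<le> ereal M"
      "\<And>y. y \<in> cball 0 (norm x + s) \<Longrightarrow> w y \<le> ereal M"
      using bound[of "norm x + s"] by (metis (no_types, lifting) add.assoc)
    have sub: "y \<in> cball 0 (norm x + t)" if "y \<in> cball x t" for y t
      using that norm_triangle_ineq2[of y x] by (simp add: dist_norm norm_minus_commute)
    have fk: "(\<integral>\<^sup>+z. ennreal (M - f k j (x + s *\<^sub>R z)) \<partial>sphere_measure) \<le> ennreal (M - f k j x)" for k j
      unfolding f_def
    proof (rule mollify_supermean[OF v r(1) less_imp_le[OF s] M(1)])
      fix y assume "y \<in> cball x (s + r j)"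
      then have "y \<in> cball x (s + 1)" using r(2)[of j] by simp
      from sub[OF this] show "v k y \<le> ereal M" by (intro M(2)) (simp add: add.assoc)
    qed
    have Fj: "(\<integral>\<^sup>+z. ennreal (M - F j (x + s *\<^sub>R z)) \<partial>sphere_measure) \<le> ennreal (M - F j x)" for j
    proof -
      have "(\<integral>\<^sup>+z. ennreal (M - F j (x + s *\<^sub>R z)) \<partial>sphere_measure)
          = (\<integral>\<^sup>+z. liminf (\<lambda>k. ennreal (M - f k j (x + s *\<^sub>R z))) \<partial>sphere_measure)"
        by (intro nn_integral_cong ennreal_liminf_eq[symmetric] tendsto_ennrealI tendsto_intros lim)
      also have "\<dots> \<le> liminf (\<lambda>k. \<integral>\<^sup>+z. ennreal (M - f k j (x + s *\<^sub>R z)) \<partial>sphere_measure)"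
        by (intro nn_integral_liminf) measurable
      also have "\<dots> \<le> liminf (\<lambda>k. ennreal (M - f k j x))" by (intro Liminf_mono always_eventually allI fk)
      also have "\<dots> = ennreal (M - F j x)" by (intro ennreal_liminf_eq tendsto_ennrealI tendsto_intros lim)
      finally show ?thesis .
    qed
    have "(\<integral>\<^sup>+z. e2ennreal (ereal M - w (x + s *\<^sub>R z)) \<partial>sphere_measure)
        = (\<integral>\<^sup>+z. liminf (\<lambda>j. ennreal (M - F j (x + s *\<^sub>R z))) \<partial>sphere_measure)"
      by (intro nn_integral_cong ennreal_liminf_eq[symmetric] e2lim)
    also have "\<dots> \<le> liminf (\<lambda>j. \<integral>\<^sup>+z. ennreal (M - F j (x + s *\<^sub>R z)) \<partial>sphere_measure)"
      by (intro nn_integral_liminf) measurable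
    also have "\<dots> \<le> liminf (\<lambda>j. ennreal (M - F j x))" by (intro Liminf_mono always_eventually allI Fj)
    also have "\<dots> = e2ennreal (ereal M - w x)" by (intro ennreal_liminf_eq e2lim)
    finally show "\<exists>C\<ge>0. (\<forall>y\<in>cball x s. w y \<le> ereal C) \<and>
        (\<integral>\<^sup>+z. e2ennreal (ereal C - w (x + s *\<^sub>R z)) \<partial>sphere_measure) \<le> e2ennreal (ereal C - w x)"
      using M(1,3) sub[of _ s] by blast
  qed
  moreover have "(\<lambda>k. \<integral>x. real_fun (v k) x * \<phi> x \<partial>lborel) \<longlonglongrightarrow> (\<integral>x. real_fun w x * \<phi> x \<partial>lborel)"
    if \<phi>: "continuous_on UNIV \<phi>" and supp: "\<And>x. x \<notin> ball 0 N \<Longrightarrow> \<phi> x = 0" for \<phi> N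
  proof (rule LIMSEQ_I)
    fix e :: real assume "0 < e"
    have liw: "locally_integrable (real_fun w)" by (rule subharmonic_locally_integrable[OF \<open>subharmonic w\<close>])
    note [measurable] = borel_measurable_continuous_onI[OF \<phi>] locally_integrable_measurable[OF liw]
    have i\<phi>: "integrable lborel (\<lambda>x. g x * \<phi> x)" if "locally_integrable g" for g
      by (rule integrable_locally_integrable_times[OF that \<phi> supp])
    have ac: "continuous_on UNIV (\<lambda>x. \<bar>\<phi> x\<bar>)" "\<And>x. x \<notin> ball 0 N \<Longrightarrow> \<bar>\<phi> x\<bar> = 0"
      using \<phi> supp by (auto intro: continuous_intros)
    obtain C where C: "\<And>k. ball_norm (N + 1) (real_fun (v k)) \<le> C" using norm by blast
    have C0: "0 \<le> C" using C[of 0] ball_norm_nonneg[of "N + 1" "real_fun (v 0)"] by simp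
    \<comment> \<open>There are three errors of at most e/4: mollifying \<open>v k\<close>
      (uniformly in k), the limit in k at fixed j, and the limit in j.\<close>
    define \<eta> where "\<eta> = e / (4 * (C + 1))"
    have \<eta>: "0 < \<eta>" "\<eta> * C \<le> e / 4" using \<open>0 < e\<close> C0 by (auto simp: \<eta>_def field_simps)
    obtain d where "0 < d" and d: "\<And>R x. 0 < R \<Longrightarrow> R < d \<Longrightarrow> \<bar>mollify R \<phi> x - \<phi> x\<bar> \<le> \<eta>"
      using mollify_uniform_approx[OF \<phi> supp \<eta>(1)] by metis
    have A: "\<bar>(\<integral>x. real_fun (v k) x * \<phi> x \<partial>lborel) - (\<integral>x. f k j x * \<phi> x \<partial>lborel)\<bar> \<le> e / 4"
      if "r j < d" for j k
    proof -
      let ?g = "\<lambda>x. mollify (r j) \<phi> x - \<phi> x"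
      have contm: "continuous_on UNIV (mollify (r j) \<phi>)"
        by (intro continuous_on_mollify locally_integrable_continuous \<phi> r)
      have m0: "mollify (r j) \<phi> x = 0" if "x \<notin> ball 0 (N + 1)" for x
        by (rule mollify_support[OF supp r(1)]) (use that r(2)[of j] in auto)
      have s2: "\<phi> x = 0" if "x \<notin> ball 0 (N + 1)" for x using that by (intro supp) auto
      have "\<bar>\<integral>x. real_fun (v k) x * ?g x \<partial>lborel\<bar> \<le> \<eta> * ball_norm (N + 1) (real_fun (v k))"
        using m0 s2 d[OF r(1) that] contm
        by (intro integrable_locally_integrable_mult(2)[OF li] borel_measurable_diff
            borel_measurable_continuous_onI \<phi>) auto
      also have "\<dots> \<le> e / 4"
        using order_trans[OF mult_left_mono[OF C[of k] less_imp_le[OF \<eta>(1)]] \<eta>(2)] .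
      also have "(\<integral>x. real_fun (v k) x * ?g x \<partial>lborel) =
          (\<integral>x. real_fun (v k) x * mollify (r j) \<phi> x \<partial>lborel) - (\<integral>x. real_fun (v k) x * \<phi> x \<partial>lborel)"
        unfolding right_diff_distrib
        by (intro Bochner_Integration.integral_diff i\<phi> li integrable_locally_integrable_times[OF li contm m0])
      also have "(\<integral>x. real_fun (v k) x * mollify (r j) \<phi> x \<partial>lborel) = (\<integral>x. f k j x * \<phi> x \<partial>lborel)"
        unfolding f_def by (rule mollify_adjoint[OF li \<phi> supp r(1), symmetric])
      finally show ?thesis by (simp add: abs_minus_commute)
    qed
    \<comment> \<open>The L^1 bound makes mollifications of a fixed radius bounded on the support of
      \<phi> uniformly in k, which supplies the dominating function.\<close>
    have B: "(\<lambda>k. \<integral>x. f k j x * \<phi> x \<partial>lborel) \<longlonglongrightarrow> (\<integral>x. F j x * \<phi> x \<partial>lborel)" for j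
    proof -
      obtain C' where C': "\<And>k. ball_norm (N + r j) (real_fun (v k)) \<le> C'" using norm by blast
      define K where "K = kernel_bound (r j) TYPE('a) * C'"
      have kb: "0 \<le> kernel_bound (r j) TYPE('a)" using abs_kernel_le[OF r(1), of j "0::'a"] by linarith
      show ?thesis
      proof (rule integral_dominated_convergence)
        show "integrable lborel (\<lambda>x. K * \<bar>\<phi> x\<bar>)"
          by (intro integrable_locally_integrable_times[OF _ ac] locally_integrable_continuous continuous_intros)
        show "AE x in lborel. (\<lambda>k. f k j x * \<phi> x) \<longlonglongrightarrow> F j x * \<phi> x"
          by (intro AE_I2 tendsto_intros lim)
        show "AE x in lborel. norm (f k j x * \<phi> x) \<le> K * \<bar>\<phi> x\<bar>" for k
        proof (rule AE_I2)
          fix x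
          show "norm (f k j x * \<phi> x) \<le> K * \<bar>\<phi> x\<bar>"
          proof (cases "x \<in> ball 0 N")
            case True
            then have "\<bar>f k j x\<bar> \<le> kernel_bound (r j) TYPE('a) * ball_norm (N + r j) (real_fun (v k))"
              unfolding f_def by (intro mollify_abs_le[OF li r(1)]) simp
            also have "\<dots> \<le> K" unfolding K_def by (intro mult_left_mono C' kb)
            finally show ?thesis by (simp add: abs_mult mult_right_mono)
          qed (simp add: supp)
        qed
      qed measurable
    qed
    \<comment> \<open>Where w is finite, w \<le> F_j \<le> F_0, so |F_0| + |w| dominates.\<close>
    have D: "(\<lambda>j. \<integral>x. F j x * \<phi> x \<partial>lborel) \<longlonglongrightarrow> (\<integral>x. real_fun w x * \<phi> x \<partial>lborel)"
    proof (rule integral_dominated_convergence)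
      have "locally_integrable (\<lambda>x. \<bar>real_fun w x\<bar>)"
        by (rule locally_integrable_abs[OF liw])
      from integrable_locally_integrable_times[OF this ac]
        integrable_locally_integrable_times[OF locally_integrable_continuous[of "\<lambda>x. \<bar>F 0 x\<bar>"] ac]
      show "integrable lborel (\<lambda>x. \<bar>F 0 x\<bar> * \<bar>\<phi> x\<bar> + \<bar>real_fun w x\<bar> * \<bar>\<phi> x\<bar>)"
        using contF[of 0] by (intro Bochner_Integration.integrable_add) (auto intro: continuous_intros)
      have lw: "(\<lambda>j. F j x) \<longlonglongrightarrow> real_fun w x \<and> (\<forall>j. \<bar>F j x\<bar> \<le> \<bar>F 0 x\<bar> + \<bar>real_fun w x\<bar>)"
        if wx: "w x \<noteq> - \<infinity>" for x
      proof -
        obtain b where b: "w x = ereal b"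
          using wx subharmonic_less_top[OF \<open>subharmonic w\<close>, of x] by (cases "w x") auto
        have "F j x \<le> F 0 x" for j using decseqD[OF F_decr, of 0 j x] by simp
        moreover have "b \<le> F j x" for j using w_le[of x j] b by simp
        ultimately have "\<bar>F j x\<bar> \<le> \<bar>F 0 x\<bar> + \<bar>b\<bar>" for j by (smt (verit))
        then show ?thesis using Fw[of x] b by simp
      qed
      show "AE x in lborel. (\<lambda>j. F j x * \<phi> x) \<longlonglongrightarrow> real_fun w x * \<phi> x"
        using subharmonic_AE_finite[OF \<open>subharmonic w\<close>]
      proof eventually_elim
        case (elim x)
        show ?case by (rule tendsto_mult[OF conjunct1[OF lw[OF elim]] tendsto_const])
      qed
      show "AE x in lborel. norm (F j x * \<phi> x) \<le> \<bar>F 0 x\<bar> * \<bar>\<phi> x\<bar> + \<bar>real_fun w x\<bar> * \<bar>\<phi> x\<bar>" for j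
        using subharmonic_AE_finite[OF \<open>subharmonic w\<close>]
      proof eventually_elim
        case (elim x)
        have "\<bar>F j x\<bar> * \<bar>\<phi> x\<bar> \<le> (\<bar>F 0 x\<bar> + \<bar>real_fun w x\<bar>) * \<bar>\<phi> x\<bar>"
          using lw[OF elim] by (intro mult_right_mono) auto
        then show ?case by (simp add: abs_mult distrib_right)
      qed
    qed measurable
    have "r \<longlonglongrightarrow> 0" unfolding r_def using LIMSEQ_Suc[OF lim_1_over_n] .
    then have "\<forall>\<^sub>F j in sequentially. r j < d" using \<open>0 < d\<close> by (rule order_tendstoD)
    moreover have "\<forall>\<^sub>F j in sequentially. dist (\<integral>x. F j x * \<phi> x \<partial>lborel) (\<integral>x. real_fun w x * \<phi> x \<partial>lborel) < e / 4"
      using D \<open>0 < e\<close> by (intro tendstoD) auto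
    ultimately have "\<forall>\<^sub>F j in sequentially. r j < d \<and>
        dist (\<integral>x. F j x * \<phi> x \<partial>lborel) (\<integral>x. real_fun w x * \<phi> x \<partial>lborel) < e / 4"
      by (rule eventually_conj)
    then obtain j where j: "r j < d" "dist (\<integral>x. F j x * \<phi> x \<partial>lborel) (\<integral>x. real_fun w x * \<phi> x \<partial>lborel) < e / 4"
      unfolding eventually_sequentially by blast
    have "\<forall>\<^sub>F k in sequentially. dist (\<integral>x. f k j x * \<phi> x \<partial>lborel) (\<integral>x. F j x * \<phi> x \<partial>lborel) < e / 4"
      using B \<open>0 < e\<close> by (intro tendstoD) auto
    then have "\<forall>\<^sub>F k in sequentially. norm ((\<integral>x. real_fun (v k) x * \<phi> x \<partial>lborel) - (\<integral>x. real_fun w x * \<phi> x \<partial>lborel)) < e"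
    proof eventually_elim
      case (elim k)
      then show ?case using A[OF j(1), of k] j(2) unfolding dist_real_def real_norm_def by linarith
    qed
    then show "\<exists>no. \<forall>k\<ge>no. norm ((\<integral>x. real_fun (v k) x * \<phi> x \<partial>lborel) - (\<integral>x. real_fun w x * \<phi> x \<partial>lborel)) < e"
      unfolding eventually_sequentially .
  qed
  ultimately show thesis by (rule that)
qed

subsection \<open>Proximate orders and rescaled functions\<close>

definition growth_fun :: "(real \<Rightarrow> real) \<Rightarrow> real \<Rightarrow> real" where
  "growth_fun p t = t powr p t"

lemma growth_fun_pos: "0 < t \<Longrightarrow> 0 < growth_fun p t"
  by (simp add: growth_fun_def)

lemma powr_minus_growth_fun: "t powr (- p t) = 1 / growth_fun p t"
  by (simp add: growth_fun_def powr_minus_divide)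

text \<open>In the variable s = ln t the logarithm of t^p(t) is p(e^s) s. Its derivative e^s s
  p'(e^s) + p(e^s) tends to \<rho> by the two limits that define a proximate order.\<close>

lemma proximate_order_log_derivative:
  assumes "proximate_order \<rho> p"
  obtains G' where "\<And>s. ((\<lambda>s. p (exp s) * s) has_real_derivative G' s) (at s)" "(G' \<longlongrightarrow> \<rho>) at_top"
proof -
  from assms obtain p' where p': "\<And>r. r > 0 \<Longrightarrow> (p has_real_derivative p' r) (at r)"
    "((\<lambda>r. r * ln r * p' r) \<longlongrightarrow> 0) at_top" and p: "(p \<longlongrightarrow> \<rho>) at_top"
    unfolding proximate_order_def by blast
  let ?G = "\<lambda>s. exp s * ln (exp s) * p' (exp s) + p (exp s)"
  show thesis
  proof (rule that)
    show "((\<lambda>s. p (exp s) * s) has_real_derivative ?G s) (at s)" for s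
      using DERIV_chain2[OF p'(1) DERIV_exp, of s]
      by (auto intro!: derivative_eq_intros)
    have "((\<lambda>s. exp s * ln (exp s) * p' (exp s)) \<longlongrightarrow> 0) at_top" "((\<lambda>s. p (exp s)) \<longlongrightarrow> \<rho>) at_top"
      using filterlim_compose[OF p'(2) exp_at_top] filterlim_compose[OF p exp_at_top] by simp_all
    from tendsto_add[OF this] show "(?G \<longlongrightarrow> \<rho>) at_top" by simp
  qed
qed

lemma growth_fun_exp: "0 < t \<Longrightarrow> growth_fun p t = exp (p (exp (ln t)) * ln t)"
  by (simp add: growth_fun_def powr_def)

text \<open>With h = ln c the mean value theorem gives G(s + h) - G(s) = h G'(z) for some z between
  s and s + h, and z tends to infinity with s.\<close>

lemma growth_fun_regularly_varying:
  assumes p: "proximate_order \<rho> p" and c: "0 < c"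
  shows "((\<lambda>t. growth_fun p (t * c) / growth_fun p t) \<longlongrightarrow> c powr \<rho>) at_top"
proof -
  define G where "G s = p (exp s) * s" for s
  obtain G' where G': "\<And>s. (G has_real_derivative G' s) (at s)" "(G' \<longlongrightarrow> \<rho>) at_top"
    using proximate_order_log_derivative[OF p] unfolding G_def by metis
  define h where "h = ln c"
  have "((\<lambda>s. G (s + h) - G s - h * \<rho>) \<longlongrightarrow> 0) at_top"
  proof (rule tendstoI)
    fix e :: real assume e: "0 < e"
    define e' where "e' = e / (\<bar>h\<bar> + 1)"
    have e': "0 < e'" "e' * \<bar>h\<bar> < e" using e by (auto simp: e'_def field_simps)
    obtain s0 where s0: "\<And>s. s \<ge> s0 \<Longrightarrow> \<bar>G' s - \<rho>\<bar> < e'"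
      using tendstoD[OF G'(2) e'(1)] unfolding eventually_at_top_linorder dist_real_def by blast
    \<comment> \<open>The margin |h| keeps z above \<open>s0\<close> for either sign of h.\<close>
    have "\<bar>G (s + h) - G s - h * \<rho>\<bar> < e" if s: "s \<ge> s0 + \<bar>h\<bar>" for s
    proof -
      have "\<exists>z. z \<ge> s0 \<and> G (s + h) - G s = h * G' z"
      proof (cases h "0::real" rule: linorder_cases)
        case less
        then have "\<exists>z>s+h. z < s \<and> G s - G (s + h) = (s - (s + h)) * G' z"
          by (intro MVT2 G') auto
        then obtain z where "z > s + h" "G s - G (s + h) = - h * G' z" by auto
        then show ?thesis using s less by (intro exI[of _ z]) auto
      next
        case equal
        then show ?thesis by auto
      next
        case greater
        then have "\<exists>z>s. z < s + h \<and> G (s + h) - G s = (s + h - s) * G' z"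
          by (intro MVT2 G') auto
        then obtain z where "z > s" "G (s + h) - G s = h * G' z" by auto
        then show ?thesis using s greater by (intro exI[of _ z]) auto
      qed
      then obtain z where z: "z \<ge> s0" "G (s + h) - G s = h * G' z" by blast
      have "\<bar>G (s + h) - G s - h * \<rho>\<bar> = \<bar>h\<bar> * \<bar>G' z - \<rho>\<bar>"
        by (simp add: z(2) right_diff_distrib flip: abs_mult)
      also have "\<dots> \<le> \<bar>h\<bar> * e'" using s0[OF z(1)] by (intro mult_left_mono) auto
      finally show ?thesis using e'(2) by (simp add: mult.commute)
    qed
    then show "\<forall>\<^sub>F s in at_top. dist (G (s + h) - G s - h * \<rho>) 0 < e"
      unfolding eventually_at_top_linorder by (auto simp: dist_real_def)
  qed
  from tendsto_exp[OF tendsto_add[OF this tendsto_const[of "h * \<rho>"]]]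
  have "((\<lambda>s. exp (G (s + h) - G s)) \<longlongrightarrow> c powr \<rho>) at_top"
    using c by (simp add: h_def powr_def mult.commute)
  from filterlim_compose[OF this ln_at_top]
  show ?thesis
  proof (rule Lim_transform_eventually)
    show "\<forall>\<^sub>F t in at_top. exp (G (ln t + h) - G (ln t)) = growth_fun p (t * c) / growth_fun p t"
      using eventually_gt_at_top[of 0]
    proof eventually_elim
      case (elim t)
      then show ?case using c
        by (simp add: growth_fun_exp G_def h_def exp_diff ln_mult)
    qed
  qed
qed

text \<open>The logarithmic derivative tends to \<rho> > 0 and is therefore eventually
  positive.\<close>

lemma growth_fun_eventually_mono:
  assumes p: "proximate_order \<rho> p" and "0 < \<rho>"
  obtains r0 where "0 < r0" "\<And>r s. r0 \<le> r \<Longrightarrow> r \<le> s \<Longrightarrow> growth_fun p r \<le> growth_fun p s"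
proof -
  define G where "G s = p (exp s) * s" for s
  obtain G' where G': "\<And>s. (G has_real_derivative G' s) (at s)" "(G' \<longlongrightarrow> \<rho>) at_top"
    using proximate_order_log_derivative[OF p] unfolding G_def by metis
  obtain s0 where s0: "\<And>s. s \<ge> s0 \<Longrightarrow> 0 < G' s"
    using order_tendstoD(1)[OF G'(2) \<open>0 < \<rho>\<close>] unfolding eventually_at_top_linorder by blast
  show thesis
  proof (rule that[of "exp s0"])
    fix r s assume "exp s0 \<le> r" "r \<le> s"
    moreover from this have "0 < r" using exp_gt_zero[of s0] by linarith
    ultimately have rs: "0 < r" "0 < s" "s0 \<le> ln r" "ln r \<le> ln s"
      by (auto simp: ln_ge_iff)
    have "G (ln r) \<le> G (ln s)"
      by (rule DERIV_nonneg_imp_nondecreasing[OF rs(4)])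
         (use G'(1) s0 rs in \<open>meson less_imp_le order_trans\<close>)
    then show "growth_fun p r \<le> growth_fun p s"
      using rs by (simp add: growth_fun_exp G_def)
  qed simp
qed

lemma growth_fun_at_top:
  assumes p: "proximate_order \<rho> p" and "0 < \<rho>"
  shows "filterlim (growth_fun p) at_top at_top"
proof -
  have "(p \<longlongrightarrow> \<rho>) at_top" using p by (simp add: proximate_order_def)
  from filterlim_tendsto_pos_mult_at_top[OF this \<open>0 < \<rho>\<close> ln_at_top]
  have "filterlim (\<lambda>t. exp (p t * ln t)) at_top at_top"
    by (rule filterlim_compose[OF exp_at_top])
  then show ?thesis
  proof (rule filterlim_mono_eventually[OF _ order_refl order_refl])
    show "\<forall>\<^sub>F t in at_top. exp (p t * ln t) = growth_fun p t"
      using eventually_gt_at_top[of 0] by eventually_elim (simp add: growth_fun_exp)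
  qed
qed

lemma continuous_on_growth_fun:
  assumes "proximate_order \<rho> p"
  shows "continuous_on {0<..} (growth_fun p)"
proof -
  have "continuous_on {0<..} p"
    using assms unfolding proximate_order_def
    by (metis DERIV_continuous_on DERIV_subset greaterThan_iff has_field_derivative_at_within)
  then show ?thesis unfolding growth_fun_def by (intro continuous_intros) auto
qed

lemma growth_type_upper_bound:
  fixes u :: "'a::euclidean_space \<Rightarrow> ereal"
  assumes "growth_type p u < ereal \<sigma>"
  obtains r0 where "0 < r0" "\<And>x. r0 \<le> norm x \<Longrightarrow> u x \<le> ereal (\<sigma> * growth_fun p (norm x))"
proof -
  have "\<forall>\<^sub>F r in at_top. sphere_max r u * ereal (r powr (- p r)) < ereal \<sigma>"
    using assms unfolding growth_type_def by (rule Limsup_lessD)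
  then obtain r0 where r0: "\<And>r. r \<ge> r0 \<Longrightarrow> sphere_max r u * ereal (r powr (- p r)) < ereal \<sigma>"
    unfolding eventually_at_top_linorder by blast
  show thesis
  proof (rule that[of "max r0 1"])
    fix x :: 'a assume x: "max r0 1 \<le> norm x"
    let ?r = "norm x"
    have L: "0 < growth_fun p ?r" using x by (intro growth_fun_pos) linarith
    have "u x \<le> sphere_max ?r u" unfolding sphere_max_def by (rule SUP_upper) simp
    then have "u x * ereal (1 / growth_fun p ?r) \<le> sphere_max ?r u * ereal (1 / growth_fun p ?r)"
      using L by (intro ereal_mult_right_mono) auto
    also have "\<dots> \<le> ereal \<sigma>"
      using r0[of ?r] x by (simp add: powr_minus_growth_fun)
    finally show "u x \<le> ereal (\<sigma> * growth_fun p ?r)"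
      using L by (cases "u x") (auto simp: field_simps)
  qed simp
qed

section \<open>Rotations, dilations and bounds for the rescaled functions\<close>

lemma orthogonal_transformation_rotation:
  fixes V :: "real \<Rightarrow> real^'m^'m"
  assumes "rotation_group V" "0 < t"
  shows "orthogonal_transformation ((*v) (V t))"
  using assms unfolding rotation_group_def rotation_matrix_def
  by (auto simp: orthogonal_transformation_matrix)

lemma norm_rot_dilation:
  assumes "rotation_group V" "0 < t"
  shows "norm (rot_dilation V t x) = t * norm x"
  using orthogonal_transformation_norm[OF orthogonal_transformation_rotation[OF assms]] assms(2)
  by (simp add: rot_dilation_def)

lemma rot_dilation_mult:
  assumes "rotation_group V" "0 < s" "0 < t"
  shows "rot_dilation V s (rot_dilation V t x) = rot_dilation V (s * t) x"
proof -
  have "V s ** V t = V (s * t)" using assms by (auto simp: rotation_group_def)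
  then show ?thesis
    by (simp add: rot_dilation_def matrix_vector_mult_scaleR matrix_vector_mul_assoc)
qed

lemma rot_dilation_1: "rotation_group V \<Longrightarrow> rot_dilation V 1 x = x"
  by (simp add: rot_dilation_def rotation_group_def)

lemma subharmonic_scale_rot_dilation:
  assumes "rotation_group V" "subharmonic u" "0 < t" "0 < c"
  shows "subharmonic (\<lambda>x. ereal c * u (rot_dilation V t x))"
  using subharmonic_scale[OF subharmonic_similarity[OF assms(2)
      orthogonal_transformation_rotation[OF assms(1,3)] assms(3), of 0] assms(4)]
  by (simp add: rot_dilation_def)

lemma subharmonic_rescale:
  assumes "rotation_group V" "subharmonic u" "0 < t"
  shows "subharmonic (rescale p V u t)"
  using subharmonic_scale_rot_dilation[OF assms, of "t powr (- p t)"] assms(3)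
  by (simp add: rescale_def[abs_def])

lemma subharmonic_rescale_const:
  assumes "rotation_group V" "subharmonic u" "0 < t"
  shows "subharmonic (rescale_const \<rho> V u t)"
  using subharmonic_scale_rot_dilation[OF assms, of "t powr (- \<rho>)"] assms(3)
  by (simp add: rescale_const_def[abs_def])

lemma real_fun_rescale:
  "real_of_ereal (rescale p V u t x) = 1 / growth_fun p t * real_of_ereal (u (rot_dilation V t x))"
  by (simp add: rescale_def powr_minus_growth_fun)

lemma integral_rot_dilation:
  fixes f :: "real^'m \<Rightarrow> real"
  assumes V: "rotation_group V" and t: "0 < t" and [measurable]: "f \<in> borel_measurable borel"
  shows "(\<integral>x. f (rot_dilation V t x) \<partial>lborel) = (\<integral>x. f x \<partial>lborel) / t ^ CARD('m)"
proof -
  have "(\<integral>x. f (t *\<^sub>R (V t *v x)) \<partial>lborel) = (\<integral>x. f (t *\<^sub>R x) \<partial>lborel)"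
    by (rule integral_lborel_orthogonal(2)[OF orthogonal_transformation_rotation[OF V t], of "\<lambda>x. f (t *\<^sub>R x)"]) simp
  moreover have "(\<integral>x. f x \<partial>lborel) = t ^ CARD('m) * (\<integral>x. f (t *\<^sub>R x) \<partial>lborel)"
    using integral_lborel_affine(2)[of f t 0] t by simp
  ultimately show ?thesis using t by (simp add: rot_dilation_def)
qed

text \<open>At the origin the radial kernel absorbs the rotation, and the dilation only multiplies
  the radius.\<close>

lemma mollify_rescale_0:
  assumes V: "rotation_group V" and u: "subharmonic u" and t: "0 < t" and R: "0 < R"
  shows "mollify R (real_fun (rescale p V u t)) 0 = mollify (t * R) (real_fun u) 0 / growth_fun p t"
proof -
  note o = orthogonal_transformation_rotation[OF V t]
  note [measurable] = subharmonic_measurable[OF u] subharmonic_measurable[OF subharmonic_rescale[OF V u t]]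
  have "rot_dilation V t (R *\<^sub>R z) = (t * R) *\<^sub>R (V t *v z)" for z
    by (simp add: rot_dilation_def matrix_vector_mult_scaleR)
  moreover have "mollify R (real_fun (rescale p V u t)) 0 =
      (\<integral>z. real_of_ereal (rescale p V u t (0 + R *\<^sub>R z)) * bump_kernel 1 z \<partial>lborel)"
    using R by (intro mollify_unit_scale) measurable
  ultimately have "mollify R (real_fun (rescale p V u t)) 0 =
      (\<integral>z. 1 / growth_fun p t * (real_fun u ((t * R) *\<^sub>R (V t *v z)) * bump_kernel 1 (V t *v z)) \<partial>lborel)"
    by (simp add: real_fun_rescale kernel_orthogonal[OF o] mult.assoc)
  also have "\<dots> = 1 / growth_fun p t * (\<integral>z. real_fun u ((t * R) *\<^sub>R (V t *v z)) * bump_kernel 1 (V t *v z) \<partial>lborel)"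
    by (rule integral_mult_right_zero)
  also have "(\<integral>z. real_fun u ((t * R) *\<^sub>R (V t *v z)) * bump_kernel 1 (V t *v z) \<partial>lborel) =
      (\<integral>z. real_fun u ((t * R) *\<^sub>R z) * bump_kernel 1 z \<partial>lborel)"
    by (rule integral_lborel_orthogonal(2)[OF o, of "\<lambda>z. real_fun u ((t * R) *\<^sub>R z) * bump_kernel 1 z"]) measurable
  also have "\<dots> = mollify (t * R) (real_fun u) 0"
    using t R by (subst mollify_unit_scale) auto
  finally show ?thesis by simp
qed

text \<open>On the left, t occurs only in the denominator. The mollified value at 0 stands in for
  u(0), which may be -\<infinity>.\<close>

lemma mollify_rescale_0_ge:
  assumes V: "rotation_group V" and u: "subharmonic u" and t: "1 \<le> t" and R: "0 < R"
  shows "mollify R (real_fun u) 0 / growth_fun p t \<le> mollify R (real_fun (rescale p V u t)) 0"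
proof -
  have "mollify R (real_fun u) 0 \<le> mollify (t * R) (real_fun u) 0"
    using t R mult_right_mono[OF t, of R] by (intro subharmonic_mollify_mono[OF u]) auto
  then show ?thesis
    using t R growth_fun_pos[of t p] by (subst mollify_rescale_0[OF V u]) (auto intro: divide_right_mono)
qed

lemma rescale_upper_bound:
  fixes V :: "real \<Rightarrow> real^'m^'m"
  assumes V: "rotation_group V" and "growth_type p u < ereal \<sigma>"
  obtains r0 where "0 < r0" "\<And>t x. 0 < t \<Longrightarrow> r0 \<le> t * norm x \<Longrightarrow>
    rescale p V u t x \<le> ereal (\<sigma> * (growth_fun p (t * norm x) / growth_fun p t))"
proof -
  obtain r0 where r0: "0 < r0" "\<And>x. r0 \<le> norm x \<Longrightarrow> u x \<le> ereal (\<sigma> * growth_fun p (norm x))"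
    using growth_type_upper_bound[OF assms(2)] by blast
  show thesis
  proof (rule that[OF r0(1)])
    fix t :: real and x :: "real^'m" assume t: "0 < t" and "r0 \<le> t * norm x"
    then have "u (rot_dilation V t x) \<le> ereal (\<sigma> * growth_fun p (t * norm x))"
      using r0(2)[of "rot_dilation V t x"] by (simp add: norm_rot_dilation[OF V t])
    then have "ereal (1 / growth_fun p t) * u (rot_dilation V t x) \<le>
        ereal (1 / growth_fun p t) * ereal (\<sigma> * growth_fun p (t * norm x))"
      using growth_fun_pos[OF t, of p] by (intro ereal_mult_left_mono) auto
    then show "rescale p V u t x \<le> ereal (\<sigma> * (growth_fun p (t * norm x) / growth_fun p t))"
      by (simp add: rescale_def powr_minus_growth_fun)
  qed
qed

text \<open>There are two regimes. Where t|x| is large the growth bound applies, and eventual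
  monotonicity with regular variation compares the growth function at t|x| with that at t. Where
  t|x| stays below r0, u is bounded above and is divided by a number at least 1.\<close>

lemma rescale_bounded_above:
  fixes V :: "real \<Rightarrow> real^'m^'m"
  assumes V: "rotation_group V" and p: "proximate_order \<rho> p" and \<rho>: "0 < \<rho>" and u: "u \<in> SH p"
  obtains C t0 where "0 \<le> C" "1 \<le> t0" "\<And>t x. t0 \<le> t \<Longrightarrow> x \<in> cball 0 N \<Longrightarrow> rescale p V u t x \<le> ereal C"
proof -
  have su: "subharmonic u" and "growth_type p u < \<infinity>" using u by (auto simp: SH_def)
  then obtain \<sigma>' where "growth_type p u < ereal \<sigma>'" using ereal_dense2 by blast
  \<comment> \<open>Made nonnegative so that inequalities between growth quotients can be multiplied
    by it.\<close>
  define \<sigma> where "\<sigma> = max \<sigma>' 0"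
  have "growth_type p u < ereal \<sigma>"
    using \<open>growth_type p u < ereal \<sigma>'\<close> by (rule less_le_trans) (simp add: \<sigma>_def)
  then obtain r1 where r1: "0 < r1" "\<And>t x. 0 < t \<Longrightarrow> r1 \<le> t * norm x \<Longrightarrow>
      rescale p V u t x \<le> ereal (\<sigma> * (growth_fun p (t * norm x) / growth_fun p t))"
    using rescale_upper_bound[OF V] by metis
  obtain r2 where r2: "0 < r2" "\<And>r s. r2 \<le> r \<Longrightarrow> r \<le> s \<Longrightarrow> growth_fun p r \<le> growth_fun p s"
    using growth_fun_eventually_mono[OF p \<rho>] by metis
  define r0 where "r0 = max r1 r2"
  obtain C0 where C0: "0 \<le> C0" "\<And>y. y \<in> cball 0 r0 \<Longrightarrow> u y \<le> ereal C0"
    using subharmonic_bounded_above_compact[OF su compact_cball] by blast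
  define c where "c = max N 1"
  have c: "0 < c" "N \<le> c" by (auto simp: c_def)
  have "\<forall>\<^sub>F t in at_top. growth_fun p (t * c) / growth_fun p t < c powr \<rho> + 1"
    using growth_fun_regularly_varying[OF p c(1)] by (rule order_tendstoD) simp
  moreover have "\<forall>\<^sub>F t in at_top. 1 \<le> growth_fun p t"
    using growth_fun_at_top[OF p \<rho>] by (simp add: filterlim_at_top)
  ultimately have "\<forall>\<^sub>F t in at_top. growth_fun p (t * c) / growth_fun p t < c powr \<rho> + 1 \<and> 1 \<le> growth_fun p t"
    by (rule eventually_conj)
  then obtain t1 where t1: "\<And>t. t1 \<le> t \<Longrightarrow> growth_fun p (t * c) / growth_fun p t < c powr \<rho> + 1"
      "\<And>t. t1 \<le> t \<Longrightarrow> 1 \<le> growth_fun p t"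
    unfolding eventually_at_top_linorder by blast
  define C where "C = C0 + \<sigma> * (c powr \<rho> + 1)"
  have \<sigma>: "0 \<le> \<sigma>" by (simp add: \<sigma>_def)
  show thesis
  proof (rule that[of C "max t1 1"])
    show "0 \<le> C" using C0 \<sigma> by (simp add: C_def)
    fix t and x :: "real^'m" assume t: "max t1 1 \<le> t" and x: "x \<in> cball 0 N"
    have Lt: "1 \<le> growth_fun p t" using t t1 by simp
    show "rescale p V u t x \<le> ereal C"
    proof (cases "r0 \<le> t * norm x")
      case True
      have "t * norm x \<le> t * c" using x c t by (intro mult_left_mono) auto
      then have "growth_fun p (t * norm x) \<le> growth_fun p (t * c)"
        using True by (intro r2) (auto simp: r0_def)
      then have "growth_fun p (t * norm x) / growth_fun p t \<le> c powr \<rho> + 1"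
        using t1(1)[of t] t Lt by (meson divide_right_mono dual_order.trans less_eq_real_def max.boundedE zero_le_one)
      then have "\<sigma> * (growth_fun p (t * norm x) / growth_fun p t) \<le> C"
        using \<sigma> C0 mult_left_mono unfolding C_def by (metis add_increasing)
      moreover have "rescale p V u t x \<le> ereal (\<sigma> * (growth_fun p (t * norm x) / growth_fun p t))"
        using True t by (intro r1) (auto simp: r0_def)
      ultimately show ?thesis by (meson ereal_less_eq(3) order_trans)
    next
      case False
      then have "u (rot_dilation V t x) \<le> ereal C0"
        using t by (intro C0) (simp add: norm_rot_dilation[OF V])
      then have "ereal (1 / growth_fun p t) * u (rot_dilation V t x) \<le> ereal (1 / growth_fun p t) * ereal C0"
        using Lt by (intro ereal_mult_left_mono) auto
      also have "\<dots> \<le> ereal C"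
        using Lt C0 \<sigma> divide_left_mono[of 1 "growth_fun p t" C0] by (simp add: C_def add_increasing2)
      finally show ?thesis by (simp add: rescale_def powr_minus_growth_fun)
    qed
  qed simp
qed

text \<open>K depends on N, C and B but not on w, which makes the bound uniform over a family. On
  the larger ball C - w is nonnegative, and its kernel mean is at most C + B.\<close>

lemma subharmonic_ball_norm_bound:
  assumes N: "0 < N" and C: "0 \<le> C"
  obtains K where "\<And>w :: 'a::euclidean_space \<Rightarrow> ereal. subharmonic w \<Longrightarrow>
    (\<And>y. y \<in> cball 0 (2 * N) \<Longrightarrow> w y \<le> ereal C) \<Longrightarrow> - B \<le> mollify (2 * N) (real_fun w) 0 \<Longrightarrow>
    ball_norm N (real_fun w) \<le> K"
proof -
  have R: "0 < 2 * N" using N by simp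
  obtain c where "0 < c" and c: "\<And>y::'a. norm y \<le> N \<Longrightarrow> c \<le> bump_kernel (2 * N) y"
    using kernel_lower_bound[OF R, where 'a='a] by auto
  let ?k = "bump_kernel (2 * N) :: 'a \<Rightarrow> real"
  let ?i = "indicator (ball (0::'a) N) :: 'a \<Rightarrow> real"
  show thesis
  proof (rule that)
    fix w :: "'a \<Rightarrow> ereal"
    assume w: "subharmonic w" and le: "\<And>y. y \<in> cball 0 (2 * N) \<Longrightarrow> w y \<le> ereal C"
      and B: "- B \<le> mollify (2 * N) (real_fun w) 0"
    have li: "locally_integrable (real_fun w)" by (rule subharmonic_locally_integrable[OF w])
    have i1: "integrable lborel (\<lambda>y. ?i y * \<bar>real_fun w y\<bar>)"
      using locally_integrable_abs[OF li] unfolding locally_integrable_def set_integrable_def by simp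
    have i2: "integrable lborel (\<lambda>y. real_fun w y * ?k y)" "integrable lborel ?k"
      using integrable_mollify(1)[OF li R, of 0] integral_kernel[OF R] by auto
    have i3: "integrable lborel ?i"
      using emeasure_bounded_finite[of "ball (0::'a) N"] by (simp add: integrable_indicator_iff)
    have "ball_norm N (real_fun w) = (\<integral>y. ?i y * \<bar>real_fun w y\<bar> \<partial>lborel)"
      by (simp add: ball_norm_def set_lebesgue_integral_def)
    \<comment> \<open>On the ball of radius N one has |w| \<le> C + (C - w), and the kernel of
      radius 2N is at least c there, so C - w is bounded by its product with the kernel divided by
      c.\<close>
    also have "\<dots> \<le> (\<integral>y. C * ?i y + (C * ?k y - real_fun w y * ?k y) / c \<partial>lborel)"
    proof (rule integral_mono_AE)
      show "AE y in lborel. ?i y * \<bar>real_fun w y\<bar> \<le> C * ?i y + (C * ?k y - real_fun w y * ?k y) / c"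
        using subharmonic_AE_finite[OF w]
      proof eventually_elim
        case (elim y)
        then obtain b where b: "w y = ereal b" using subharmonic_less_top[OF w, of y] by (cases "w y") auto
        show ?case
        proof (cases "norm y \<le> 2 * N")
          case True
          then have bC: "b \<le> C" using le[of y] b by simp
          have "0 \<le> (C - b) * ?k y / c"
            using bC kernel_nonneg[OF R, of y] \<open>0 < c\<close> by simp
          moreover have "\<bar>b\<bar> \<le> C + (C - b) * ?k y / c" if "norm y < N"
          proof -
            have "c * (C - b) \<le> (C - b) * ?k y" using c[of y] that bC mult_right_mono[of c "?k y" "C - b"] by (simp add: mult.commute)
            then have "C - b \<le> (C - b) * ?k y / c" using \<open>0 < c\<close> by (simp add: field_simps)
            then show ?thesis using bC C by (auto simp: abs_if)
          qed
          ultimately show ?thesis using b by (auto simp: indicator_def left_diff_distrib)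
        next
          case False
          then show ?thesis using kernel_eq_0[OF R, of y] N by (auto simp: indicator_def)
        qed
      qed
    qed (use i1 i2 i3 in auto)
    also have "\<dots> = C * measure lborel (ball (0::'a) N) + (C - mollify (2 * N) (real_fun w) 0) / c"
      using i2 i3 integral_kernel(2)[OF R, where 'a='a] by (simp add: mollify_def)
    also have "\<dots> \<le> C * measure lborel (ball (0::'a) N) + (C + B) / c"
      using B \<open>0 < c\<close> by (intro add_left_mono divide_right_mono) auto
    finally show "ball_norm N (real_fun w) \<le> C * measure lborel (ball (0::'a) N) + (C + B) / c" .
  qed
qed

lemma ball_norm_mono:
  assumes "locally_integrable f" "N \<le> N'"
  shows "ball_norm N f \<le> ball_norm N' f"
  unfolding ball_norm_def set_lebesgue_integral_def
  using assms locally_integrable_abs[OF assms(1)] unfolding locally_integrable_def set_integrable_def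
  by (intro integral_mono) (auto simp: indicator_def)

lemma rescale_ball_norm_bounded:
  fixes V :: "real \<Rightarrow> real^'m^'m"
  assumes V: "rotation_group V" and p: "proximate_order \<rho> p" and \<rho>: "0 < \<rho>" and u: "u \<in> SH p"
  obtains K t0 where "1 \<le> t0" "\<And>t. t0 \<le> t \<Longrightarrow> ball_norm N (real_fun (rescale p V u t)) \<le> K"
proof -
  have su: "subharmonic u" using u by (auto simp: SH_def)
  define N' where "N' = max N 1"
  have N': "0 < N'" "N \<le> N'" by (auto simp: N'_def)
  obtain C t0 where C: "0 \<le> C" "1 \<le> t0"
    "\<And>t x. t0 \<le> t \<Longrightarrow> x \<in> cball 0 (2 * N') \<Longrightarrow> rescale p V u t x \<le> ereal C"
    using rescale_bounded_above[OF V p \<rho> u, of "2 * N'"] by metis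
  obtain t1 where t1: "\<And>t. t1 \<le> t \<Longrightarrow> 1 \<le> growth_fun p t"
    using growth_fun_at_top[OF p \<rho>] unfolding filterlim_at_top eventually_at_top_linorder by blast
  define B where "B = \<bar>mollify (2 * N') (real_fun u) 0\<bar>"
  obtain K where K: "\<And>w :: real^'m \<Rightarrow> ereal. subharmonic w \<Longrightarrow>
    (\<And>y. y \<in> cball 0 (2 * N') \<Longrightarrow> w y \<le> ereal C) \<Longrightarrow> - B \<le> mollify (2 * N') (real_fun w) 0 \<Longrightarrow>
    ball_norm N' (real_fun w) \<le> K"
    using subharmonic_ball_norm_bound[OF N'(1) C(1), of B, where 'a="real^'m"] by blast
  show thesis
  proof (rule that[of "max t0 t1" K])
    fix t assume t: "max t0 t1 \<le> t"
    then have t': "1 \<le> t" "t0 \<le> t" "1 \<le> growth_fun p t" using C(2) t1 by auto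
    have sub: "subharmonic (rescale p V u t)" using t' by (intro subharmonic_rescale[OF V su]) simp
    \<comment> \<open>The growth function is at least 1 for these t, so dividing the fixed mean of u
      by it keeps the quotient above -B.\<close>
    have "- B \<le> - (B / growth_fun p t)"
      using t'(3) divide_left_mono[of 1 "growth_fun p t" B] by (simp add: B_def)
    also have "\<dots> \<le> mollify (2 * N') (real_fun u) 0 / growth_fun p t"
      using t'(3) divide_right_mono[of "- B" "mollify (2 * N') (real_fun u) 0" "growth_fun p t"] by (simp add: B_def)
    also have "\<dots> \<le> mollify (2 * N') (real_fun (rescale p V u t)) 0"
      using N' by (intro mollify_rescale_0_ge[OF V su t'(1)]) simp
    finally have "ball_norm N' (real_fun (rescale p V u t)) \<le> K"
      using C(3)[OF t'(2)] by (intro K sub)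
    then show "ball_norm N (real_fun (rescale p V u t)) \<le> K"
      using ball_norm_mono[OF subharmonic_locally_integrable[OF sub] N'(2)] by simp
  qed (use C(2) in simp)
qed

subsection \<open>Regular distributions and limit sets\<close>

lemma test_function_continuous:
  assumes "\<phi> \<in> test_functions"
  shows "continuous_on UNIV \<phi>"
proof -
  have "partial_deriv [] \<phi> differentiable (at x)" for x
    using assms unfolding test_functions_def smooth_def by blast
  then show ?thesis
    by (simp add: continuous_on_eq_continuous_within differentiable_imp_continuous_within)
qed

lemma test_function_support:
  fixes \<phi> :: "'a::euclidean_space \<Rightarrow> real"
  assumes "\<phi> \<in> test_functions"
  obtains N where "0 < N" "\<And>x. x \<notin> ball 0 N \<Longrightarrow> \<phi> x = 0"
proof -
  have "bounded {x. \<phi> x \<noteq> 0}"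
    using assms bounded_closure_image compact_imp_bounded bounded_subset closure_subset
    unfolding test_functions_def by blast
  then obtain N where "0 < N" "{x. \<phi> x \<noteq> 0} \<subseteq> ball 0 N"
    using bounded_subset_ballD[of _ 0] by blast
  then show thesis by (intro that[of N]) auto
qed

lemma integrable_test_function:
  fixes f :: "'a::euclidean_space \<Rightarrow> real"
  assumes "locally_integrable f" "\<phi> \<in> test_functions"
  shows "integrable lborel (\<lambda>x. f x * \<phi> x)"
  using test_function_support[OF assms(2)]
    integrable_locally_integrable_times[OF assms(1) test_function_continuous[OF assms(2)]] by metis

lemma partial_deriv_append: "partial_deriv (bs @ cs) f = partial_deriv bs (partial_deriv cs f)"
  by (induction bs) auto

lemma smooth_partial:
  assumes "smooth f" "b \<in> Basis"
  shows "smooth (\<lambda>x. frechet_derivative f (at x) b)"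
proof -
  have "partial_deriv (bs @ [b]) f differentiable (at x)" if "bs \<in> lists Basis" for bs x
    using assms that unfolding smooth_def by (metis append_in_lists_conv lists.Cons lists.Nil)
  then show ?thesis by (simp add: smooth_def partial_deriv_append)
qed

lemma smooth_differentiable: "smooth f \<Longrightarrow> f differentiable (at x)"
  unfolding smooth_def by (metis lists.Nil partial_deriv.simps(1))

lemma smooth_linear_combination:
  fixes f g :: "'a::euclidean_space \<Rightarrow> real"
  assumes "smooth f" "smooth g"
  shows "smooth (\<lambda>x. a * f x + b * g x)"
proof (rule smooth_if_closed_under_partials[where S="{\<lambda>x. a * f x + b * g x |f g :: 'a \<Rightarrow> real. smooth f \<and> smooth g}"])
  have diff: "((\<lambda>x. a * f x + b * g x) has_derivative
      (\<lambda>h. a * frechet_derivative f (at x) h + b * frechet_derivative g (at x) h)) (at x)"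
    if "smooth f" "smooth g" for f g :: "'a \<Rightarrow> real" and x
    using that
    by (intro derivative_intros frechet_derivative_works[THEN iffD1] smooth_differentiable)
  fix h :: "'a \<Rightarrow> real" assume "h \<in> {\<lambda>x. a * f x + b * g x |f g. smooth f \<and> smooth g}"
  then obtain f g where h: "h = (\<lambda>x. a * f x + b * g x)" "smooth f" "smooth g" by blast
  show "h differentiable (at x)" for x
    using diff[OF h(2,3), of x] h(1) by (auto simp: differentiable_def)
  fix e :: 'a assume e: "e \<in> Basis"
  have "(\<lambda>x. frechet_derivative h (at x) e) =
      (\<lambda>x. a * frechet_derivative f (at x) e + b * frechet_derivative g (at x) e)"
    unfolding h(1) by (rule ext) (simp flip: frechet_derivative_at[OF diff[OF h(2,3)]])
  then show "(\<lambda>x. frechet_derivative h (at x) e) \<in> {\<lambda>x. a * f x + b * g x |f g. smooth f \<and> smooth g}"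
    using smooth_partial[OF h(2) e] smooth_partial[OF h(3) e]
    by (intro CollectI exI[of _ "\<lambda>x. frechet_derivative f (at x) e"]
        exI[of _ "\<lambda>x. frechet_derivative g (at x) e"] conjI)
qed (use assms in blast)

lemma test_functions_linear_combination:
  assumes "\<phi> \<in> test_functions" "\<psi> \<in> test_functions"
  shows "(\<lambda>x. a * \<phi> x + b * \<psi> x) \<in> test_functions"
proof -
  obtain M N where "\<And>x. x \<notin> ball 0 M \<Longrightarrow> \<phi> x = 0" "\<And>x. x \<notin> ball 0 N \<Longrightarrow> \<psi> x = 0"
    using test_function_support[OF assms(1)] test_function_support[OF assms(2)] by metis
  then have "a * \<phi> x + b * \<psi> x = 0" if "x \<notin> ball 0 (max M N)" for x using that by simp
  then have "{x. a * \<phi> x + b * \<psi> x \<noteq> 0} \<subseteq> ball 0 (max M N)" by blast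
  then have "bounded {x. a * \<phi> x + b * \<psi> x \<noteq> 0}" using bounded_ball bounded_subset by blast
  moreover have "smooth (\<lambda>x. a * \<phi> x + b * \<psi> x)"
    using assms by (intro smooth_linear_combination) (auto simp: test_functions_def)
  ultimately show ?thesis by (simp add: test_functions_def compact_closure)
qed

lemma regular_distribution_eq:
  "\<phi> \<in> test_functions \<Longrightarrow> regular_distribution u \<phi> = (\<integral>x. real_of_ereal (u x) * \<phi> x \<partial>lborel)"
  by (simp add: regular_distribution_def)

lemma regular_distribution_extensional: "regular_distribution u \<in> extensional test_functions"
  by (simp add: regular_distribution_def)

text \<open>The distribution has order 0: on a common ball of support its values are bounded by the
  sup norm of the test function times the L^1 norm of u.\<close>

lemma regular_distribution_in_distributions:
  fixes u :: "'a::euclidean_space \<Rightarrow> ereal"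
  assumes f: "locally_integrable (real_fun u)"
  shows "regular_distribution u \<in> distributions"
  unfolding distributions_def
proof (intro CollectI conjI ballI allI impI)
  show "regular_distribution u \<in> extensional test_functions"
    by (rule regular_distribution_extensional)
  show "regular_distribution u (\<lambda>x. a * \<phi> x + b * \<psi> x) =
      a * regular_distribution u \<phi> + b * regular_distribution u \<psi>"
    if \<phi>: "\<phi> \<in> test_functions" and \<psi>: "\<psi> \<in> test_functions" for \<phi> \<psi> a b
  proof -
    have "(\<lambda>x. real_fun u x * (a * \<phi> x + b * \<psi> x)) = (\<lambda>x. a * (real_fun u x * \<phi> x) + b * (real_fun u x * \<psi> x))"
      by (simp add: algebra_simps)
    then show ?thesis
      using \<phi> \<psi> integrable_test_function[OF f \<phi>] integrable_test_function[OF f \<psi>]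
      by (simp add: regular_distribution_eq test_functions_linear_combination)
  qed
  fix \<phi> :: "nat \<Rightarrow> 'a \<Rightarrow> real" and \<psi>
  assume "(\<forall>n. \<phi> n \<in> test_functions) \<and> \<psi> \<in> test_functions \<and> test_convergent \<phi> \<psi>"
  then have \<phi>: "\<And>n. \<phi> n \<in> test_functions" and \<psi>: "\<psi> \<in> test_functions" and conv: "test_convergent \<phi> \<psi>"
    by auto
  obtain K where K: "compact K" "\<And>n. {x. \<phi> n x \<noteq> 0} \<subseteq> K"
    using conv unfolding test_convergent_def by blast
  have "\<forall>bs\<in>lists Basis. uniform_limit UNIV (\<lambda>n. partial_deriv bs (\<phi> n)) (partial_deriv bs \<psi>) sequentially"
    using conv unfolding test_convergent_def by blast
  from this[rule_format, OF lists.Nil] have unif: "uniform_limit UNIV \<phi> \<psi> sequentially" by simp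
  obtain N1 where "K \<subseteq> ball 0 N1"
    using bounded_subset_ballD[OF compact_imp_bounded[OF K(1)], of 0] by blast
  moreover obtain N2 where "\<And>x. x \<notin> ball 0 N2 \<Longrightarrow> \<psi> x = 0"
    using test_function_support[OF \<psi>] by blast
  ultimately have supp: "\<phi> n x - \<psi> x = 0" if "x \<notin> ball 0 (max N1 N2)" for n x
    using K(2)[of n] that by force
  let ?B = "ball_norm (max N1 N2) (real_fun u)"
  have B: "0 \<le> ?B" by (rule ball_norm_nonneg)
  show "(\<lambda>n. regular_distribution u (\<phi> n)) \<longlonglongrightarrow> regular_distribution u \<psi>"
  proof (rule tendstoI)
    fix e :: real assume e: "0 < e"
    then have "0 < e / (?B + 1)" using B by simp
    with unif have "\<forall>\<^sub>F n in sequentially. \<forall>x\<in>UNIV. dist (\<phi> n x) (\<psi> x) < e / (?B + 1)"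
      by (rule uniform_limitD)
    then show "\<forall>\<^sub>F n in sequentially. dist (regular_distribution u (\<phi> n)) (regular_distribution u \<psi>) < e"
    proof eventually_elim
      case (elim n)
      have "\<bar>\<integral>x. real_fun u x * (\<phi> n x - \<psi> x) \<partial>lborel\<bar> \<le> e / (?B + 1) * ?B"
      proof (rule integrable_locally_integrable_mult(2)[OF f])
        show "(\<lambda>x. \<phi> n x - \<psi> x) \<in> borel_measurable borel"
          by (intro borel_measurable_continuous_onI continuous_intros test_function_continuous \<phi> \<psi>)
        show "\<bar>\<phi> n x - \<psi> x\<bar> \<le> e / (?B + 1)" for x
          using elim by (simp add: dist_real_def less_imp_le)
      qed (rule supp)
      also have "\<dots> < e" using B e by (simp add: field_simps)
      also have "(\<integral>x. real_fun u x * (\<phi> n x - \<psi> x) \<partial>lborel) =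
          regular_distribution u (\<phi> n) - regular_distribution u \<psi>"
        using integrable_test_function[OF f \<phi>[of n]] integrable_test_function[OF f \<psi>]
        by (simp add: regular_distribution_eq \<phi> \<psi> right_diff_distrib)
      finally show ?case by (simp add: dist_real_def)
    qed
  qed
qed

lemma limitin_regular_distribution:
  assumes "\<And>k. locally_integrable (real_fun (w k))" "locally_integrable (real_fun v)"
  shows "limitin distribution_topology (\<lambda>k. regular_distribution (w k)) (regular_distribution v) sequentially \<longleftrightarrow>
    (\<forall>\<phi>\<in>test_functions. (\<lambda>k. \<integral>x. real_fun (w k) x * \<phi> x \<partial>lborel) \<longlonglongrightarrow> (\<integral>x. real_fun v x * \<phi> x \<partial>lborel))"
  unfolding distribution_topology_def limitin_subtopology limitin_componentwise
  using assms[THEN regular_distribution_in_distributions]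
  by (simp add: regular_distribution_eq regular_distribution_extensional PiE_def)

lemma Fr_iff:
  fixes V :: "real \<Rightarrow> real^'m^'m"
  assumes V: "rotation_group V" and u: "subharmonic u"
  shows "v \<in> Fr p V u \<longleftrightarrow> subharmonic v \<and> (\<exists>t. (\<forall>k. 0 < t k) \<and> filterlim t at_top sequentially \<and>
    (\<forall>\<phi>\<in>test_functions. (\<lambda>k. \<integral>x. real_fun (rescale p V u (t k)) x * \<phi> x \<partial>lborel)
      \<longlonglongrightarrow> (\<integral>x. real_fun v x * \<phi> x \<partial>lborel)))"
proof -
  have "limitin distribution_topology (\<lambda>k. regular_distribution (rescale p V u (t k))) (regular_distribution v) sequentially \<longleftrightarrow>
    (\<forall>\<phi>\<in>test_functions. (\<lambda>k. \<integral>x. real_fun (rescale p V u (t k)) x * \<phi> x \<partial>lborel) \<longlonglongrightarrow> (\<integral>x. real_fun v x * \<phi> x \<partial>lborel))"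
    if "subharmonic v" "\<forall>k. 0 < t k" for t
    using that by (intro limitin_regular_distribution subharmonic_locally_integrable subharmonic_rescale[OF V u]) auto
  then show ?thesis unfolding Fr_def by blast
qed

lemma eventually_le_imp_bounded:
  fixes X :: "nat \<Rightarrow> real"
  assumes "\<forall>\<^sub>F k in sequentially. X k \<le> C"
  shows "\<exists>C. \<forall>k. X k \<le> C"
proof -
  obtain K where K: "\<And>k. k \<ge> K \<Longrightarrow> X k \<le> C" using assms unfolding eventually_sequentially by blast
  show ?thesis
  proof (intro exI allI)
    fix k
    show "X k \<le> max C (Max (X ` {..K}))"
      using K[of k] by (cases "k \<le> K") (auto intro: le_max_iff_disj[THEN iffD2])
  qed
qed

text \<open>The uniform bound covers the large parameters; the finitely many remaining members are
  bounded one by one.\<close>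

lemma rescale_sequence_bounded_above:
  fixes V :: "real \<Rightarrow> real^'m^'m"
  assumes V: "rotation_group V" and p: "proximate_order \<rho> p" "0 < \<rho>" and u: "u \<in> SH p"
    and t: "\<And>k. 0 < t k" "filterlim t at_top sequentially"
  shows "\<exists>C. \<forall>k. \<forall>x\<in>cball 0 N. rescale p V u (t k) x \<le> ereal C"
proof -
  have su: "subharmonic u" using u by (simp add: SH_def)
  have "\<exists>c. \<forall>x\<in>cball 0 N. rescale p V u (t k) x \<le> ereal c" for k
    using subharmonic_bounded_above_compact[OF subharmonic_rescale[OF V su t(1)] compact_cball] by metis
  then obtain c where c: "\<And>k x. x \<in> cball 0 N \<Longrightarrow> rescale p V u (t k) x \<le> ereal (c k)" by metis
  obtain C t0 where C: "\<And>t x. t0 \<le> t \<Longrightarrow> x \<in> cball 0 N \<Longrightarrow> rescale p V u t x \<le> ereal C"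
    using rescale_bounded_above[OF V p u, of N] by metis
  define X where "X k = (if t0 \<le> t k then C else c k)" for k
  have "\<forall>\<^sub>F k in sequentially. t0 \<le> t k" using t(2) by (simp add: filterlim_at_top)
  then have "\<forall>\<^sub>F k in sequentially. X k \<le> C" by eventually_elim (simp add: X_def)
  then obtain C' where "\<And>k. X k \<le> C'" using eventually_le_imp_bounded by blast
  moreover have "rescale p V u (t k) x \<le> ereal (X k)" if "x \<in> cball 0 N" for k x
    using c[OF that] C[OF _ that] by (simp add: X_def)
  ultimately show ?thesis by (meson ereal_less_eq(3) order_trans)
qed

lemma rescale_limit_exists:
  fixes V :: "real \<Rightarrow> real^'m^'m"
  assumes V: "rotation_group V" and p: "proximate_order \<rho> p" "0 < \<rho>" and u: "u \<in> SH p"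
    and t: "\<And>k. 0 < t k" "filterlim t at_top sequentially" and D: "closure D = UNIV"
    and conv: "\<And>j x. x \<in> D \<Longrightarrow> convergent (\<lambda>k. mollify (1 / real (Suc j)) (real_fun (rescale p V u (t k))) x)"
  obtains w where "subharmonic w"
    "\<And>\<phi> N. continuous_on UNIV \<phi> \<Longrightarrow> (\<And>x. x \<notin> ball 0 N \<Longrightarrow> \<phi> x = 0) \<Longrightarrow>
      (\<lambda>k. \<integral>x. real_fun (rescale p V u (t k)) x * \<phi> x \<partial>lborel) \<longlonglongrightarrow> (\<integral>x. real_fun w x * \<phi> x \<partial>lborel)"
proof (rule subharmonic_compactness[OF _ _ _ D conv])
  have su: "subharmonic u" using u by (simp add: SH_def)
  show "subharmonic (rescale p V u (t k))" for k by (rule subharmonic_rescale[OF V su t(1)])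
  show "\<exists>C. \<forall>k. \<forall>x\<in>cball 0 N. rescale p V u (t k) x \<le> ereal C" for N
    by (rule rescale_sequence_bounded_above[OF V p u t])
  show "\<exists>C. \<forall>k. ball_norm N (real_fun (rescale p V u (t k))) \<le> C" for N
  proof -
    obtain K t0 where K: "\<And>t. t0 \<le> t \<Longrightarrow> ball_norm N (real_fun (rescale p V u t)) \<le> K"
      using rescale_ball_norm_bounded[OF V p u, of N] by metis
    have "\<forall>\<^sub>F k in sequentially. t0 \<le> t k" using t(2) by (simp add: filterlim_at_top)
    then have "\<forall>\<^sub>F k in sequentially. ball_norm N (real_fun (rescale p V u (t k))) \<le> K"
      by eventually_elim (rule K)
    then show ?thesis by (rule eventually_le_imp_bounded)
  qed
qed (use that in blast)+

text \<open>Kernels are test functions, so the mollifications converge and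
  \<open>rescale_limit_exists\<close> yields a subharmonic w with the stronger convergence; w has
  the same mollifications as v, hence equals v. The gain is that a test function may be composed
  with a dilation and used on the strength of continuity alone.\<close>

lemma rescale_limit_continuous_functions:
  fixes V :: "real \<Rightarrow> real^'m^'m"
  assumes V: "rotation_group V" and p: "proximate_order \<rho> p" "0 < \<rho>" and u: "u \<in> SH p"
    and t: "\<And>k. 0 < t k" "filterlim t at_top sequentially" and v: "subharmonic v"
    and lim: "\<forall>\<phi>\<in>test_functions. (\<lambda>k. \<integral>x. real_fun (rescale p V u (t k)) x * \<phi> x \<partial>lborel)
      \<longlonglongrightarrow> (\<integral>x. real_fun v x * \<phi> x \<partial>lborel)"
    and \<phi>: "continuous_on UNIV \<phi>" "\<And>x. x \<notin> ball 0 N \<Longrightarrow> \<phi> x = 0"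
  shows "(\<lambda>k. \<integral>x. real_fun (rescale p V u (t k)) x * \<phi> x \<partial>lborel) \<longlonglongrightarrow> (\<integral>x. real_fun v x * \<phi> x \<partial>lborel)"
proof -
  have limv: "(\<lambda>k. mollify R (real_fun (rescale p V u (t k))) x) \<longlonglongrightarrow> mollify R (real_fun v) x" if "0 < R" for R x
    unfolding mollify_def by (rule lim[rule_format, OF kernel_test_function[OF that]])
  obtain w where w: "subharmonic w"
    "\<And>\<phi> N. continuous_on UNIV \<phi> \<Longrightarrow> (\<And>x. x \<notin> ball 0 N \<Longrightarrow> \<phi> x = 0) \<Longrightarrow>
      (\<lambda>k. \<integral>x. real_fun (rescale p V u (t k)) x * \<phi> x \<partial>lborel) \<longlonglongrightarrow> (\<integral>x. real_fun w x * \<phi> x \<partial>lborel)"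
  proof (rule rescale_limit_exists[OF V p u t closure_UNIV])
    show "convergent (\<lambda>k. mollify (1 / real (Suc j)) (real_fun (rescale p V u (t k))) x)" for j x
      by (rule convergentI[OF limv]) simp
  qed blast
  have "v = w"
  proof (rule subharmonic_eqI[OF v w(1)])
    fix j x
    let ?R = "1 / real (Suc j)"
    have "(\<lambda>k. mollify ?R (real_fun (rescale p V u (t k))) x) \<longlonglongrightarrow> mollify ?R (real_fun w) x"
      unfolding mollify_def
      by (rule w(2)[OF _ kernel_shift_support[OF _ order_refl]]) (auto intro!: continuous_intros)
    from LIMSEQ_unique[OF limv this]
    show "mollify ?R (real_fun v) x = mollify ?R (real_fun w) x" by simp
  qed
  then show ?thesis using w(2)[OF \<phi>] by simp
qed

text \<open>Weak convergence gives no pointwise bound directly. The growth bound is passed to the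
  mollifications of v, and then their radius tends to 0. The value at the origin is squeezed by
  means centred there.\<close>

lemma Fr_subset_U:
  fixes V :: "real \<Rightarrow> real^'m^'m"
  assumes V: "rotation_group V" and p: "proximate_order \<rho> p" "0 < \<rho>" and u: "u \<in> SH p"
    and \<sigma>: "growth_type p u \<le> ereal \<sigma>"
  shows "Fr p V u \<subseteq> U \<rho> \<sigma>"
proof
  fix v assume "v \<in> Fr p V u"
  have su: "subharmonic u" using u by (simp add: SH_def)
  obtain t where v: "subharmonic v" and t: "\<And>k. 0 < t k" "filterlim t at_top sequentially"
    and lim: "\<forall>\<phi>\<in>test_functions. (\<lambda>k. \<integral>x. real_fun (rescale p V u (t k)) x * \<phi> x \<partial>lborel)
      \<longlonglongrightarrow> (\<integral>x. real_fun v x * \<phi> x \<partial>lborel)"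
    using \<open>v \<in> Fr p V u\<close> unfolding Fr_iff[OF V su] by blast
  have limv: "(\<lambda>k. mollify R (real_fun (rescale p V u (t k))) x) \<longlonglongrightarrow> mollify R (real_fun v) x"
    if "0 < R" for R x
    unfolding mollify_def by (rule lim[rule_format, OF kernel_test_function[OF that]])
  have small_radii: "\<forall>\<^sub>F R in at_right 0. 0 < R \<and> R < c" if "0 < c" for c :: real
    using that by (auto simp: eventually_at_right_field)
  \<comment> \<open>The upper limit bounds u eventually only with a constant above \<sigma>; it is
    lowered to \<sigma> afterwards.\<close>
  have bound_away: "v x \<le> ereal (\<sigma>' * norm x powr \<rho>)" if "\<sigma> < \<sigma>'" "x \<noteq> 0" for \<sigma>' x
  proof -
    let ?n = "norm x"
    have n: "0 < ?n" using \<open>x \<noteq> 0\<close> by simp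
    have "growth_type p u < ereal \<sigma>'" using \<sigma> \<open>\<sigma> < \<sigma>'\<close> by (meson ereal_less(1) less_ereal.simps(1) order_le_less_trans)
    then obtain r1 where r1: "0 < r1" "\<And>t x. 0 < t \<Longrightarrow> r1 \<le> t * norm x \<Longrightarrow>
        rescale p V u t x \<le> ereal (\<sigma>' * (growth_fun p (t * norm x) / growth_fun p t))"
      using rescale_upper_bound[OF V] by metis
    obtain r2 where r2: "0 < r2" "\<And>r s. r2 \<le> r \<Longrightarrow> r \<le> s \<Longrightarrow> growth_fun p r \<le> growth_fun p s"
      using growth_fun_eventually_mono[OF p] by metis
    \<comment> \<open>Both extremes of |y| over the ball of radius R about x occur, because
      \<sigma>' may have either sign: the outer one gives the larger value for \<sigma>' \<ge> 0,
      the inner one for \<sigma>' < 0.\<close>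
    let ?h = "\<lambda>R. max (\<sigma>' * (?n + R) powr \<rho>) (\<sigma>' * (?n - R) powr \<rho>)"
    have "mollify R (real_fun v) x \<le> ?h R" if R: "0 < R" "R < ?n / 2" for R
    proof (rule tendsto_le[OF sequentially_bot _ limv[OF R(1)]])
      let ?q = "\<lambda>c k. growth_fun p (t k * c) / growth_fun p (t k)"
      have q: "(\<lambda>k. \<sigma>' * ?q c k) \<longlonglongrightarrow> \<sigma>' * c powr \<rho>" if "0 < c" for c
        by (intro tendsto_mult tendsto_const filterlim_compose[OF growth_fun_regularly_varying[OF p(1) that] t(2)])
      show "(\<lambda>k. max (\<sigma>' * ?q (?n + R) k) (\<sigma>' * ?q (?n - R) k)) \<longlonglongrightarrow> ?h R"
        by (intro tendsto_max q) (use R n in auto)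
      have "\<forall>\<^sub>F k in sequentially. max r1 r2 / (?n - R) \<le> t k"
        using t(2) by (simp add: filterlim_at_top)
      then show "\<forall>\<^sub>F k in sequentially. mollify R (real_fun (rescale p V u (t k))) x
          \<le> max (\<sigma>' * ?q (?n + R) k) (\<sigma>' * ?q (?n - R) k)"
      proof eventually_elim
        case (elim k)
        have nR: "0 < ?n - R" using R n by simp
        have big: "max r1 r2 \<le> t k * (?n - R)" using elim nR by (simp add: pos_divide_le_eq)
        have L: "0 < growth_fun p (t k)" by (rule growth_fun_pos[OF t(1)])
        show ?case
        proof (rule subharmonic_mollify_le[OF subharmonic_rescale[OF V su t(1)] R(1)])
          fix y assume "y \<in> cball x R"
          then have y: "?n - R \<le> norm y" "norm y \<le> ?n + R"
            using norm_triangle_ineq2[of x y] norm_triangle_ineq2[of y x]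
            by (auto simp: dist_norm norm_minus_commute)
          have lo: "t k * (?n - R) \<le> t k * norm y" and hi: "t k * norm y \<le> t k * (?n + R)"
            using y t(1)[of k] by (auto intro!: mult_left_mono)
          have "growth_fun p (t k * (?n - R)) \<le> growth_fun p (t k * norm y)"
            "growth_fun p (t k * norm y) \<le> growth_fun p (t k * (?n + R))"
            using big lo hi by (auto intro!: r2)
          then have qy: "?q (?n - R) k \<le> ?q (norm y) k" "?q (norm y) k \<le> ?q (?n + R) k"
            using L by (auto intro!: divide_right_mono)
          have "rescale p V u (t k) y \<le> ereal (\<sigma>' * ?q (norm y) k)"
            using big lo by (intro r1 t) auto
          also have "\<sigma>' * ?q (norm y) k \<le> max (\<sigma>' * ?q (?n + R) k) (\<sigma>' * ?q (?n - R) k)"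
          proof (cases "0 \<le> \<sigma>'")
            case True
            then show ?thesis using mult_left_mono[OF qy(2) True] by (simp only: le_max_iff_disj simp_thms)
          next
            case False
            then show ?thesis using mult_left_mono_neg[OF qy(1), of \<sigma>'] by (simp only: le_max_iff_disj) simp
          qed
          finally show "rescale p V u (t k) y \<le> ereal (max (\<sigma>' * ?q (?n + R) k) (\<sigma>' * ?q (?n - R) k))"
            by simp
        qed
      qed
    qed
    then have "v x \<le> ereal (?h R)" if "0 < R \<and> R < ?n / 2" for R
      using that subharmonic_le_mollify[OF v, of R x] by (meson ereal_less_eq(3) order_trans)
    then have ev: "\<forall>\<^sub>F R in at_right 0. v x \<le> ereal (?h R)"
      using small_radii[of "?n / 2"] n by (auto elim: eventually_mono)
    have "(?h \<longlongrightarrow> max (\<sigma>' * (?n + 0) powr \<rho>) (\<sigma>' * (?n - 0) powr \<rho>)) (at_right 0)"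
      using n by (intro tendsto_intros) auto
    then have "(?h \<longlongrightarrow> \<sigma>' * ?n powr \<rho>) (at_right 0)" by simp
    from tendsto_lowerbound[OF tendsto_ereal[OF this] ev] show ?thesis by simp
  qed
  have bound: "v x \<le> ereal (\<sigma> * norm x powr \<rho>)" if "x \<noteq> 0" for x
  proof (rule tendsto_lowerbound)
    have "((\<lambda>s. s * norm x powr \<rho>) \<longlongrightarrow> \<sigma> * norm x powr \<rho>) (at_right \<sigma>)"
      by (intro tendsto_intros)
    then show "((\<lambda>s. ereal (s * norm x powr \<rho>)) \<longlongrightarrow> ereal (\<sigma> * norm x powr \<rho>)) (at_right \<sigma>)"
      by (rule tendsto_ereal)
    show "\<forall>\<^sub>F s in at_right \<sigma>. v x \<le> ereal (s * norm x powr \<rho>)"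
      using bound_away[OF _ that] by (auto simp: eventually_at_right_field intro: exI[of _ "\<sigma> + 1"])
  qed simp
  have "v 0 = 0"
  proof (rule antisym)
    \<comment> \<open>The bound off the origin controls the mean over the ball of radius R, the
      origin being a null set; |\<sigma>| makes the bound monotone in the radius.\<close>
    have "v 0 \<le> ereal (\<bar>\<sigma>\<bar> * R powr \<rho>)" if "0 < R" for R
    proof -
      have "mollify R (real_fun v) 0 \<le> \<bar>\<sigma>\<bar> * R powr \<rho>"
      proof (rule subharmonic_mollify_le[OF v that, where z=0])
        fix y :: "real^'m" assume y: "y \<in> cball 0 R" "y \<noteq> 0"
        have "\<sigma> * norm y powr \<rho> \<le> \<bar>\<sigma>\<bar> * R powr \<rho>"
          using y p(2) by (intro mult_mono powr_mono2) auto
        then show "v y \<le> ereal (\<bar>\<sigma>\<bar> * R powr \<rho>)"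
          using bound[OF y(2)] by (meson ereal_less_eq(3) order_trans)
      qed
      then show ?thesis
        using subharmonic_le_mollify[OF v that, of 0] by (meson ereal_less_eq(3) order_trans)
    qed
    then have ev: "\<forall>\<^sub>F R in at_right 0. v 0 \<le> ereal (\<bar>\<sigma>\<bar> * R powr \<rho>)"
      by (auto simp: eventually_at_right_field intro: exI[of _ 1])
    have "((\<lambda>R. ereal (\<bar>\<sigma>\<bar> * R powr \<rho>)) \<longlongrightarrow> ereal (\<bar>\<sigma>\<bar> * 0)) (at_right 0)"
    proof -
      have "((\<lambda>R. R powr \<rho>) \<longlongrightarrow> 0 powr \<rho>) (at_right 0)"
        using p(2) by (intro tendsto_powr' tendsto_ident_at tendsto_const) (auto simp: eventually_at_right_field intro: exI[of _ 1])
      then have "((\<lambda>R. \<bar>\<sigma>\<bar> * R powr \<rho>) \<longlongrightarrow> \<bar>\<sigma>\<bar> * 0 powr \<rho>) (at_right 0)"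
        by (intro tendsto_mult tendsto_const)
      from tendsto_ereal[OF this] show ?thesis by simp
    qed
    from tendsto_lowerbound[OF this ev] show "v 0 \<le> 0" by (simp add: zero_ereal_def)
    \<comment> \<open>The means at 0 are at least a fixed number divided by
      \<open>growth_fun p (t k)\<close>, which tends to infinity.\<close>
    have "0 \<le> mollify R (real_fun v) 0" if R: "0 < R" for R
    proof (rule tendsto_le[OF sequentially_bot limv[OF R]])
      have "filterlim (\<lambda>k. growth_fun p (t k)) at_infinity sequentially"
        by (intro filterlim_at_top_imp_at_infinity filterlim_compose[OF growth_fun_at_top[OF p] t(2)])
      then show "(\<lambda>k. mollify R (real_fun u) 0 / growth_fun p (t k)) \<longlonglongrightarrow> 0"
        by (rule tendsto_divide_0[OF tendsto_const])
      have "\<forall>\<^sub>F k in sequentially. 1 \<le> t k" using t(2) by (simp add: filterlim_at_top)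
      then show "\<forall>\<^sub>F k in sequentially. mollify R (real_fun u) 0 / growth_fun p (t k)
          \<le> mollify R (real_fun (rescale p V u (t k))) 0"
        by eventually_elim (rule mollify_rescale_0_ge[OF V su _ R])
    qed
    then have "\<forall>\<^sub>F R in at_right 0. 0 \<le> ereal (mollify R (real_fun v) 0)"
      by (auto simp: eventually_at_right_field intro: exI[of _ 1])
    then show "0 \<le> v 0"
      by (rule tendsto_lowerbound[OF subharmonic_mollify_tendsto[OF v]]) simp
  qed
  moreover have "sphere_max r v \<le> ereal (\<sigma> * r powr \<rho>)" if "0 \<le> r" for r
    unfolding sphere_max_def
  proof (rule SUP_least)
    fix x :: "real^'m" assume "x \<in> sphere 0 r"
    then show "v x \<le> ereal (\<sigma> * r powr \<rho>)"
      using bound[of x] \<open>v 0 = 0\<close> by (cases "x = 0") auto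
  qed
  ultimately show "v \<in> U \<rho> \<sigma>" using v by (simp add: U_def)
qed

text \<open>The parameters t_k are replaced by t_k s. The function rescaled by t_k s is the one
  rescaled by t_k, composed with the dilation by s and multiplied by \<open>\<kappa> k\<close>,
  which tends to s^(-\<rho>) by regular variation.\<close>

lemma rescale_const_in_Fr:
  fixes V :: "real \<Rightarrow> real^'m^'m"
  assumes V: "rotation_group V" and p: "proximate_order \<rho> p" "0 < \<rho>" and u: "u \<in> SH p"
    and v: "v \<in> Fr p V u" and s: "0 < s"
  shows "rescale_const \<rho> V v s \<in> Fr p V u"
proof -
  have su: "subharmonic u" using u by (simp add: SH_def)
  obtain t where sv: "subharmonic v" and t: "\<And>k. 0 < t k" "filterlim t at_top sequentially"
    and lim: "\<forall>\<phi>\<in>test_functions. (\<lambda>k. \<integral>x. real_fun (rescale p V u (t k)) x * \<phi> x \<partial>lborel)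
      \<longlonglongrightarrow> (\<integral>x. real_fun v x * \<phi> x \<partial>lborel)"
    using v unfolding Fr_iff[OF V su] by blast
  note limc = rescale_limit_continuous_functions[OF V p u t sv lim]
  have inv: "rot_dilation V (1 / s) (rot_dilation V s x) = x" for x
    using s by (simp add: rot_dilation_mult[OF V] rot_dilation_1[OF V])
  have lin: "linear (rot_dilation V (1 / s))"
    unfolding rot_dilation_def[abs_def] by (intro linear_compose_scale_right matrix_vector_mul_linear)
  have sub: "subharmonic (rescale p V u r)" if "0 < r" for r by (rule subharmonic_rescale[OF V su that])
  define \<kappa> where "\<kappa> k = growth_fun p (t k) / growth_fun p (t k * s)" for k
  have \<kappa>: "\<kappa> \<longlonglongrightarrow> s powr (- \<rho>)"
  proof -
    have "(\<lambda>k. growth_fun p (t k * s) / growth_fun p (t k)) \<longlonglongrightarrow> s powr \<rho>"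
      by (rule filterlim_compose[OF growth_fun_regularly_varying[OF p(1) s] t(2)])
    from tendsto_inverse[OF this] show ?thesis using s by (simp add: \<kappa>_def[abs_def] powr_minus)
  qed
  have resc: "real_fun (rescale p V u (t k * s)) x = \<kappa> k * real_fun (rescale p V u (t k)) (rot_dilation V s x)" for k x
    using growth_fun_pos[OF t(1), of p k]
    by (simp add: real_fun_rescale \<kappa>_def rot_dilation_mult[OF V t(1) s])
  have resc_v: "real_fun (rescale_const \<rho> V v s) x = s powr (- \<rho>) * real_fun v (rot_dilation V s x)" for x
    by (simp add: rescale_const_def)
  show ?thesis
    unfolding Fr_iff[OF V su]
  proof (intro conjI exI[of _ "\<lambda>k. t k * s"] allI ballI)
    show "subharmonic (rescale_const \<rho> V v s)" by (rule subharmonic_rescale_const[OF V sv s])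
    show "0 < t k * s" for k using t s by simp
    show "filterlim (\<lambda>k. t k * s) at_top sequentially"
      using filterlim_tendsto_pos_mult_at_top[OF tendsto_const s t(2)] by (simp add: mult.commute)
    fix \<phi> :: "real^'m \<Rightarrow> real" assume \<phi>: "\<phi> \<in> test_functions"
    obtain N where N: "0 < N" "\<And>x. x \<notin> ball 0 N \<Longrightarrow> \<phi> x = 0" using test_function_support[OF \<phi>] by blast
    \<comment> \<open>The dilation is moved from the functions onto \<phi>, which leaves a fixed
      continuous function supported in the ball of radius s N.\<close>
    define \<psi> where "\<psi> y = \<phi> (rot_dilation V (1 / s) y)" for y
    have "continuous_on UNIV \<psi>"
      unfolding \<psi>_def
      by (rule continuous_on_compose2[OF test_function_continuous[OF \<phi>]
            linear_continuous_on[OF linear_conv_bounded_linear[THEN iffD1, OF lin]]]) simp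
    moreover have "\<psi> y = 0" if "y \<notin> ball 0 (s * N)" for y
      unfolding \<psi>_def using that s by (intro N(2)) (simp add: norm_rot_dilation[OF V] field_simps)
    ultimately have lim\<psi>: "(\<lambda>k. \<integral>x. real_fun (rescale p V u (t k)) x * \<psi> x \<partial>lborel)
        \<longlonglongrightarrow> (\<integral>x. real_fun v x * \<psi> x \<partial>lborel)"
      and \<psi>m: "\<psi> \<in> borel_measurable borel"
      using limc borel_measurable_continuous_onI by blast+
    have change: "(\<integral>x. c * f (rot_dilation V s x) * \<phi> x \<partial>lborel) = c * ((\<integral>y. f y * \<psi> y \<partial>lborel) / s ^ CARD('m))"
      if [measurable]: "f \<in> borel_measurable borel" for f c
    proof -
      note [measurable] = \<psi>m
      have "(\<integral>x. f (rot_dilation V s x) * \<psi> (rot_dilation V s x) \<partial>lborel) = (\<integral>y. f y * \<psi> y \<partial>lborel) / s ^ CARD('m)"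
        by (rule integral_rot_dilation[OF V s, of "\<lambda>y. f y * \<psi> y"]) measurable
      then show ?thesis by (simp add: \<psi>_def inv mult.assoc)
    qed
    have m: "real_fun (rescale p V u (t k)) \<in> borel_measurable borel" "real_fun v \<in> borel_measurable borel" for k
      using subharmonic_measurable[OF sub[OF t(1)]] subharmonic_measurable[OF sv]
      by (auto intro: borel_measurable_real_of_ereal)
    have "(\<lambda>k. \<kappa> k * ((\<integral>y. real_fun (rescale p V u (t k)) y * \<psi> y \<partial>lborel) / s ^ CARD('m)))
        \<longlonglongrightarrow> s powr (- \<rho>) * ((\<integral>y. real_fun v y * \<psi> y \<partial>lborel) / s ^ CARD('m))"
      using s by (intro tendsto_intros \<kappa> lim\<psi>) simp
    then show "(\<lambda>k. \<integral>x. real_fun (rescale p V u (t k * s)) x * \<phi> x \<partial>lborel)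
        \<longlonglongrightarrow> (\<integral>x. real_fun (rescale_const \<rho> V v s) x * \<phi> x \<partial>lborel)"
      unfolding resc resc_v change[OF m(1)] change[OF m(2)] .
  qed
qed

lemma rescale_const_inverse:
  fixes V :: "real \<Rightarrow> real^'m^'m"
  assumes V: "rotation_group V" and t: "0 < t"
  shows "rescale_const \<rho> V (rescale_const \<rho> V v (1 / t)) t = v"
proof
  fix x
  have "t powr (- \<rho>) * (1 / t) powr (- \<rho>) = 1"
    using t by (simp flip: powr_mult)
  then have "ereal (t powr (- \<rho>)) * (ereal ((1 / t) powr (- \<rho>)) * v x) = v x"
    by (simp flip: mult.assoc one_ereal_def)
  then show "rescale_const \<rho> V (rescale_const \<rho> V v (1 / t)) t x = v x"
    using t by (simp add: rescale_const_def rot_dilation_mult[OF V] rot_dilation_1[OF V])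
qed

text \<open>The two normalisations differ by the factor exp(-(q(t) - p(t)) ln t), which tends to 1,
  so the same sequence of parameters serves for both.\<close>

lemma Fr_proximate_order_equiv_subset:
  fixes V :: "real \<Rightarrow> real^'m^'m"
  assumes V: "rotation_group V" and u: "subharmonic u"
    and equiv: "((\<lambda>r. (q r - p r) * ln r) \<longlongrightarrow> 0) at_top"
  shows "Fr p V u \<subseteq> Fr q V u"
proof
  fix v assume "v \<in> Fr p V u"
  then obtain t where v: "subharmonic v" and t: "\<And>k. 0 < t k" "filterlim t at_top sequentially"
    and lim: "\<And>\<phi>. \<phi> \<in> test_functions \<Longrightarrow> (\<lambda>k. \<integral>x. real_fun (rescale p V u (t k)) x * \<phi> x \<partial>lborel)
      \<longlonglongrightarrow> (\<integral>x. real_fun v x * \<phi> x \<partial>lborel)"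
    unfolding Fr_iff[OF V u] by blast
  let ?\<kappa> = "\<lambda>k. exp (- ((q (t k) - p (t k)) * ln (t k)))"
  have \<kappa>: "?\<kappa> \<longlonglongrightarrow> 1"
    using tendsto_exp[OF tendsto_minus[OF filterlim_compose[OF equiv t(2)]]] by simp
  have resc: "real_fun (rescale q V u (t k)) x = ?\<kappa> k * real_fun (rescale p V u (t k)) x" for k x
    using t(1)[of k] by (simp add: rescale_def powr_def left_diff_distrib flip: exp_add)
  show "v \<in> Fr q V u"
    unfolding Fr_iff[OF V u]
  proof (intro conjI exI[of _ t] allI ballI)
    fix \<phi> :: "real^'m \<Rightarrow> real" assume "\<phi> \<in> test_functions"
    from tendsto_mult[OF \<kappa> lim[OF this]]
    show "(\<lambda>k. \<integral>x. real_fun (rescale q V u (t k)) x * \<phi> x \<partial>lborel) \<longlonglongrightarrow> (\<integral>x. real_fun v x * \<phi> x \<partial>lborel)"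
      unfolding resc mult.assoc by simp
  qed (use v t in auto)
qed

lemma Fr_proximate_order_equiv:
  fixes V :: "real \<Rightarrow> real^'m^'m"
  assumes V: "rotation_group V" and u: "subharmonic u" and equiv: "proximate_order_equiv q p"
  shows "Fr q V u = Fr p V u"
proof (rule antisym)
  have "((\<lambda>r. (q r - p r) / (1 / ln r)) \<longlongrightarrow> 0) at_top"
    using equiv unfolding proximate_order_equiv_def by (rule smalloD_tendsto)
  then have *: "((\<lambda>r. (q r - p r) * ln r) \<longlongrightarrow> 0) at_top" by simp
  then show "Fr p V u \<subseteq> Fr q V u" by (rule Fr_proximate_order_equiv_subset[OF V u])
  have "((\<lambda>r. (p r - q r) * ln r) \<longlongrightarrow> 0) at_top"
    using tendsto_minus[OF *] by (simp add: algebra_simps)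
  then show "Fr q V u \<subseteq> Fr p V u" by (rule Fr_proximate_order_equiv_subset[OF V u])
qed

subsection \<open>Compactness and connectedness\<close>

text \<open>If two closed sets split the intersection, their traces on it are disjoint compact sets,
  separated by disjoint open U and W. Compactness then puts some C m inside U \<union> W, against
  its connectedness.\<close>

lemma connectedin_nested_Inter:
  fixes C :: "nat \<Rightarrow> 'a set"
  assumes X: "Hausdorff_space X" and comp: "\<And>n. compactin X (C n)" and conn: "\<And>n. connectedin X (C n)"
    and decr: "decseq C"
  shows "connectedin X (\<Inter>n. C n)"
proof -
  let ?S = "\<Inter>n. C n"
  have closed: "closedin X (C n)" for n by (rule compactin_imp_closedin[OF X comp])
  have closedS: "closedin X ?S" by (intro closedin_Inter) (use closed in auto)
  have compS: "compactin X T" if "closedin X T" "T \<subseteq> ?S" for T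
    by (rule closed_compactin[OF comp[of 0] _ that(1)]) (use that(2) in auto)
  show ?thesis
    unfolding connectedin_closedin
  proof (intro conjI notI)
    show "?S \<subseteq> topspace X" using closedS by (rule closedin_subset)
    assume "\<exists>E1 E2. closedin X E1 \<and> closedin X E2 \<and> ?S \<subseteq> E1 \<union> E2 \<and> E1 \<inter> E2 \<inter> ?S = {} \<and>
      E1 \<inter> ?S \<noteq> {} \<and> E2 \<inter> ?S \<noteq> {}"
    then obtain E1 E2 where E: "closedin X E1" "closedin X E2" "?S \<subseteq> E1 \<union> E2" "E1 \<inter> E2 \<inter> ?S = {}"
      "E1 \<inter> ?S \<noteq> {}" "E2 \<inter> ?S \<noteq> {}"
      by (elim exE conjE) (rule that; assumption)
    have "compactin X (E1 \<inter> ?S)" "compactin X (E2 \<inter> ?S)"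
      by (intro compS closedin_Int E closedS; blast)+
    moreover have "disjnt (E1 \<inter> ?S) (E2 \<inter> ?S)" using E(4) by (auto simp: disjnt_def)
    ultimately obtain U W where UW: "openin X U" "openin X W" "E1 \<inter> ?S \<subseteq> U" "E2 \<inter> ?S \<subseteq> W" "disjnt U W"
      using Hausdorff_space_compact_separation[OF X] by metis
    have SUW: "?S \<subseteq> U \<union> W" using E(3) UW(3,4) by blast
    \<comment> \<open>A point of C 0 outside the intersection lies in the complement of some C n. In
      a finite subcover the largest index gives a C m that misses all the complements used.\<close>
    let ?O = "insert (U \<union> W) (range (\<lambda>n. topspace X - C n))"
    have "\<And>Q. Q \<in> ?O \<Longrightarrow> openin X Q" using UW(1,2) closed by (auto intro: openin_diff)
    moreover have "C 0 \<subseteq> \<Union>?O"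
    proof
      fix x assume "x \<in> C 0"
      then have "x \<in> topspace X" using closed[of 0] closedin_subset by blast
      then show "x \<in> \<Union>?O" using SUW by (cases "x \<in> ?S") auto
    qed
    ultimately obtain F where F: "finite F" "F \<subseteq> ?O" "C 0 \<subseteq> \<Union>F"
      using comp[of 0] unfolding compactin_def by meson
    then obtain I where I: "finite I" "F \<subseteq> insert (U \<union> W) ((\<lambda>n. topspace X - C n) ` I)"
    proof -
      have "finite (F - {U \<union> W})" "F - {U \<union> W} \<subseteq> range (\<lambda>n. topspace X - C n)" using F by auto
      from finite_subset_image[OF this] obtain I where
        I: "I \<subseteq> UNIV \<and> finite I \<and> F - {U \<union> W} = (\<lambda>n. topspace X - C n) ` I" ..
      have "F \<subseteq> insert (U \<union> W) (F - {U \<union> W})" by blast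
      also have "\<dots> = insert (U \<union> W) ((\<lambda>n. topspace X - C n) ` I)" using I by simp
      finally show ?thesis using I by (intro that[of I]) simp
    qed
    define m where "m = Max (insert 0 I)"
    have "C m \<subseteq> C i" if "i \<in> insert 0 I" for i
      using decr that I(1) by (auto simp: m_def decseq_def)
    then have "C m \<subseteq> U \<union> W" using F(3) I(2) by blast
    moreover have "U \<inter> C m \<noteq> {}" "W \<inter> C m \<noteq> {}" using E(5,6) UW(3,4) by blast+
    moreover have "U \<inter> W \<inter> C m = {}" using UW(5) by (auto simp: disjnt_def)
    ultimately show False using conn[of m] UW(1,2) unfolding connectedin by blast
  qed
qed

text \<open>As u need not be continuous, a substitution carries the parameter over to the continuous
  function \<phi>, where dominated convergence applies.\<close>

lemma continuous_on_rescale_integral: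
  fixes V :: "real \<Rightarrow> real^'m^'m"
  assumes V: "rotation_group V" and p: "proximate_order \<rho> p" and u: "subharmonic u"
    and \<phi>: "continuous_on UNIV \<phi>" "\<And>x. x \<notin> ball 0 N \<Longrightarrow> \<phi> x = 0"
  shows "continuous_on {0<..} (\<lambda>t. \<integral>x. real_fun (rescale p V u t) x * \<phi> x \<partial>lborel)"
proof -
  note [measurable] = locally_integrable_measurable[OF subharmonic_locally_integrable[OF u]]
    borel_measurable_continuous_onI[OF \<phi>(1)]
  have contV: "continuous_on {0<..} V" using V by (simp add: rotation_group_def)
  have cont_rot: "continuous_on {0<..} (\<lambda>t. rot_dilation V t y)" for y
    unfolding rot_dilation_def matrix_vector_mult_def
    by (intro continuous_intros continuous_on_vec_lambda contV continuous_on_component)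
  have cont_dil: "continuous_on UNIV (rot_dilation V t)" if "0 < t" for t
    unfolding rot_dilation_def[abs_def]
    by (intro continuous_intros linear_continuous_on matrix_vector_mul_bounded_linear)
  have m\<phi>: "(\<lambda>y. \<phi> (rot_dilation V t y)) \<in> borel_measurable borel" if "0 < t" for t
    by (intro borel_measurable_continuous_onI continuous_on_compose2[OF \<phi>(1) cont_dil[OF that]]) simp
  obtain B where B: "0 \<le> B" "\<And>x. \<bar>\<phi> x\<bar> \<le> B" using bounded_compact_support[OF \<phi>] by blast
  define H where "H s = (\<integral>y. real_fun u y * \<phi> (rot_dilation V s y) \<partial>lborel)" for s
  \<comment> \<open>For s > a the composites of \<phi> with the dilation by s all vanish outside the
    ball of radius |N|/a, which gives one integrable majorant.\<close>
  have H: "continuous_on {a<..} H" if a: "0 < a" for a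
    unfolding continuous_on_sequentially
  proof (intro allI ballI impI, elim conjE)
    fix X s assume s: "s \<in> {a<..}" and X: "\<forall>n. X n \<in> {a<..}" "X \<longlonglongrightarrow> s"
    have pos: "0 < X n" "a < X n" "0 < s" for n using X(1) s a by (auto intro: less_trans)
    show "(H \<circ> X) \<longlonglongrightarrow> H s"
      unfolding H_def o_def
    proof (rule integral_dominated_convergence)
      show "(\<lambda>y. real_fun u y * \<phi> (rot_dilation V s y)) \<in> borel_measurable lborel"
        using m\<phi>[OF pos(3)] by simp
      show "(\<lambda>y. real_fun u y * \<phi> (rot_dilation V (X n) y)) \<in> borel_measurable lborel" for n
        using m\<phi>[OF pos(1)] by simp
      have "integrable lborel (\<lambda>y. indicator (ball 0 (\<bar>N\<bar> / a)) y * \<bar>real_fun u y\<bar>)"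
        using locally_integrable_abs[OF subharmonic_locally_integrable[OF u]]
        unfolding locally_integrable_def set_integrable_def by simp
      then show "integrable lborel (\<lambda>y. B * (indicator (ball 0 (\<bar>N\<bar> / a)) y * \<bar>real_fun u y\<bar>))" by simp
      show "AE y in lborel. (\<lambda>n. real_fun u y * \<phi> (rot_dilation V (X n) y)) \<longlonglongrightarrow> real_fun u y * \<phi> (rot_dilation V s y)"
      proof (rule AE_I2)
        fix y
        have "(\<lambda>n. rot_dilation V (X n) y) \<longlonglongrightarrow> rot_dilation V s y"
          using continuous_on_tendsto_compose[OF cont_rot X(2)] pos by simp
        then have "(\<lambda>n. \<phi> (rot_dilation V (X n) y)) \<longlonglongrightarrow> \<phi> (rot_dilation V s y)"
          using continuous_on_tendsto_compose[OF \<phi>(1)] by simp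
        then show "(\<lambda>n. real_fun u y * \<phi> (rot_dilation V (X n) y)) \<longlonglongrightarrow> real_fun u y * \<phi> (rot_dilation V s y)"
          by (intro tendsto_intros)
      qed
      show "AE y in lborel. norm (real_fun u y * \<phi> (rot_dilation V (X n) y))
          \<le> B * (indicator (ball 0 (\<bar>N\<bar> / a)) y * \<bar>real_fun u y\<bar>)" for n
      proof (rule AE_I2)
        fix y :: "real^'m"
        show "norm (real_fun u y * \<phi> (rot_dilation V (X n) y)) \<le> B * (indicator (ball 0 (\<bar>N\<bar> / a)) y * \<bar>real_fun u y\<bar>)"
        proof (cases "y \<in> ball 0 (\<bar>N\<bar> / a)")
          case True
          have "\<bar>real_fun u y\<bar> * \<bar>\<phi> (rot_dilation V (X n) y)\<bar> \<le> \<bar>real_fun u y\<bar> * B"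
            by (intro mult_left_mono B(2) abs_ge_zero)
          with True show ?thesis by (simp add: abs_mult mult.commute)
        next
          case False
          then have "\<bar>N\<bar> \<le> a * norm y" using a by (simp add: pos_divide_le_eq not_less mult.commute)
          also have "\<dots> \<le> X n * norm y" using pos(2)[of n] by (intro mult_right_mono) auto
          finally have "\<phi> (rot_dilation V (X n) y) = 0"
            by (intro \<phi>(2)) (simp add: norm_rot_dilation[OF V pos(1)])
          moreover have "0 \<le> B * (indicator (ball 0 (\<bar>N\<bar> / a)) y * \<bar>real_fun u y\<bar>)"
            by (intro mult_nonneg_nonneg B(1) indicator_pos_le abs_ge_zero)
          ultimately show ?thesis by simp
        qed
      qed
    qed
  qed
  have H': "continuous_on {0<..} H"
  proof (rule continuous_at_imp_continuous_on, rule ballI)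
    fix s :: real assume "s \<in> {0<..}"
    then have "0 < s / 2" "s \<in> {s / 2<..}" by auto
    then show "isCont H s" using H[of "s / 2"] by (metis continuous_on_eq_continuous_at open_greaterThan)
  qed
  have eq: "(\<integral>x. real_fun (rescale p V u t) x * \<phi> x \<partial>lborel) = 1 / growth_fun p t * (H (1 / t) / t ^ CARD('m))"
    if t: "0 < t" for t
  proof -
    have inv: "rot_dilation V (1 / t) (rot_dilation V t x) = x" for x
      using t by (simp add: rot_dilation_mult[OF V] rot_dilation_1[OF V])
    have "(\<integral>x. real_fun u (rot_dilation V t x) * \<phi> (rot_dilation V (1 / t) (rot_dilation V t x)) \<partial>lborel) = H (1 / t) / t ^ CARD('m)"
      unfolding H_def using m\<phi>[of "1 / t"] t
      by (intro integral_rot_dilation[OF V t, of "\<lambda>y. real_fun u y * \<phi> (rot_dilation V (1 / t) y)"]) auto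
    then show ?thesis by (simp add: inv real_fun_rescale mult.assoc)
  qed
  have "continuous_on {0<..} (\<lambda>t. 1 / growth_fun p t * (H (1 / t) / t ^ CARD('m)))"
    using growth_fun_pos[of _ p]
    by (intro continuous_intros continuous_on_growth_fun[OF p] continuous_on_compose2[OF H']) (auto simp: less_le)
  then show ?thesis by (rule continuous_on_eq) (simp add: eq)
qed

text \<open>For large t this is the L^1 bound; on the remaining compact interval it is continuity in
  t.\<close>

lemma rescale_integral_bounded:
  fixes V :: "real \<Rightarrow> real^'m^'m"
  assumes V: "rotation_group V" and p: "proximate_order \<rho> p" "0 < \<rho>" and u: "u \<in> SH p"
    and \<phi>: "\<phi> \<in> test_functions"
  shows "\<exists>B. \<forall>t\<ge>1. \<bar>\<integral>x. real_fun (rescale p V u t) x * \<phi> x \<partial>lborel\<bar> \<le> B"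
proof -
  have su: "subharmonic u" using u by (simp add: SH_def)
  have cont: "continuous_on UNIV \<phi>" by (rule test_function_continuous[OF \<phi>])
  obtain N where N: "\<And>x. x \<notin> ball 0 N \<Longrightarrow> \<phi> x = 0" using test_function_support[OF \<phi>] by blast
  obtain b where b: "0 \<le> b" "\<And>x. \<bar>\<phi> x\<bar> \<le> b" using bounded_compact_support[OF cont N] by blast
  let ?I = "\<lambda>t. \<integral>x. real_fun (rescale p V u t) x * \<phi> x \<partial>lborel"
  obtain K t0 where K: "1 \<le> t0" "\<And>t. t0 \<le> t \<Longrightarrow> ball_norm N (real_fun (rescale p V u t)) \<le> K"
    using rescale_ball_norm_bounded[OF V p u, of N] by metis
  have large: "\<bar>?I t\<bar> \<le> b * K" if "t0 \<le> t" for t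
  proof -
    have "locally_integrable (real_fun (rescale p V u t))"
      using K(1) that by (intro subharmonic_locally_integrable subharmonic_rescale[OF V su]) simp
    then have "\<bar>?I t\<bar> \<le> b * ball_norm N (real_fun (rescale p V u t))"
      by (intro integrable_locally_integrable_mult(2) borel_measurable_continuous_onI cont b(2) N)
    also have "\<dots> \<le> b * K" by (intro mult_left_mono K(2) that b(1))
    finally show ?thesis .
  qed
  have contI: "continuous_on {1..t0} ?I"
    by (rule continuous_on_subset[OF continuous_on_rescale_integral[OF V p(1) su cont N]]) auto
  have "bounded (?I ` {1..t0})"
    by (intro compact_imp_bounded compact_continuous_image contI compact_Icc)
  then obtain B where B: "\<And>t. t \<in> {1..t0} \<Longrightarrow> \<bar>?I t\<bar> \<le> B"
    unfolding bounded_iff ball_simps real_norm_def by blast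
  show ?thesis
  proof (intro exI[of _ "max B (b * K)"] allI impI)
    fix t :: real assume "1 \<le> t"
    then show "\<bar>?I t\<bar> \<le> max B (b * K)"
      using B[of t] large[of t] by (cases "t0 \<le> t") (auto simp: le_max_iff_disj)
  qed
qed

text \<open>For each k there is a parameter t \<ge> k + 1 at which T is approximated within 1/(k +
  1) on the first k + 1 tests. Hence one sequence serves any countable family of tests, though not
  necessarily all of them.\<close>

lemma weak_closure_sequence:
  fixes A :: "real \<Rightarrow> ('a::euclidean_space \<Rightarrow> real) \<Rightarrow> real" and e :: "nat \<Rightarrow> 'a \<Rightarrow> real"
  assumes T: "\<And>n::nat. T \<in> powertop_real test_functions closure_of (A ` {real (Suc n)..})"
    and e: "\<And>i. e i \<in> test_functions"
  obtains t where "\<And>k. 0 < t k" "filterlim t at_top sequentially"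
    "\<And>i. (\<lambda>k. A (t k) (e i)) \<longlonglongrightarrow> T (e i)"
proof -
  have "\<exists>t\<ge>real (Suc k). \<forall>i\<le>k. \<bar>A t (e i) - T (e i)\<bar> < 1 / real (Suc k)" for k
  proof -
    let ?O = "\<lambda>i. {S \<in> topspace (powertop_real test_functions). S (e i) \<in> ball (T (e i)) (1 / real (Suc k))}"
    have "openin (powertop_real test_functions) (\<Inter>i\<in>{..k}. ?O i)"
    proof (rule openin_Inter)
      show "openin (powertop_real test_functions) W" if "W \<in> ?O ` {..k}" for W
      proof -
        obtain i where "W = ?O i" using \<open>W \<in> ?O ` {..k}\<close> by blast
        moreover have "openin (powertop_real test_functions) (?O i)"
          by (rule openin_continuous_map_preimage[OF continuous_map_product_projection[OF e]]) simp
        ultimately show ?thesis by (simp only:)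
      qed
    qed auto
    moreover have "T \<in> (\<Inter>i\<in>{..k}. ?O i)" using T[of 0] by (auto simp: in_closure_of)
    ultimately obtain y where "y \<in> A ` {real (Suc k)..}" "y \<in> (\<Inter>i\<in>{..k}. ?O i)"
      using T[of k] unfolding in_closure_of by meson
    then show ?thesis by (auto simp: dist_real_def abs_minus_commute)
  qed
  then obtain t where t: "\<And>k. real (Suc k) \<le> t k" "\<And>k i. i \<le> k \<Longrightarrow> \<bar>A (t k) (e i) - T (e i)\<bar> < 1 / real (Suc k)"
    by metis
  show thesis
  proof (rule that)
    show "0 < t k" for k using t(1)[of k] by simp
    show "filterlim t at_top sequentially"
      by (rule filterlim_at_top_mono[OF filterlim_real_sequentially])
         (use t(1) in \<open>auto intro!: always_eventually order_trans[OF _ t(1)]\<close>)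
    fix i
    have "(\<lambda>k. 1 / real (Suc k)) \<longlonglongrightarrow> 0" using LIMSEQ_Suc[OF lim_1_over_n] .
    then have "(\<lambda>k. A (t k) (e i) - T (e i)) \<longlonglongrightarrow> 0"
    proof (rule Lim_null_comparison[rotated])
      show "\<forall>\<^sub>F k in sequentially. norm (A (t k) (e i) - T (e i)) \<le> 1 / real (Suc k)"
        unfolding eventually_sequentially real_norm_def using t(2) less_imp_le by blast
    qed
    then show "(\<lambda>k. A (t k) (e i)) \<longlonglongrightarrow> T (e i)" by (rule LIM_zero_cancel)
  qed
qed

text \<open>From right to left, each test function \<phi> gets its own sequence, chosen to converge
  also on a countable family of kernels. The limit function is determined by the values of T on
  these kernels, so it is the same for every \<phi> and represents T.\<close>

lemma Fr_closure:
  fixes V :: "real \<Rightarrow> real^'m^'m"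
  assumes V: "rotation_group V" and p: "proximate_order \<rho> p" "0 < \<rho>" and u: "u \<in> SH p"
  shows "regular_distribution ` Fr p V u =
    (\<Inter>n::nat. powertop_real test_functions closure_of ((\<lambda>t. regular_distribution (rescale p V u t)) ` {real (Suc n)..}))"
    (is "_ = (\<Inter>n. ?C n)")
proof (intro equalityI subsetI)
  have su: "subharmonic u" using u by (simp add: SH_def)
  let ?A = "\<lambda>t. regular_distribution (rescale p V u t)"
  {
    fix T assume "T \<in> regular_distribution ` Fr p V u"
    then obtain v where T: "T = regular_distribution v" and "v \<in> Fr p V u" by blast
    then obtain t where t: "filterlim t at_top sequentially"
      and "limitin distribution_topology (\<lambda>k. ?A (t k)) T sequentially"
      unfolding Fr_def by blast
    then have lim: "limitin (powertop_real test_functions) (\<lambda>k. ?A (t k)) T sequentially"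
      unfolding distribution_topology_def limitin_subtopology by blast
    show "T \<in> (\<Inter>n. ?C n)"
    proof
      fix n
      show "T \<in> ?C n"
        unfolding in_closure_of
      proof (intro conjI allI impI)
        show "T \<in> topspace (powertop_real test_functions)" using lim by (rule limitin_topspace)
        fix W assume "T \<in> W \<and> openin (powertop_real test_functions) W"
        then have "\<forall>\<^sub>F k in sequentially. ?A (t k) \<in> W" using lim unfolding limitin_def by blast
        moreover have "\<forall>\<^sub>F k in sequentially. real (Suc n) \<le> t k" using t unfolding filterlim_at_top by blast
        ultimately have "\<forall>\<^sub>F k in sequentially. ?A (t k) \<in> W \<and> real (Suc n) \<le> t k" by (rule eventually_conj)
        then obtain k where "?A (t k) \<in> W" "real (Suc n) \<le> t k" unfolding eventually_sequentially by blast
        then show "\<exists>y. y \<in> ?A ` {real (Suc n)..} \<and> y \<in> W" by blast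
      qed
    qed
  next
    fix T assume T: "T \<in> (\<Inter>n. ?C n)"
    then have Tc: "T \<in> ?C n" for n by blast
    obtain D :: "(real^'m) set" where "countable D" and D: "\<And>X. open X \<Longrightarrow> X \<noteq> {} \<Longrightarrow> \<exists>d\<in>D. d \<in> X"
      using countable_dense_setE by blast
    have dense: "closure D = UNIV"
      unfolding closure_approachable set_eq_iff
    proof (intro allI iffI UNIV_I impI)
      fix x :: "real^'m" and e :: real assume "0 < e"
      then show "\<exists>y\<in>D. dist y x < e" using D[of "ball x e"] by (auto simp: dist_commute)
    qed
    have "D \<noteq> {}" using D[of UNIV] by auto
    define \<psi> where "\<psi> = (\<lambda>(j, x) y. bump_kernel (1 / real (Suc j)) (y - (x::real^'m)))"
    define d where "d = from_nat_into ((UNIV :: nat set) \<times> D)"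
    have range_d: "range d = (UNIV :: nat set) \<times> D"
      unfolding d_def using \<open>countable D\<close> \<open>D \<noteq> {}\<close> by (intro range_from_nat_into) auto
    have \<psi>: "\<psi> q \<in> test_functions" for q
      by (cases q) (simp add: \<psi>_def kernel_test_function)
    have ex: "\<exists>w. w \<in> Fr p V u \<and> T \<phi> = regular_distribution w \<phi> \<and>
        (\<forall>j. \<forall>x\<in>D. mollify (1 / real (Suc j)) (real_fun w) x = T (\<psi> (j, x)))"
      if \<phi>: "\<phi> \<in> test_functions" for \<phi>
    proof -
      \<comment> \<open>Index 0 is the test function in question, the other indices enumerate the
        kernels.\<close>
      define e where "e i = (case i of 0 \<Rightarrow> \<phi> | Suc n \<Rightarrow> \<psi> (d n))" for i
      have e: "e i \<in> test_functions" for i by (cases i) (auto simp: e_def \<phi> \<psi>)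
      obtain t where t: "\<And>k. 0 < t k" "filterlim t at_top sequentially"
        and lim: "\<And>i. (\<lambda>k. ?A (t k) (e i)) \<longlonglongrightarrow> T (e i)"
        using weak_closure_sequence[of T ?A e, OF Tc e] by metis
      have lim\<psi>: "(\<lambda>k. mollify (1 / real (Suc j)) (real_fun (rescale p V u (t k))) x) \<longlonglongrightarrow> T (\<psi> (j, x))"
        if "x \<in> D" for j x
      proof -
        have "(j, x) \<in> range d" using range_d that by simp
        then obtain n where "(j, x) = d n" by blast
        then have "e (Suc n) = \<psi> (j, x)" by (simp add: e_def)
        then show ?thesis
          using lim[of "Suc n"] \<psi>[of "(j, x)"] by (simp add: regular_distribution_eq mollify_def \<psi>_def)
      qed
      obtain w where w: "subharmonic w"
        "\<And>\<phi> N. continuous_on UNIV \<phi> \<Longrightarrow> (\<And>x. x \<notin> ball 0 N \<Longrightarrow> \<phi> x = 0) \<Longrightarrow>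
          (\<lambda>k. \<integral>x. real_fun (rescale p V u (t k)) x * \<phi> x \<partial>lborel) \<longlonglongrightarrow> (\<integral>x. real_fun w x * \<phi> x \<partial>lborel)"
      proof (rule rescale_limit_exists[OF V p u t dense])
        show "convergent (\<lambda>k. mollify (1 / real (Suc j)) (real_fun (rescale p V u (t k))) x)" if "x \<in> D" for j x
          by (rule convergentI[OF lim\<psi>[OF that]])
      qed blast
      have limw: "(\<lambda>k. \<integral>x. real_fun (rescale p V u (t k)) x * \<theta> x \<partial>lborel) \<longlonglongrightarrow> (\<integral>x. real_fun w x * \<theta> x \<partial>lborel)"
        if "\<theta> \<in> test_functions" for \<theta>
        using test_function_support[OF that] w(2)[OF test_function_continuous[OF that]] by metis
      have "w \<in> Fr p V u" unfolding Fr_iff[OF V su] using w(1) t limw by blast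
      moreover have "T \<phi> = regular_distribution w \<phi>"
        using LIMSEQ_unique[OF lim[of 0]] limw[OF \<phi>] \<phi> by (simp add: e_def regular_distribution_eq)
      moreover have "mollify (1 / real (Suc j)) (real_fun w) x = T (\<psi> (j, x))" if "x \<in> D" for j x
      proof -
        have "(\<lambda>k. mollify (1 / real (Suc j)) (real_fun (rescale p V u (t k))) x)
            \<longlonglongrightarrow> mollify (1 / real (Suc j)) (real_fun w) x"
          using limw[OF \<psi>[of "(j, x)"]] by (simp add: mollify_def \<psi>_def)
        then show ?thesis by (rule LIMSEQ_unique[OF _ lim\<psi>[OF that]])
      qed
      ultimately show ?thesis by blast
    qed
    \<comment> \<open>Mollifications of a fixed radius are continuous, so agreement on D is
      agreement everywhere, and this determines a subharmonic function.\<close>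
    have unique: "w = w'"
      if w: "w \<in> Fr p V u" "\<forall>j. \<forall>x\<in>D. mollify (1 / real (Suc j)) (real_fun w) x = T (\<psi> (j, x))"
        and w': "w' \<in> Fr p V u" "\<forall>j. \<forall>x\<in>D. mollify (1 / real (Suc j)) (real_fun w') x = T (\<psi> (j, x))" for w w'
    proof (rule subharmonic_eqI)
      show sw: "subharmonic w" "subharmonic w'" using w(1) w'(1) by (auto simp: Fr_def)
      fix j x
      let ?R = "1 / real (Suc j)"
      have cont: "continuous_on (closure D) (\<lambda>x. mollify ?R (real_fun w) x - mollify ?R (real_fun w') x)"
        using continuous_on_mollify[OF subharmonic_locally_integrable[OF sw(1)], of ?R]
          continuous_on_mollify[OF subharmonic_locally_integrable[OF sw(2)], of ?R]
        unfolding dense by (intro continuous_on_diff) auto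
      have "mollify ?R (real_fun w) x - mollify ?R (real_fun w') x = 0"
        by (rule continuous_constant_on_closure[OF cont]) (use w(2) w'(2) dense in auto)
      then show "mollify ?R (real_fun w) x = mollify ?R (real_fun w') x" by simp
    qed
    obtain w where w: "w \<in> Fr p V u" "\<forall>j. \<forall>x\<in>D. mollify (1 / real (Suc j)) (real_fun w) x = T (\<psi> (j, x))"
      using ex[OF \<psi>] by blast
    have "T \<phi> = regular_distribution w \<phi>" if "\<phi> \<in> test_functions" for \<phi>
      using ex[OF that] unique[OF w] by blast
    moreover have "T \<in> extensional test_functions"
      using Tc[of 0] by (auto simp: in_closure_of PiE_def)
    ultimately have "T = regular_distribution w"
      by (intro extensionalityI[OF _ regular_distribution_extensional])
    then show "T \<in> regular_distribution ` Fr p V u" using w(1) by blast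
  }
qed

text \<open>The work is done in the full product, where Tychonoff's theorem applies: the closures of
  the curves might leave \<open>distributions\<close>, but their intersection lies in it, so
  compactness and connectedness pass to the subspace.\<close>

lemma Fr_compact_connected:
  fixes V :: "real \<Rightarrow> real^'m^'m"
  assumes V: "rotation_group V" and p: "proximate_order \<rho> p" "0 < \<rho>" and u: "u \<in> SH p"
  shows "compactin distribution_topology (regular_distribution ` Fr p V u)"
    and "connectedin distribution_topology (regular_distribution ` Fr p V u)"
proof -
  have su: "subharmonic u" using u by (simp add: SH_def)
  let ?A = "\<lambda>t. regular_distribution (rescale p V u t)"
  let ?C = "\<lambda>n::nat. powertop_real test_functions closure_of (?A ` {real (Suc n)..})"
  have Haus: "Hausdorff_space (powertop_real test_functions :: ((real^'m \<Rightarrow> real) \<Rightarrow> real) topology)"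
    by (simp add: Hausdorff_space_product_topology)
  have "\<exists>B. \<forall>t\<ge>1. \<bar>?A t \<phi>\<bar> \<le> B" if "\<phi> \<in> test_functions" for \<phi>
    using rescale_integral_bounded[OF V p u that] that by (simp add: regular_distribution_eq)
  then obtain B where B: "\<And>\<phi> t. \<phi> \<in> test_functions \<Longrightarrow> 1 \<le> t \<Longrightarrow> \<bar>?A t \<phi>\<bar> \<le> B \<phi>" by metis
  \<comment> \<open>The bounds hold for all t \<ge> 1, hence on every ray starting at n + 1, so this
    box contains all the curves.\<close>
  let ?K = "PiE test_functions (\<lambda>\<phi>. {- B \<phi>..B \<phi>})"
  have K: "compactin (powertop_real test_functions) ?K" by (simp add: compactin_PiE compactin_euclidean_iff)
  have sub: "?A ` {real (Suc n)..} \<subseteq> ?K" for n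
  proof (intro image_subsetI)
    fix t assume "t \<in> {real (Suc n)..}"
    then have "1 \<le> t" by simp
    from B[OF _ this] show "?A t \<in> ?K"
      unfolding PiE_iff using regular_distribution_extensional by (simp add: abs_le_iff minus_le_iff)
  qed
  have "?C n \<subseteq> ?K" for n
    by (rule closure_of_minimal[OF sub compactin_imp_closedin[OF Haus K]])
  then have comp: "compactin (powertop_real test_functions) (?C n)" for n
    by (intro closed_compactin[OF K]) auto
  have "continuous_map (top_of_set {0<..}) (powertop_real test_functions) ?A"
    unfolding continuous_map_componentwise
  proof (intro conjI ballI)
    show "?A ` topspace (top_of_set {0<..}) \<subseteq> extensional test_functions"
      using regular_distribution_extensional by blast
    fix \<phi> :: "real^'m \<Rightarrow> real" assume \<phi>: "\<phi> \<in> test_functions"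
    obtain N where "\<And>x. x \<notin> ball 0 N \<Longrightarrow> \<phi> x = 0" using test_function_support[OF \<phi>] by blast
    from continuous_on_rescale_integral[OF V p(1) su test_function_continuous[OF \<phi>] this]
    show "continuous_map (top_of_set {0<..}) euclideanreal (\<lambda>t. ?A t \<phi>)"
      using \<phi> by (simp add: regular_distribution_eq)
  qed
  moreover have "connectedin (top_of_set {0<..}) {real (Suc n)..}" for n
    by (simp add: connectedin_subtopology connectedin_iff_connected subset_iff connected_Ici)
  ultimately have conn: "connectedin (powertop_real test_functions) (?C n)" for n
    by (intro connectedin_closure_of connectedin_continuous_map_image)
  have decr: "decseq ?C"
    by (intro decseq_SucI closure_of_mono image_mono) auto
  have subD: "regular_distribution ` Fr p V u \<subseteq> distributions"
    using regular_distribution_in_distributions[OF subharmonic_locally_integrable] by (auto simp: Fr_def)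
  have "compactin (powertop_real test_functions) (\<Inter>n. ?C n)"
    by (rule closed_compactin_Inter[OF comp[of 0] rangeI[of ?C 0]]) auto
  then show "compactin distribution_topology (regular_distribution ` Fr p V u)"
    using subD unfolding distribution_topology_def compactin_subtopology Fr_closure[OF V p u] by blast
  show "connectedin distribution_topology (regular_distribution ` Fr p V u)"
    using connectedin_nested_Inter[OF Haus comp conn decr] subD
    unfolding distribution_topology_def connectedin_subtopology Fr_closure[OF V p u] by blast
qed

theorem theorem3p1p2p2:
  fixes V :: "real \<Rightarrow> real^'m^'m"
    and u :: "real^'m \<Rightarrow> ereal"
    and p :: "real \<Rightarrow> real"
    and \<rho> :: real
  assumes "CARD('m) \<ge> 2"
    and "0 < \<rho>"
    and "rotation_group V"
    and "proximate_order \<rho> p"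
    and "u \<in> SH p"
  shows "(compactin distribution_topology (regular_distribution ` Fr p V u) \<and>
          connectedin distribution_topology (regular_distribution ` Fr p V u)) \<and>
         (\<forall>\<sigma>::real. growth_type p u \<le> ereal \<sigma> \<longrightarrow> Fr p V u \<subseteq> U \<rho> \<sigma>) \<and>
         (\<forall>t>0. (\<lambda>v. rescale_const \<rho> V v t) ` Fr p V u = Fr p V u) \<and>
         (\<forall>p\<^sub>1. proximate_order \<rho> p\<^sub>1 \<and> proximate_order_equiv p\<^sub>1 p \<longrightarrow>
           Fr p\<^sub>1 V u = Fr p V u)"
proof (intro conjI allI impI)
  have u: "subharmonic u" using assms(5) by (simp add: SH_def)
  show "compactin distribution_topology (regular_distribution ` Fr p V u)"
    and "connectedin distribution_topology (regular_distribution ` Fr p V u)"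
    by (rule Fr_compact_connected[OF assms(3,4,2,5)])+
  show "Fr p V u \<subseteq> U \<rho> \<sigma>" if "growth_type p u \<le> ereal \<sigma>" for \<sigma>
    by (rule Fr_subset_U[OF assms(3,4,2,5) that])
  show "(\<lambda>v. rescale_const \<rho> V v t) ` Fr p V u = Fr p V u" if t: "0 < t" for t
  proof (intro equalityI subsetI)
    fix v assume "v \<in> (\<lambda>v. rescale_const \<rho> V v t) ` Fr p V u"
    then show "v \<in> Fr p V u" using rescale_const_in_Fr[OF assms(3,4,2,5) _ t] by blast
  next
    fix v assume "v \<in> Fr p V u"
    \<comment> \<open>Scaling by 1/t supplies the preimage of v and stays in the limit set by the
      inclusion just used.\<close>
    then have "rescale_const \<rho> V v (1 / t) \<in> Fr p V u"
      using t by (intro rescale_const_in_Fr[OF assms(3,4,2,5)]) auto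
    then show "v \<in> (\<lambda>v. rescale_const \<rho> V v t) ` Fr p V u"
      using rescale_const_inverse[OF assms(3) t, of \<rho> v] by (metis imageI)
  qed
  show "Fr p\<^sub>1 V u = Fr p V u" if "proximate_order \<rho> p\<^sub>1 \<and> proximate_order_equiv p\<^sub>1 p" for p\<^sub>1
    using Fr_proximate_order_equiv[OF assms(3) u] that by blast
qed

end
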